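(* Let $(G,K)$ be a proper pair of quasireductive supergroups over $\mathbb{C}$. Then the functor $F:\overline{\operatorname{Rep} G}\to\overline{\operatorname{Rep} K}$ between semisimplifications induced by the restriction functor $\operatorname{Res}^G_K:\operatorname{Rep} G\to\operatorname{Rep} K$ is full.
   Context: All supergroups are affine algebraic supergroups over $\mathbb{C}$. A supergroup $G$ is quasireductive if the identity component of its underlying even algebraic group $G_0$ is reductive ($G$ need not be connected). $\mathfrak{g}=\mathfrak{g}_{\bar 0}\oplus\mathfrak{g}_{\bar 1}$ is its Lie superalgebra. $\operatorname{Rep} G$ is the category of finite-dimensional $G$-modules (with even morphisms), a rigid symmetric monoidal category. $\operatorname{Ind}_K^G$ is the right adjoint of restriction, with values in (possibly infinite-dimensional) locally finite algebraic $G$-modules; $\mathbb{C}$ denotes the trivial module. A quasireductive subgroup $K\subseteq G$ is splitting if the natural $G$-map $\mathbb{C}\to\operatorname{Ind}_K^G\mathbb{C}$ given by adjunction has a $G$-equivariant splitting $\operatorname{Ind}_K^G\mathbb{C}\to\mathbb{C}$. An element $x\in\mathfrak{g}_{\bar 1}$ is homological if $[x,x]$ is a semisimple element of $\mathfrak{g}_{\bar 0}$; $\mathfrak{g}_{\bar 1}^{hom}$ is the set of such elements. For such $x$ and a $G$-module $M$, $DS_xM=\operatorname{Ker}(x)/(\operatorname{Im}(x)\cap\operatorname{Ker}(x))$, where $x$ acts $M\to M$. A pair $(G,K)$, with $G$ quasireductive and $K\subset G$ a splitting subgroup, is proper if for some $x\in\mathfrak{k}_{\bar 1}^{hom}$ (where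 $\mathfrak{k}=\operatorname{Lie}K$) one has $DS_x\operatorname{Ind}^G_K\mathbb{C}=\mathbb{C}$. Semisimplification: in $\mathcal{C}=\operatorname{Rep} G$, the trace (supertrace) of $f:X\to X$ is the scalar $\mathbf 1\xrightarrow{\operatorname{coev}}X\otimes X^*\xrightarrow{f\otimes 1}X\otimes X^*\cong X^*\otimes X\xrightarrow{\operatorname{ev}}\mathbf 1$; a morphism $f:X\to Y$ is negligible if $\operatorname{tr}(fg)=0$ for all $g:Y\to X$. The negligible morphisms form a tensor ideal $\mathcal{N}$, and $\overline{\mathcal C}=\mathcal C/\mathcal N$, with quotient functor $S:\mathcal C\to\overline{\mathcal C}$. For a splitting subgroup $K\subset G$ the functor $\operatorname{Res}^G_K$ sends negligible morphisms to negligible morphisms, so there is a unique induced functor $F:\overline{\operatorname{Rep} G}\to\overline{\operatorname{Rep} K}$ with $F\circ S=S\circ\operatorname{Res}^G_K$. *)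

theory Defs
  imports "HOL-Analysis.Abstract_Topological_Spaces" "HOL-Library.Function_Algebras"
begin

section \<open>Complex vector spaces and algebras\<close>

class complex_vector = ab_group_add +
  fixes scaleC :: "complex \<Rightarrow> 'a \<Rightarrow> 'a" (infixr "*\<^sub>C" 75)
  assumes scaleC_add_right: "c *\<^sub>C (x + y) = c *\<^sub>C x + c *\<^sub>C y"
    and scaleC_add_left: "(c + d) *\<^sub>C x = c *\<^sub>C x + d *\<^sub>C x"
    and scaleC_scaleC: "c *\<^sub>C d *\<^sub>C x = (c * d) *\<^sub>C x"
    and scaleC_one: "1 *\<^sub>C x = x"

class complex_algebra_1 = complex_vector + ring_1 +
  assumes mult_scaleC_left: "c *\<^sub>C x * y = c *\<^sub>C (x * y)"
    and mult_scaleC_right: "x * c *\<^sub>C y = c *\<^sub>C (x * y)"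

global_interpretation cvec: vector_space "scaleC :: complex \<Rightarrow> 'a \<Rightarrow> 'a::complex_vector"
  by unfold_locales (simp_all add: scaleC_add_right scaleC_add_left scaleC_scaleC scaleC_one)

global_interpretation cvecp: vector_space_pair
    "scaleC :: complex \<Rightarrow> 'a \<Rightarrow> 'a::complex_vector"
    "scaleC :: complex \<Rightarrow> 'b \<Rightarrow> 'b::complex_vector"
  by unfold_locales

instantiation complex :: complex_algebra_1
begin
definition scaleC_complex_def [simp]: "c *\<^sub>C (z::complex) = c * z"
instance by standard (simp_all add: algebra_simps)
end

instantiation "fun" :: (type, complex_vector) complex_vector
begin
definition scaleC_fun_def: "c *\<^sub>C f = (\<lambda>x. c *\<^sub>C f x)"
instance
  by standard (simp_all add: scaleC_fun_def fun_eq_iff scaleC_add_right scaleC_add_left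
      scaleC_scaleC scaleC_one)
end

lemma scaleC_fun_apply [simp]: "(c *\<^sub>C f) x = c *\<^sub>C f x"
  by (simp add: scaleC_fun_def)

definition clinear_on :: "'a::complex_vector set \<Rightarrow> ('a \<Rightarrow> 'b::complex_vector) \<Rightarrow> bool" where
  "clinear_on V f \<longleftrightarrow>
     (\<forall>u\<in>V. \<forall>v\<in>V. f (u + v) = f u + f v) \<and> (\<forall>c. \<forall>v\<in>V. f (c *\<^sub>C v) = c *\<^sub>C f v)"

definition cbilinear_on ::
  "'a::complex_vector set \<Rightarrow> 'b::complex_vector set \<Rightarrow> ('a \<Rightarrow> 'b \<Rightarrow> 'c::complex_vector) \<Rightarrow> bool" where
  "cbilinear_on V W f \<longleftrightarrow>
     (\<forall>w\<in>W. clinear_on V (\<lambda>v. f v w)) \<and> (\<forall>v\<in>V. clinear_on W (f v))"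


section \<open>The tensor product over the complex numbers\<close>

text \<open>A list of pairs stands for the corresponding sum of pure tensors; the tensor product is the
  quotient of such formal sums by the bilinearity relations.\<close>

inductive tensor_eq ::
  "('a::complex_vector \<times> 'b::complex_vector) list \<Rightarrow> ('a \<times> 'b) list \<Rightarrow> bool" where
  pairs_refl: "tensor_eq xs xs"
| pairs_sym: "tensor_eq xs ys \<Longrightarrow> tensor_eq ys xs"
| pairs_trans: "tensor_eq xs ys \<Longrightarrow> tensor_eq ys zs \<Longrightarrow> tensor_eq xs zs"
| pairs_append: "tensor_eq xs xs' \<Longrightarrow> tensor_eq ys ys' \<Longrightarrow> tensor_eq (xs @ ys) (xs' @ ys')"
| pairs_commute: "tensor_eq (xs @ ys) (ys @ xs)"
| pairs_zero: "tensor_eq [(0, b)] []"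
| pairs_add_left: "tensor_eq [(a + a', b)] [(a, b), (a', b)]"
| pairs_add_right: "tensor_eq [(a, b + b')] [(a, b), (a, b')]"
| pairs_scale: "tensor_eq [(c *\<^sub>C a, b)] [(a, c *\<^sub>C b)]"

quotient_type (overloaded) ('a, 'b) tensor =
  "('a::complex_vector \<times> 'b::complex_vector) list" / tensor_eq
  by (rule equivpI) (auto intro: reflpI sympI transpI tensor_eq.pairs_refl tensor_eq.pairs_sym tensor_eq.pairs_trans)

definition pair_scale :: "complex \<Rightarrow> ('a::complex_vector \<times> 'b::complex_vector) list \<Rightarrow> ('a \<times> 'b) list" where
  "pair_scale c = map (\<lambda>(a, b). (c *\<^sub>C a, b))"

lemma pair_scale_simps [simp]:
  "pair_scale c [] = []" "pair_scale c ((a, b) # xs) = (c *\<^sub>C a, b) # pair_scale c xs"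
  "pair_scale c (xs @ ys) = pair_scale c xs @ pair_scale c ys"
  by (simp_all add: pair_scale_def)

lemma tensor_eq_Cons: "tensor_eq [p] [q] \<Longrightarrow> tensor_eq xs ys \<Longrightarrow> tensor_eq (p # xs) (q # ys)"
  using tensor_eq.pairs_append[of "[p]" "[q]" xs ys] by simp

lemma pair_scale_respects: "tensor_eq xs ys \<Longrightarrow> tensor_eq (pair_scale c xs) (pair_scale c ys)"
proof (induction rule: tensor_eq.induct)
  case (pairs_scale d a b)
  have "c *\<^sub>C d *\<^sub>C a = d *\<^sub>C c *\<^sub>C a"
    by (simp add: scaleC_scaleC mult.commute)
  then show ?case
    using tensor_eq.pairs_scale[of d "c *\<^sub>C a" b] by (simp del: scaleC_scaleC cvec.scale_scale)
qed (auto simp: scaleC_add_right intro: tensor_eq.intros)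

lemma pair_scale_one: "pair_scale 1 xs = xs"
  by (induction xs) (auto simp: scaleC_one)

lemma pair_scale_pair_scale: "pair_scale c (pair_scale d xs) = pair_scale (c * d) xs"
  by (induction xs) (auto simp: scaleC_scaleC)

lemma pair_scale_add: "tensor_eq (pair_scale (c + d) xs) (pair_scale c xs @ pair_scale d xs)"
proof (induction xs)
  case Nil
  then show ?case by (simp add: tensor_eq.pairs_refl)
next
  case (Cons x xs)
  obtain a b where x: "x = (a, b)" by force
  have 1: "tensor_eq ([((c + d) *\<^sub>C a, b)] @ pair_scale (c + d) xs)
      ([(c *\<^sub>C a, b), (d *\<^sub>C a, b)] @ (pair_scale c xs @ pair_scale d xs))"
    by (rule tensor_eq.pairs_append) (auto simp: scaleC_add_left intro: tensor_eq.pairs_add_left Cons.IH)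
  have "tensor_eq ([(c *\<^sub>C a, b)] @ (([(d *\<^sub>C a, b)] @ pair_scale c xs) @ pair_scale d xs))
      ([(c *\<^sub>C a, b)] @ ((pair_scale c xs @ [(d *\<^sub>C a, b)]) @ pair_scale d xs))"
    by (intro tensor_eq.pairs_append tensor_eq.pairs_refl tensor_eq.pairs_commute)
  with 1 show ?case
    by (auto simp: x intro: tensor_eq.pairs_trans)
qed

lemma pair_scale_zero: "tensor_eq (pair_scale 0 xs) []"
proof (induction xs)
  case Nil
  then show ?case by (simp add: tensor_eq.pairs_refl)
next
  case (Cons x xs)
  then show ?case
    using tensor_eq.pairs_append[OF tensor_eq.pairs_zero Cons.IH] by (cases x) auto
qed

lemma pair_scale_minus: "tensor_eq (pair_scale (- 1) xs @ xs) []"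
proof -
  have "tensor_eq (pair_scale 0 xs) (pair_scale (- 1) xs @ xs)"
    using pair_scale_add[of "- 1" 1 xs] by (simp add: pair_scale_one)
  then show ?thesis
    by (meson pair_scale_zero tensor_eq.pairs_sym tensor_eq.pairs_trans)
qed

instantiation tensor :: (complex_vector, complex_vector) complex_vector
begin

lift_definition zero_tensor :: "('a, 'b) tensor" is "[]" .

lift_definition plus_tensor :: "('a, 'b) tensor \<Rightarrow> ('a, 'b) tensor \<Rightarrow> ('a, 'b) tensor" is "(@)"
  by (rule tensor_eq.pairs_append)

lift_definition scaleC_tensor :: "complex \<Rightarrow> ('a, 'b) tensor \<Rightarrow> ('a, 'b) tensor" is pair_scale
  by (rule pair_scale_respects)

definition uminus_tensor :: "('a, 'b) tensor \<Rightarrow> ('a, 'b) tensor" where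
  "uminus_tensor t = (- 1) *\<^sub>C t"

definition minus_tensor :: "('a, 'b) tensor \<Rightarrow> ('a, 'b) tensor \<Rightarrow> ('a, 'b) tensor" where
  "minus_tensor s t = s + (- t)"

instance
proof
  fix r s t :: "('a, 'b) tensor" and c d :: complex
  show "r + s + t = r + (s + t)" by transfer (simp add: tensor_eq.pairs_refl)
  show "r + s = s + r" by transfer (rule tensor_eq.pairs_commute)
  show "0 + r = r" by transfer (simp add: tensor_eq.pairs_refl)
  show "- r + r = 0" unfolding uminus_tensor_def by transfer (rule pair_scale_minus)
  show "r - s = r + - s" by (simp add: minus_tensor_def)
  show "c *\<^sub>C (r + s) = c *\<^sub>C r + c *\<^sub>C s" by transfer (simp add: tensor_eq.pairs_refl)
  show "(c + d) *\<^sub>C r = c *\<^sub>C r + d *\<^sub>C r" by transfer (rule pair_scale_add)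
  show "c *\<^sub>C d *\<^sub>C r = (c * d) *\<^sub>C r" by transfer (simp add: pair_scale_pair_scale tensor_eq.pairs_refl)
  show "1 *\<^sub>C r = r" by transfer (simp add: pair_scale_one tensor_eq.pairs_refl)
qed

end

lift_definition tens :: "'a::complex_vector \<Rightarrow> 'b::complex_vector \<Rightarrow> ('a, 'b) tensor" (infixr "\<otimes>\<^sub>C" 72)
  is "\<lambda>a b. [(a, b)]" .

lemma tens_add_left: "(a + a') \<otimes>\<^sub>C b = a \<otimes>\<^sub>C b + a' \<otimes>\<^sub>C b"
  by transfer (simp add: tensor_eq.pairs_add_left)

lemma tens_add_right: "a \<otimes>\<^sub>C (b + b') = a \<otimes>\<^sub>C b + a \<otimes>\<^sub>C b'"
  by transfer (simp add: tensor_eq.pairs_add_right)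

lemma tens_scale_left: "(c *\<^sub>C a) \<otimes>\<^sub>C b = c *\<^sub>C (a \<otimes>\<^sub>C b)"
  by transfer (simp add: tensor_eq.pairs_refl)

lemma tens_scale_right: "a \<otimes>\<^sub>C (c *\<^sub>C b) = c *\<^sub>C (a \<otimes>\<^sub>C b)"
  by transfer (simp add: tensor_eq.pairs_scale tensor_eq.pairs_sym)

definition pure_sum :: "('a::complex_vector \<times> 'b::complex_vector) list \<Rightarrow> ('a, 'b) tensor" where
  "pure_sum xs = (\<Sum>(a, b)\<leftarrow>xs. a \<otimes>\<^sub>C b)"

definition tensor_space ::
  "'a::complex_vector set \<Rightarrow> 'b::complex_vector set \<Rightarrow> ('a, 'b) tensor set" where
  "tensor_space V W = cvec.span {v \<otimes>\<^sub>C w | v w. v \<in> V \<and> w \<in> W}"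

text \<open>For subspaces \<open>V\<close>, \<open>W\<close> and \<open>f\<close> bilinear on \<open>V \<times> W\<close>, \<open>tlift V W f\<close> is the linear map on
  \<open>V \<otimes> W\<close> induced by \<open>f\<close>; it does not depend on the presentation chosen (lemma \<open>tlift_pure_sum\<close>
  below). The subspaces are arguments because \<open>f\<close> need not be bilinear outside \<open>V \<times> W\<close>.\<close>

definition tlift :: "'a::complex_vector set \<Rightarrow> 'b::complex_vector set \<Rightarrow>
    ('a \<Rightarrow> 'b \<Rightarrow> 'c::complex_vector) \<Rightarrow> ('a, 'b) tensor \<Rightarrow> 'c" where
  "tlift V W f t =
     (\<Sum>(v, w)\<leftarrow>(SOME xs. set xs \<subseteq> V \<times> W \<and> pure_sum xs = t). f v w)"

abbreviation tlift_all :: "('a::complex_vector \<Rightarrow> 'b::complex_vector \<Rightarrow> 'c::complex_vector) \<Rightarrow>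
    ('a, 'b) tensor \<Rightarrow> 'c" where
  "tlift_all \<equiv> tlift UNIV UNIV"

definition tmap :: "'a::complex_vector set \<Rightarrow> 'b::complex_vector set \<Rightarrow>
    ('a \<Rightarrow> 'c::complex_vector) \<Rightarrow> ('b \<Rightarrow> 'd::complex_vector) \<Rightarrow> ('a, 'b) tensor \<Rightarrow> ('c, 'd) tensor" where
  "tmap V W f g = tlift V W (\<lambda>v w. f v \<otimes>\<^sub>C g w)"

definition tassoc :: "(('a::complex_vector, 'b::complex_vector) tensor, 'c::complex_vector) tensor \<Rightarrow>
    ('a, ('b, 'c) tensor) tensor" where
  "tassoc = tlift_all (\<lambda>t c. tlift_all (\<lambda>a b. a \<otimes>\<^sub>C (b \<otimes>\<^sub>C c)) t)"

lemma abs_tensor_eq_pure_sum: "abs_tensor xs = pure_sum xs"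
proof (induction xs)
  case Nil
  then show ?case by (simp add: pure_sum_def zero_tensor.abs_eq)
next
  case (Cons x xs)
  have "abs_tensor (x # xs) = abs_tensor [x] + abs_tensor xs"
    by (simp add: plus_tensor.abs_eq)
  then show ?case
    using Cons by (cases x) (simp add: pure_sum_def tens.abs_eq)
qed

lemma clinear_on_0: "clinear_on V f \<Longrightarrow> 0 \<in> V \<Longrightarrow> f 0 = 0"
  unfolding clinear_on_def by (metis cvec.scale_zero_left)

lemma bilinear_sum_respects:
  assumes "cbilinear_on UNIV UNIV f" "tensor_eq xs ys"
  shows "(\<Sum>(a, b)\<leftarrow>xs. f a b) = (\<Sum>(a, b)\<leftarrow>ys. f a b)"
  using assms(2)
proof (induction rule: tensor_eq.induct)
  case (pairs_zero b)
  then show ?case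
    using assms(1) clinear_on_0[of UNIV "\<lambda>v. f v b"] by (auto simp: cbilinear_on_def)
qed (use assms(1) in \<open>auto simp: cbilinear_on_def clinear_on_def add.commute\<close>)

lemma projection_exists:
  fixes V :: "'a::complex_vector set"
  assumes "cvec.subspace V"
  obtains P where "clinear_on UNIV P" "range P \<subseteq> V" "\<And>v. v \<in> V \<Longrightarrow> P v = v"
proof -
  obtain B where B: "B \<subseteq> V" "cvec.independent B" "V \<subseteq> cvec.span B"
    using cvec.maximal_independent_subset by blast
  have sB: "cvec.span B = V"
    using B assms cvec.span_subspace by blast
  obtain P :: "'a \<Rightarrow> 'a" where P: "Vector_Spaces.linear scaleC scaleC P" "\<And>b. b \<in> B \<Longrightarrow> P b = b"
      "range P = cvec.span (id ` B)"
    using cvecp.linear_independent_extend_subspace[OF B(2), of id] by auto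
  interpret P: Vector_Spaces.linear scaleC scaleC P by (rule P(1))
  have "P v = v" if "v \<in> V" for v
    using that unfolding sB[symmetric]
    by (induction rule: cvec.span_induct_alt) (simp_all add: P.add P.scale P(2))
  moreover have "clinear_on UNIV P"
    by (simp add: clinear_on_def P.add P.scale)
  ultimately show ?thesis
    using that P(3) sB by auto
qed

lemma pure_sum_respects_on:
  assumes V: "cvec.subspace V" and W: "cvec.subspace W" and f: "cbilinear_on V W f"
    and xs: "set xs \<subseteq> V \<times> W" and ys: "set ys \<subseteq> V \<times> W" and eq: "pure_sum xs = pure_sum ys"
  shows "(\<Sum>(a, b)\<leftarrow>xs. f a b) = (\<Sum>(a, b)\<leftarrow>ys. f a b)"
proof -
  obtain P where P: "clinear_on UNIV P" "range P \<subseteq> V" "\<And>v. v \<in> V \<Longrightarrow> P v = v"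
    using projection_exists[OF V] by metis
  obtain Q where Q: "clinear_on UNIV Q" "range Q \<subseteq> W" "\<And>v. v \<in> W \<Longrightarrow> Q v = v"
    using projection_exists[OF W] by metis
  have bil: "cbilinear_on UNIV UNIV (\<lambda>a b. f (P a) (Q b))"
    using f P(1,2) Q(1,2) unfolding cbilinear_on_def clinear_on_def by (auto simp: image_subset_iff)
  have "tensor_eq xs ys"
    using eq by (simp flip: abs_tensor_eq_pure_sum add: tensor.abs_eq_iff)
  then have *: "(\<Sum>(a, b)\<leftarrow>xs. f (P a) (Q b)) = (\<Sum>(a, b)\<leftarrow>ys. f (P a) (Q b))"
    using bilinear_sum_respects[OF bil] by simp
  have "map (\<lambda>(a, b). f (P a) (Q b)) zs = map (\<lambda>(a, b). f a b) zs" if "set zs \<subseteq> V \<times> W" for zs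
    using that by (intro map_cong) (auto simp: P(3) Q(3))
  with * xs ys show ?thesis by metis
qed

lemma tlift_pure_sum:
  assumes "cvec.subspace V" "cvec.subspace W" "cbilinear_on V W f" "set xs \<subseteq> V \<times> W"
  shows "tlift V W f (pure_sum xs) = (\<Sum>(a, b)\<leftarrow>xs. f a b)"
proof -
  let ?P = "\<lambda>ys. set ys \<subseteq> V \<times> W \<and> pure_sum ys = pure_sum xs"
  have "?P (SOME ys. ?P ys)"
    by (rule someI[where P = ?P and x = xs]) (simp add: assms(4))
  then show ?thesis
    unfolding tlift_def by (intro pure_sum_respects_on) (use assms in auto)
qed


lemma cbilinear_on_tens: "cbilinear_on V W (\<otimes>\<^sub>C)"
  by (auto simp: cbilinear_on_def clinear_on_def tens_add_left tens_add_right tens_scale_left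
      tens_scale_right)

lemma tensor_space_pure_sum:
  assumes V: "cvec.subspace V" and t: "t \<in> tensor_space V W"
  obtains xs where "set xs \<subseteq> V \<times> W" "t = pure_sum xs"
proof -
  have "\<exists>xs. set xs \<subseteq> V \<times> W \<and> t = pure_sum xs"
    using t unfolding tensor_space_def
  proof (induction rule: cvec.span_induct_alt)
    case base
    show ?case by (rule exI[of _ "[]"]) (simp add: pure_sum_def)
  next
    case (step c x y)
    then obtain v w xs where x: "x = v \<otimes>\<^sub>C w" "v \<in> V" "w \<in> W"
      and xs: "set xs \<subseteq> V \<times> W" "y = pure_sum xs" by auto
    have "c *\<^sub>C v \<in> V" using V x(2) by (simp add: cvec.subspace_scale)
    then show ?case
      by (intro exI[of _ "(c *\<^sub>C v, w) # xs"]) (use x xs in \<open>auto simp: pure_sum_def tens_scale_left\<close>)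
  qed
  then show ?thesis using that by blast
qed

lemma tens_in_tensor_space: "v \<in> V \<Longrightarrow> w \<in> W \<Longrightarrow> v \<otimes>\<^sub>C w \<in> tensor_space V W"
  unfolding tensor_space_def by (auto intro: cvec.span_base)

lemma subspace_tensor_space: "cvec.subspace (tensor_space V W)"
  by (simp add: tensor_space_def)

lemma pure_sum_in_tensor_space: "set xs \<subseteq> V \<times> W \<Longrightarrow> pure_sum xs \<in> tensor_space V W"
proof (induction xs)
  case Nil
  show ?case by (simp add: pure_sum_def cvec.subspace_0 subspace_tensor_space)
next
  case (Cons x xs)
  then have "fst x \<otimes>\<^sub>C snd x + pure_sum xs \<in> tensor_space V W"
    by (intro cvec.subspace_add subspace_tensor_space tens_in_tensor_space) auto
  then show ?case by (simp add: pure_sum_def case_prod_beta)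
qed

lemma tensor_space_UNIV [simp]: "tensor_space UNIV UNIV = UNIV"
proof -
  have "t \<in> tensor_space UNIV UNIV" for t :: "('a, 'b) tensor"
    by (induction t rule: tensor.abs_induct)
      (simp add: abs_tensor_eq_pure_sum pure_sum_in_tensor_space)
  then show ?thesis by auto
qed

lemma tlift_tens:
  assumes "cvec.subspace V" "cvec.subspace W" "cbilinear_on V W f" "v \<in> V" "w \<in> W"
  shows "tlift V W f (v \<otimes>\<^sub>C w) = f v w"
  using tlift_pure_sum[of V W f "[(v, w)]"] assms by (simp add: pure_sum_def)

lemma tlift_clinear:
  assumes V: "cvec.subspace V" and W: "cvec.subspace W" and f: "cbilinear_on V W f"
  shows "clinear_on (tensor_space V W) (tlift V W f)"
  unfolding clinear_on_def
proof (intro conjI ballI allI)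
  fix s t assume s: "s \<in> tensor_space V W" and t: "t \<in> tensor_space V W"
  obtain xs where xs: "set xs \<subseteq> V \<times> W" "s = pure_sum xs"
    using tensor_space_pure_sum[OF V s] .
  obtain ys where ys: "set ys \<subseteq> V \<times> W" "t = pure_sum ys"
    using tensor_space_pure_sum[OF V t] .
  have "s + t = pure_sum (xs @ ys)" by (simp add: xs ys pure_sum_def)
  then show "tlift V W f (s + t) = tlift V W f s + tlift V W f t"
    using xs ys by (simp add: tlift_pure_sum[OF V W f])
next
  fix c s assume s: "s \<in> tensor_space V W"
  obtain xs where xs: "set xs \<subseteq> V \<times> W" "s = pure_sum xs"
    using tensor_space_pure_sum[OF V s] .
  have 1: "c *\<^sub>C s = pure_sum (pair_scale c xs)"
    unfolding xs(2) pure_sum_def by (induction xs) (auto simp: scaleC_add_right tens_scale_left)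
  have 2: "set (pair_scale c xs) \<subseteq> V \<times> W"
    using xs(1) V by (induction xs) (auto simp: cvec.subspace_scale)
  have "(\<Sum>(a, b)\<leftarrow>pair_scale c xs. f a b) = c *\<^sub>C (\<Sum>(a, b)\<leftarrow>xs. f a b)"
    using xs(1) f by (induction xs) (auto simp: cbilinear_on_def clinear_on_def scaleC_add_right)
  then show "tlift V W f (c *\<^sub>C s) = c *\<^sub>C tlift V W f s"
    unfolding 1 using 2 xs by (simp add: tlift_pure_sum[OF V W f])
qed


lemma tensor_space_mono: "V \<subseteq> V' \<Longrightarrow> W \<subseteq> W' \<Longrightarrow> tensor_space V W \<subseteq> tensor_space V' W'"
  unfolding tensor_space_def by (rule cvec.span_mono) blast

lemma tensor_space_ext:
  assumes f: "clinear_on (tensor_space V W) f" and g: "clinear_on (tensor_space V W) g"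
    and eq: "\<And>v w. v \<in> V \<Longrightarrow> w \<in> W \<Longrightarrow> f (v \<otimes>\<^sub>C w) = g (v \<otimes>\<^sub>C w)"
    and t: "t \<in> tensor_space V W"
  shows "f t = g t"
proof -
  have "t \<in> tensor_space V W \<and> f t = g t"
    using t unfolding tensor_space_def
  proof (induction rule: cvec.span_induct_alt)
    case base
    have 0: "0 \<in> tensor_space V W" by (simp add: cvec.subspace_0 subspace_tensor_space)
    then show ?case
      using clinear_on_0[OF f 0] clinear_on_0[OF g 0] by (simp add: tensor_space_def)
  next
    case (step c x y)
    then obtain v w where x: "x = v \<otimes>\<^sub>C w" "v \<in> V" "w \<in> W" by auto
    have xt: "x \<in> tensor_space V W" using x by (simp add: tens_in_tensor_space)
    have yt: "y \<in> tensor_space V W" using step by (simp add: tensor_space_def)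
    have cx: "c *\<^sub>C x \<in> tensor_space V W"
      using xt by (simp add: cvec.subspace_scale subspace_tensor_space)
    have "f (c *\<^sub>C x + y) = c *\<^sub>C f x + f y" "g (c *\<^sub>C x + y) = c *\<^sub>C g x + g y"
      using f g cx xt yt unfolding clinear_on_def by auto
    moreover have "f x = g x" using eq x by simp
    moreover have "c *\<^sub>C x + y \<in> tensor_space V W"
      using cx yt by (simp add: cvec.subspace_add subspace_tensor_space)
    ultimately show ?case using step by (simp add: tensor_space_def)
  qed
  then show ?thesis by simp
qed

lemma clinear_on_compose:
  "clinear_on V f \<Longrightarrow> f ` V \<subseteq> W \<Longrightarrow> clinear_on W g \<Longrightarrow> clinear_on V (\<lambda>v. g (f v))"
  unfolding clinear_on_def by (auto simp: image_subset_iff)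

lemma tmap_bilinear:
  "clinear_on V f \<Longrightarrow> clinear_on W g \<Longrightarrow> cbilinear_on V W (\<lambda>v w. f v \<otimes>\<^sub>C g w)"
  unfolding cbilinear_on_def clinear_on_def
  by (auto simp: tens_add_left tens_add_right tens_scale_left tens_scale_right)

lemma clinear_on_id: "clinear_on V id"
  by (simp add: clinear_on_def)


lemma tlift_image:
  assumes "cvec.subspace V" "cvec.subspace W" "cbilinear_on V W f" "cvec.subspace S"
    and f: "\<And>v w. v \<in> V \<Longrightarrow> w \<in> W \<Longrightarrow> f v w \<in> S" and t: "t \<in> tensor_space V W"
  shows "tlift V W f t \<in> S"
proof -
  obtain xs where xs: "set xs \<subseteq> V \<times> W" "t = pure_sum xs"
    using tensor_space_pure_sum[OF assms(1) t] .
  have "(\<Sum>(a, b)\<leftarrow>xs. f a b) \<in> S"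
    using xs(1) by (induction xs) (auto simp: f assms(4) cvec.subspace_0 cvec.subspace_add)
  then show ?thesis using xs assms(1-3) by (simp add: tlift_pure_sum)
qed

lemma clinear_on_add: "clinear_on V f \<Longrightarrow> clinear_on V g \<Longrightarrow> clinear_on V (\<lambda>v. f v + g v)"
  unfolding clinear_on_def by (simp add: scaleC_add_right algebra_simps)

lemma clinear_on_scale: "clinear_on V f \<Longrightarrow> clinear_on V (\<lambda>v. c *\<^sub>C f v)"
  unfolding clinear_on_def by (simp add: scaleC_add_right scaleC_scaleC mult.commute)

lemma tlift_compose:
  assumes V: "cvec.subspace V" and W: "cvec.subspace W" and f: "cbilinear_on V W f"
    and S: "cvec.subspace S" and fS: "\<And>v w. v \<in> V \<Longrightarrow> w \<in> W \<Longrightarrow> f v w \<in> S"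
    and h: "clinear_on S h" and t: "t \<in> tensor_space V W"
    and g: "\<And>v w. v \<in> V \<Longrightarrow> w \<in> W \<Longrightarrow> h (f v w) = g v w"
  shows "h (tlift V W f t) = tlift V W g t"
proof (rule tensor_space_ext[OF _ _ _ t])
  have g': "g v w = h (f v w)" if "v \<in> V" "w \<in> W" for v w
    using g that by simp
  have fl: "clinear_on V (\<lambda>v. f v w)" if "w \<in> W" for w
    using f that by (simp add: cbilinear_on_def)
  have fr: "clinear_on W (f v)" if "v \<in> V" for v
    using f that by (simp add: cbilinear_on_def)
  have bg: "cbilinear_on V W g"
    unfolding cbilinear_on_def
  proof (intro conjI ballI)
    fix w assume w: "w \<in> W"
    have "clinear_on V (\<lambda>v. h (f v w))"
      by (rule clinear_on_compose[OF fl[OF w] _ h]) (use fS w in auto)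
    then show "clinear_on V (\<lambda>v. g v w)"
      using V w by (simp add: clinear_on_def g' cvec.subspace_add cvec.subspace_scale)
  next
    fix v assume v: "v \<in> V"
    have "clinear_on W (\<lambda>w. h (f v w))"
      by (rule clinear_on_compose[OF fr[OF v] _ h]) (use fS v in auto)
    then show "clinear_on W (g v)"
      using W v by (simp add: clinear_on_def g' cvec.subspace_add cvec.subspace_scale)
  qed
  show "clinear_on (tensor_space V W) (\<lambda>t. h (tlift V W f t))"
    by (rule clinear_on_compose[OF tlift_clinear[OF V W f] _ h]) (auto intro: tlift_image[OF V W f S fS])
  show "clinear_on (tensor_space V W) (tlift V W g)" by (rule tlift_clinear[OF V W bg])
  show "h (tlift V W f (v \<otimes>\<^sub>C w)) = tlift V W g (v \<otimes>\<^sub>C w)" if "v \<in> V" "w \<in> W" for v w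
    using that by (simp add: tlift_tens[OF V W f] tlift_tens[OF V W bg] g)
qed


section \<open>Super vector spaces\<close>

text \<open>Parities are Booleans, \<open>True\<close> being odd; the sum of two parities is \<open>p \<noteq> q\<close>.\<close>

definition psgn :: "bool \<Rightarrow> bool \<Rightarrow> complex" where
  "psgn p q = (if p \<and> q then - 1 else 1)"

definition superspace :: "'v::complex_vector set \<Rightarrow> (bool \<Rightarrow> 'v set) \<Rightarrow> bool" where
  "superspace V gr \<longleftrightarrow> cvec.subspace V \<and> (\<forall>p. cvec.subspace (gr p)) \<and>
     gr False \<inter> gr True = {0} \<and> V = {u + w | u w. u \<in> gr False \<and> w \<in> gr True}"

definition gproj :: "(bool \<Rightarrow> 'v::complex_vector set) \<Rightarrow> bool \<Rightarrow> 'v \<Rightarrow> 'v" where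
  "gproj gr p v = (THE u. u \<in> gr p \<and> v - u \<in> gr (\<not> p))"

definition tensor_grade :: "(bool \<Rightarrow> 'v::complex_vector set) \<Rightarrow> (bool \<Rightarrow> 'w::complex_vector set) \<Rightarrow>
    bool \<Rightarrow> ('v, 'w) tensor set" where
  "tensor_grade gr gr' p =
     cvec.span {v \<otimes>\<^sub>C w | v w q r. v \<in> gr q \<and> w \<in> gr' r \<and> (q \<noteq> r) = p}"


section \<open>Affine algebraic supergroups\<close>

text \<open>A supergroup \<open>G\<close> is given by its coordinate Hopf superalgebra: the underlying algebra is the
  whole type, and the record holds the two homogeneous components and the structure maps.\<close>

record (overloaded) ('a::complex_vector) supergroup =
  part :: "bool \<Rightarrow> 'a set"
  comult :: "'a \<Rightarrow> ('a, 'a) tensor"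
  counit :: "'a \<Rightarrow> complex"
  antipode :: "'a \<Rightarrow> 'a"

definition supercomm_algebra :: "(bool \<Rightarrow> 'a::complex_algebra_1 set) \<Rightarrow> bool" where
  "supercomm_algebra A \<longleftrightarrow> superspace UNIV A \<and> 1 \<in> A False \<and>
     (\<forall>p q. \<forall>a\<in>A p. \<forall>b\<in>A q. a * b \<in> A (p \<noteq> q) \<and> b * a = psgn p q *\<^sub>C (a * b))"

definition finitely_generated :: "'a::complex_algebra_1 itself \<Rightarrow> bool" where
  "finitely_generated _ \<longleftrightarrow> (\<exists>F::'a set. finite F \<and>
     (\<forall>B. cvec.subspace B \<and> 1 \<in> B \<and> (\<forall>a\<in>B. \<forall>b\<in>B. a * b \<in> B) \<and> F \<subseteq> B \<longrightarrow> B = UNIV))"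

text \<open>The product \<open>(a \<otimes> b) (c \<otimes> d) = (-1)\<^bsup>|b||c|\<^esup> a c \<otimes> b d\<close> of the superalgebra \<open>A \<otimes> A\<close>.\<close>

definition tensor_mult :: "(bool \<Rightarrow> 'a::complex_algebra_1 set) \<Rightarrow>
    ('a, 'a) tensor \<Rightarrow> ('a, 'a) tensor \<Rightarrow> ('a, 'a) tensor" where
  "tensor_mult A s t = tlift_all (\<lambda>a b. tlift_all (\<lambda>c d.
     \<Sum>p\<in>UNIV. \<Sum>q\<in>UNIV. psgn p q *\<^sub>C ((a * gproj A q c) \<otimes>\<^sub>C (gproj A p b * d))) t) s"

definition hopf_superalgebra :: "'a::complex_algebra_1 supergroup \<Rightarrow> bool" where
  "hopf_superalgebra G \<longleftrightarrow>
     clinear_on UNIV (comult G) \<and>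
     (\<forall>p. comult G ` part G p \<subseteq> tensor_grade (part G) (part G) p) \<and>
     comult G 1 = 1 \<otimes>\<^sub>C 1 \<and>
     (\<forall>a b. comult G (a * b) = tensor_mult (part G) (comult G a) (comult G b)) \<and>
     clinear_on UNIV (counit G) \<and>
     (\<forall>a\<in>part G True. counit G a = 0) \<and>
     counit G 1 = 1 \<and>
     (\<forall>a b. counit G (a * b) = counit G a * counit G b) \<and>
     (\<forall>a. tassoc (tmap UNIV UNIV (comult G) id (comult G a)) = tmap UNIV UNIV id (comult G) (comult G a)) \<and>
     (\<forall>a. tlift_all (\<lambda>b c. counit G b *\<^sub>C c) (comult G a) = a) \<and>
     (\<forall>a. tlift_all (\<lambda>b c. counit G c *\<^sub>C b) (comult G a) = a) \<and>
     clinear_on UNIV (antipode G) \<and>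
     (\<forall>p. antipode G ` part G p \<subseteq> part G p) \<and>
     (\<forall>a. tlift_all (\<lambda>b c. antipode G b * c) (comult G a) = counit G a *\<^sub>C 1) \<and>
     (\<forall>a. tlift_all (\<lambda>b c. b * antipode G c) (comult G a) = counit G a *\<^sub>C 1)"

definition affine_algebraic_supergroup :: "'a::complex_algebra_1 supergroup \<Rightarrow> bool" where
  "affine_algebraic_supergroup G \<longleftrightarrow>
     supercomm_algebra (part G) \<and> finitely_generated TYPE('a) \<and> hopf_superalgebra G"

text \<open>A closed subgroup \<open>K \<subseteq> G\<close> is given by the surjection \<open>r\<close> restricting functions from \<open>G\<close> to \<open>K\<close>.\<close>

definition closed_subgroup :: "'a::complex_algebra_1 supergroup \<Rightarrow> 'b::complex_algebra_1 supergroup \<Rightarrow>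
    ('a \<Rightarrow> 'b) \<Rightarrow> bool" where
  "closed_subgroup G K r \<longleftrightarrow> clinear_on UNIV r \<and> surj r \<and> r 1 = 1 \<and>
     (\<forall>a b. r (a * b) = r a * r b) \<and> (\<forall>p. r ` part G p \<subseteq> part K p) \<and>
     (\<forall>a. comult K (r a) = tmap UNIV UNIV r r (comult G a)) \<and>
     (\<forall>a. counit K (r a) = counit G a)"


section \<open>The underlying even group and quasireductivity\<close>

text \<open>The coordinate ring of the underlying even group \<open>G\<^sub>0\<close> is the quotient of that of \<open>G\<close> by the
  ideal generated by the odd functions. An algebraic group over the complex numbers is reduced, so
  \<open>G\<^sub>0\<close> is treated classically, as its group of complex points with the Zariski topology.\<close>

definition odd_ideal :: "'a::complex_algebra_1 supergroup \<Rightarrow> 'a set" where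
  "odd_ideal G = cvec.span {a * b | a b. b \<in> part G True}"

definition points :: "'a::complex_algebra_1 supergroup \<Rightarrow> ('a \<Rightarrow> complex) set" where
  "points G = {g. clinear_on UNIV g \<and> g 1 = 1 \<and> (\<forall>a b. g (a * b) = g a * g b) \<and>
     (\<forall>a\<in>odd_ideal G. g a = 0)}"

definition point_mult :: "'a::complex_algebra_1 supergroup \<Rightarrow> ('a \<Rightarrow> complex) \<Rightarrow> ('a \<Rightarrow> complex) \<Rightarrow>
    'a \<Rightarrow> complex" where
  "point_mult G g h a = tlift_all (\<lambda>b c. g b * h c) (comult G a)"

definition point_inv :: "'a::complex_algebra_1 supergroup \<Rightarrow> ('a \<Rightarrow> complex) \<Rightarrow> 'a \<Rightarrow> complex" where
  "point_inv G g = g \<circ> antipode G"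

definition zeros :: "'a::complex_algebra_1 supergroup \<Rightarrow> 'a set \<Rightarrow> ('a \<Rightarrow> complex) set" where
  "zeros G T = {g \<in> points G. \<forall>a\<in>T. g a = 0}"

definition zariski :: "'a::complex_algebra_1 supergroup \<Rightarrow> ('a \<Rightarrow> complex) topology" where
  "zariski G = topology (\<lambda>U. \<exists>T. U = points G - zeros G T)"

lemma istopology_zariski: "istopology (\<lambda>U. \<exists>T. U = points G - zeros G T)"
  unfolding istopology_def
proof (intro conjI allI impI)
  fix U U' assume "\<exists>T. U = points G - zeros G T" "\<exists>T. U' = points G - zeros G T"
  then obtain T T' where T: "U = points G - zeros G T" "U' = points G - zeros G T'" by blast
  have mult: "g (a * b) = g a * g b" if "g \<in> points G" for g a b
    using that by (simp add: points_def)
  have "(\<forall>a\<in>T. g a = 0) \<or> (\<forall>a\<in>T'. g a = 0) \<longleftrightarrow>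
      (\<forall>a\<in>{a * b | a b. a \<in> T \<and> b \<in> T'}. g a = 0)" if "g \<in> points G" for g
  proof
    assume "(\<forall>a\<in>T. g a = 0) \<or> (\<forall>a\<in>T'. g a = 0)"
    then show "\<forall>a\<in>{a * b | a b. a \<in> T \<and> b \<in> T'}. g a = 0"
      using mult[OF that] by auto
  next
    assume *: "\<forall>a\<in>{a * b | a b. a \<in> T \<and> b \<in> T'}. g a = 0"
    have "g a = 0 \<or> g b = 0" if "a \<in> T" "b \<in> T'" for a b
      using * that mult[OF \<open>g \<in> points G\<close>, of a b] by (metis (mono_tags, lifting) mem_Collect_eq mult_eq_0_iff)
    then show "(\<forall>a\<in>T. g a = 0) \<or> (\<forall>a\<in>T'. g a = 0)" by metis
  qed
  then have "U \<inter> U' = points G - zeros G {a * b | a b. a \<in> T \<and> b \<in> T'}"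
    unfolding T zeros_def by blast
  then show "\<exists>T. U \<inter> U' = points G - zeros G T" by blast
next
  fix \<K> assume "\<forall>U\<in>\<K>. \<exists>T. U = points G - zeros G T"
  then obtain T where T: "\<And>U. U \<in> \<K> \<Longrightarrow> U = points G - zeros G (T U)" by metis
  have "\<Union>\<K> = (\<Union>U\<in>\<K>. points G - zeros G (T U))"
    by (subst image_cong[OF _ T[symmetric], OF refl]) auto
  also have "\<dots> = points G - zeros G (\<Union>(T ` \<K>))"
    unfolding zeros_def by auto
  finally show "\<exists>T. \<Union>\<K> = points G - zeros G T" by blast
qed

definition identity_component :: "'a::complex_algebra_1 supergroup \<Rightarrow> ('a \<Rightarrow> complex) set" where
  "identity_component G = connected_component_of_set (zariski G) (counit G)"

definition closed_point_subgroup ::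
  "'a::complex_algebra_1 supergroup \<Rightarrow> ('a \<Rightarrow> complex) set \<Rightarrow> bool" where
  "closed_point_subgroup G H \<longleftrightarrow> closedin (zariski G) H \<and> counit G \<in> H \<and>
     (\<forall>g\<in>H. \<forall>h\<in>H. point_mult G g h \<in> H) \<and> (\<forall>g\<in>H. point_inv G g \<in> H)"

text \<open>Right translation by \<open>g\<close>, i.e. \<open>(g \<cdot> f) h = f (h g)\<close>. A point is unipotent if it acts locally
  unipotently on the coordinate ring of \<open>G\<^sub>0\<close>.\<close>

definition translate :: "'a::complex_algebra_1 supergroup \<Rightarrow> ('a \<Rightarrow> complex) \<Rightarrow> 'a \<Rightarrow> 'a" where
  "translate G g a = tlift_all (\<lambda>b c. g c *\<^sub>C b) (comult G a)"

definition unipotent_point :: "'a::complex_algebra_1 supergroup \<Rightarrow> ('a \<Rightarrow> complex) \<Rightarrow> bool" where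
  "unipotent_point G g \<longleftrightarrow> (\<forall>a. \<exists>n. ((\<lambda>b. translate G g b - b) ^^ n) a \<in> odd_ideal G)"

text \<open>Reductive: the unipotent radical, i.e. the largest connected normal unipotent closed subgroup,
  is trivial.\<close>

definition reductive :: "'a::complex_algebra_1 supergroup \<Rightarrow> ('a \<Rightarrow> complex) set \<Rightarrow> bool" where
  "reductive G H \<longleftrightarrow> (\<forall>U. closed_point_subgroup G U \<and> U \<subseteq> H \<and>
     (\<forall>h\<in>H. \<forall>u\<in>U. point_mult G (point_mult G h u) (point_inv G h) \<in> U) \<and>
     connectedin (zariski G) U \<and> (\<forall>u\<in>U. unipotent_point G u) \<longrightarrow> U = {counit G})"

definition quasireductive :: "'a::complex_algebra_1 supergroup \<Rightarrow> bool" where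
  "quasireductive G \<longleftrightarrow> affine_algebraic_supergroup G \<and> reductive G (identity_component G)"


section \<open>The Lie superalgebra\<close>

text \<open>The Lie superalgebra consists of the superderivations at the identity. Since the counit
  vanishes on odd functions, no sign survives in the Leibniz rule.\<close>

definition lie :: "'a::complex_algebra_1 supergroup \<Rightarrow> bool \<Rightarrow> ('a \<Rightarrow> complex) set" where
  "lie G p = {x. clinear_on UNIV x \<and> (\<forall>a\<in>part G (\<not> p). x a = 0) \<and>
     (\<forall>a b. x (a * b) = x a * counit G b + counit G a * x b)}"

text \<open>The convolution product \<open>(x \<otimes> y) \<circ> \<Delta>\<close> with the Koszul rule
  \<open>(x \<otimes> y) (a \<otimes> b) = (-1)\<^bsup>|y||a|\<^esup> x a y b\<close>, where \<open>q = |y|\<close>; the bracket is its supercommutator.\<close>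

definition convolution :: "'a::complex_algebra_1 supergroup \<Rightarrow> bool \<Rightarrow>
    ('a \<Rightarrow> complex) \<Rightarrow> ('a \<Rightarrow> complex) \<Rightarrow> 'a \<Rightarrow> complex" where
  "convolution G q x y a =
     tlift_all (\<lambda>b c. (\<Sum>p\<in>UNIV. psgn q p * x (gproj (part G) p b)) * y c) (comult G a)"

definition lie_bracket :: "'a::complex_algebra_1 supergroup \<Rightarrow> bool \<Rightarrow> bool \<Rightarrow>
    ('a \<Rightarrow> complex) \<Rightarrow> ('a \<Rightarrow> complex) \<Rightarrow> 'a \<Rightarrow> complex" where
  "lie_bracket G p q x y a = convolution G q x y a - psgn p q * convolution G p y x a"

text \<open>An element of the Lie algebra of \<open>G\<^sub>0\<close> is semisimple if the corresponding left-invariant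
  vector field acts diagonalizably on the coordinate ring of \<open>G\<^sub>0\<close>.\<close>

definition semisimple :: "'a::complex_algebra_1 supergroup \<Rightarrow> ('a \<Rightarrow> complex) \<Rightarrow> bool" where
  "semisimple G x \<longleftrightarrow> x \<in> lie G False \<and>
     cvec.span (\<Union>c. {a. tlift_all (\<lambda>b b'. x b' *\<^sub>C b) (comult G a) - c *\<^sub>C a \<in> odd_ideal G}) = UNIV"

definition homological :: "'a::complex_algebra_1 supergroup \<Rightarrow> ('a \<Rightarrow> complex) set" where
  "homological G = {x \<in> lie G True. semisimple G (lie_bracket G True True x x)}"


section \<open>Modules\<close>

text \<open>A (locally finite algebraic) \<open>G\<close>-module is a right supercomodule over the coordinate ring; its
  underlying space is a subspace of the type \<open>'v\<close>.\<close>

record (overloaded) ('v::complex_vector, 'a::complex_vector) supermodule =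
  carr :: "'v set"
  grade :: "bool \<Rightarrow> 'v set"
  coact :: "'v \<Rightarrow> ('v, 'a) tensor"

definition g_module :: "'a::complex_algebra_1 supergroup \<Rightarrow> ('v::complex_vector, 'a) supermodule \<Rightarrow> bool" where
  "g_module G M \<longleftrightarrow> superspace (carr M) (grade M) \<and> clinear_on (carr M) (coact M) \<and>
     (\<forall>p. coact M ` grade M p \<subseteq> tensor_grade (grade M) (part G) p) \<and>
     (\<forall>v\<in>carr M. tassoc (tmap (carr M) UNIV (coact M) id (coact M v)) =
        tmap (carr M) UNIV id (comult G) (coact M v)) \<and>
     (\<forall>v\<in>carr M. tlift (carr M) UNIV (\<lambda>u a. counit G a *\<^sub>C u) (coact M v) = v)"

definition finite_dim :: "('v::complex_vector, 'a::complex_vector) supermodule \<Rightarrow> bool" where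
  "finite_dim M \<longleftrightarrow> (\<exists>B. finite B \<and> cvec.span B = carr M)"

text \<open>Even \<open>G\<close>-equivariant linear maps, made functions on the whole type by the value 0 outside the
  source. \<open>G\<close> enters only through the coactions.\<close>

definition module_hom :: "('v::complex_vector, 'a::complex_vector) supermodule \<Rightarrow>
    ('w::complex_vector, 'a) supermodule \<Rightarrow> ('v \<Rightarrow> 'w) set" where
  "module_hom M N = {f. clinear_on (carr M) f \<and> (\<forall>p. f ` grade M p \<subseteq> grade N p) \<and>
     (\<forall>v\<in>carr M. coact N (f v) = tmap (carr M) UNIV f id (coact M v)) \<and>
     (\<forall>v. v \<notin> carr M \<longrightarrow> f v = 0)}"

definition trivial_module :: "(complex, 'a::complex_algebra_1) supermodule" where
  "trivial_module = \<lparr>carr = UNIV, grade = (\<lambda>p. if p then {0} else UNIV), coact = (\<lambda>c. c \<otimes>\<^sub>C 1)\<rparr>"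

definition restrict_module :: "('a \<Rightarrow> 'b) \<Rightarrow> ('v::complex_vector, 'a::complex_vector) supermodule \<Rightarrow>
    ('v, 'b::complex_vector) supermodule" where
  "restrict_module r M =
     \<lparr>carr = carr M, grade = grade M, coact = (\<lambda>v. tmap (carr M) UNIV id r (coact M v))\<rparr>"


section \<open>Induction of the trivial module and splitting subgroups\<close>

text \<open>The functions \<open>f\<close> on \<open>G\<close> with \<open>f (k g) = f g\<close>, on which \<open>G\<close> acts by right translation. Lemma
  \<open>induced_trivial_adjunction\<close> below shows that this is the value at the trivial module of the right
  adjoint of restriction, with the counit of \<open>G\<close> (evaluation at the identity) as counit of the
  adjunction.\<close>

definition induced_trivial :: "'a::complex_algebra_1 supergroup \<Rightarrow> ('a \<Rightarrow> 'b::complex_algebra_1) \<Rightarrow>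
    ('a, 'a) supermodule" where
  "induced_trivial G r =
     (let I = {a. tmap UNIV UNIV r id (comult G a) = 1 \<otimes>\<^sub>C a}
      in \<lparr>carr = I, grade = (\<lambda>p. I \<inter> part G p), coact = comult G\<rparr>)"

lemma tensor_grade_subset: "tensor_grade gr gr' p \<subseteq> tensor_space (\<Union>p. gr p) UNIV"
  unfolding tensor_grade_def tensor_space_def by (rule cvec.span_mono) blast

lemma superspace_grade: "superspace V gr \<Longrightarrow> gr p \<subseteq> V"
proof -
  assume V: "superspace V gr"
  then have "0 \<in> gr False" "0 \<in> gr True"
    by (auto simp: superspace_def cvec.subspace_0)
  with V show ?thesis
    by (cases p) (force simp: superspace_def)+
qed

lemma coact_tensor_space:
  assumes "g_module G M" "v \<in> carr M"
  shows "coact M v \<in> tensor_space (carr M) UNIV"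
proof -
  have ss: "superspace (carr M) (grade M)" using assms(1) by (simp add: g_module_def)
  obtain u w where uw: "v = u + w" "u \<in> grade M False" "w \<in> grade M True"
    using ss assms(2) by (auto simp: superspace_def)
  have sub: "coact M z \<in> tensor_space (carr M) UNIV" if "z \<in> grade M p" for z p
  proof -
    have "coact M z \<in> tensor_grade (grade M) (part G) p"
      using assms(1) that unfolding g_module_def by blast
    then have "coact M z \<in> tensor_space (\<Union>p. grade M p) UNIV"
      using tensor_grade_subset by blast
    then show ?thesis
      using tensor_space_mono[of "\<Union>p. grade M p" "carr M" UNIV UNIV] superspace_grade[OF ss] by blast
  qed
  have "coact M v = coact M u + coact M w"
    using assms(1) uw superspace_grade[OF ss] unfolding g_module_def clinear_on_def by blast
  then show ?thesis
    using sub[OF uw(2)] sub[OF uw(3)] by (simp add: cvec.subspace_add subspace_tensor_space)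
qed

theorem induced_trivial_adjunction:
  fixes M :: "('v::complex_vector, 'a::complex_algebra_1) supermodule"
    and r :: "'a \<Rightarrow> 'b::complex_algebra_1"
  assumes G: "affine_algebraic_supergroup G" and r: "closed_subgroup G K r" and M: "g_module G M"
    and \<phi>: "\<phi> \<in> module_hom (restrict_module r M) trivial_module"
  shows "\<exists>!\<psi>. \<psi> \<in> module_hom M (induced_trivial G r) \<and> (\<forall>v. counit G (\<psi> v) = \<phi> v)"
proof -
  let ?V = "carr M" and ?\<Delta> = "comult G" and ?\<rho> = "coact M"
  note hopf = G[unfolded affine_algebraic_supergroup_def hopf_superalgebra_def]
  have sG: "superspace UNIV (part G)"
    using G by (simp add: affine_algebraic_supergroup_def supercomm_algebra_def)
  have ss: "superspace ?V (grade M)" using M by (simp add: g_module_def)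
  have V: "cvec.subspace ?V" using ss unfolding superspace_def by blast
  note U = cvec.subspace_UNIV
  note TS = subspace_tensor_space
  have \<rho>_lin: "clinear_on ?V ?\<rho>" using M by (simp add: g_module_def)
  have \<rho>_in: "?\<rho> v \<in> tensor_space ?V UNIV" if "v \<in> ?V" for v
    using coact_tensor_space[OF M that] .
  have \<Delta>_lin: "clinear_on UNIV ?\<Delta>" and \<epsilon>_lin: "clinear_on UNIV (counit G)" using hopf by blast+
  have r_lin: "clinear_on UNIV r" using r by (simp add: closed_subgroup_def)
  have \<phi>_lin: "clinear_on ?V \<phi>" and \<phi>_out: "\<And>v. v \<notin> ?V \<Longrightarrow> \<phi> v = 0"
    and \<phi>_odd: "\<And>v. v \<in> grade M True \<Longrightarrow> \<phi> v = 0"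
    and \<phi>_inv: "\<And>v. v \<in> ?V \<Longrightarrow> \<phi> v \<otimes>\<^sub>C 1 = tmap ?V UNIV \<phi> id (tmap ?V UNIV id r (?\<rho> v))"
    using \<phi> by (force simp: module_hom_def restrict_module_def trivial_module_def)+
  have bil: "cbilinear_on ?V UNIV (\<lambda>u a. \<phi> u *\<^sub>C f a)"
    if "clinear_on UNIV f" for f :: "'c::complex_vector \<Rightarrow> 'd::complex_vector"
    using \<phi>_lin that unfolding cbilinear_on_def clinear_on_def
    by (auto simp: scaleC_add_left scaleC_add_right scaleC_scaleC mult.commute)
  define L where "L = tlift ?V UNIV (\<lambda>u a::'a. \<phi> u *\<^sub>C a)"
  define \<psi> where "\<psi> v = (if v \<in> ?V then L (?\<rho> v) else 0)" for v
  have bilL: "cbilinear_on ?V UNIV (\<lambda>u a::'a. \<phi> u *\<^sub>C a)"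
    using bil[of id] by (simp add: clinear_on_id)
  have L_lin: "clinear_on (tensor_space ?V UNIV) L"
    unfolding L_def by (rule tlift_clinear[OF V U bilL])
  have \<psi>_L: "\<psi> v = L (?\<rho> v)" if "v \<in> ?V" for v
    using that by (simp add: \<psi>_def)
  have \<psi>_lin: "clinear_on ?V \<psi>"
    using clinear_on_compose[OF \<rho>_lin _ L_lin] \<rho>_in V
    unfolding clinear_on_def \<psi>_def by (auto simp: image_subset_iff cvec.subspace_add cvec.subspace_scale)

  have \<psi>_r: "r (\<psi> v) = \<phi> v *\<^sub>C 1" if v: "v \<in> ?V" for v
  proof -
    let ?E = "tlift_all (\<lambda>(c::complex) (b::'b). c *\<^sub>C b)"
    have bilE: "cbilinear_on UNIV UNIV (\<lambda>(c::complex) (b::'b). c *\<^sub>C b)"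
      unfolding cbilinear_on_def clinear_on_def
      by (auto simp: scaleC_add_left scaleC_add_right scaleC_scaleC mult.commute)
    have E_lin: "clinear_on UNIV ?E"
      using tlift_clinear[OF U U bilE] by simp
    have "tmap ?V UNIV \<phi> id (tmap ?V UNIV id r (?\<rho> v)) =
        tlift ?V UNIV (\<lambda>u a. \<phi> u \<otimes>\<^sub>C r a) (?\<rho> v)"
      unfolding tmap_def[of _ _ id]
    proof (rule tlift_compose[OF V U _ TS[of ?V UNIV] _ _ \<rho>_in[OF v]])
      show "cbilinear_on ?V UNIV (\<lambda>u a. id u \<otimes>\<^sub>C r a)"
        by (rule tmap_bilinear[OF clinear_on_id r_lin])
      show "clinear_on (tensor_space ?V UNIV) (tmap ?V UNIV \<phi> (id :: 'b \<Rightarrow> 'b))"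
        unfolding tmap_def by (rule tlift_clinear[OF V U tmap_bilinear[OF \<phi>_lin clinear_on_id]])
      show "tmap ?V UNIV \<phi> id (id u \<otimes>\<^sub>C r a) = \<phi> u \<otimes>\<^sub>C r a" if "u \<in> ?V" for u a
        unfolding tmap_def using tlift_tens[OF V U tmap_bilinear[OF \<phi>_lin clinear_on_id] that] by simp
    qed (auto simp: tens_in_tensor_space)
    then have "?E (\<phi> v \<otimes>\<^sub>C 1) = ?E (tlift ?V UNIV (\<lambda>u a. \<phi> u \<otimes>\<^sub>C r a) (?\<rho> v))"
      using \<phi>_inv[OF v] by simp
    also have "\<dots> = tlift ?V UNIV (\<lambda>u a. \<phi> u *\<^sub>C r a) (?\<rho> v)"
      by (rule tlift_compose[OF V U tmap_bilinear[OF \<phi>_lin r_lin] U _ E_lin \<rho>_in[OF v]])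
        (simp_all add: tlift_tens[OF U U bilE])
    also have "\<dots> = r (\<psi> v)"
      unfolding \<psi>_L[OF v] L_def
      by (rule tlift_compose[OF V U bilL U _ r_lin \<rho>_in[OF v], symmetric])
        (use r_lin in \<open>simp_all add: clinear_on_def\<close>)
    finally show ?thesis by (simp add: tlift_tens[OF U U bilE])
  qed

  have \<psi>_eq: "?\<Delta> (\<psi> v) = tmap ?V UNIV \<psi> id (?\<rho> v)" if v: "v \<in> ?V" for v
  proof -
    define L2 where "L2 = tlift ?V UNIV (\<lambda>u t::('a, 'a) tensor. \<phi> u *\<^sub>C t)"
    have bilL2: "cbilinear_on ?V UNIV (\<lambda>u t::('a, 'a) tensor. \<phi> u *\<^sub>C t)"
      using bil[of id] by (simp add: clinear_on_id)
    have L2_lin: "clinear_on (tensor_space ?V UNIV) L2"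
      unfolding L2_def by (rule tlift_clinear[OF V U bilL2])
    have L2_tens: "L2 (u \<otimes>\<^sub>C t) = \<phi> u *\<^sub>C t" if "u \<in> ?V" for u t
      unfolding L2_def using tlift_tens[OF V U bilL2 that] by simp
    have b1: "cbilinear_on UNIV UNIV (\<lambda>(b::'v) (c::'a). b \<otimes>\<^sub>C (c \<otimes>\<^sub>C a))" for a :: 'a
      unfolding cbilinear_on_def clinear_on_def
      by (auto simp: tens_add_left tens_add_right tens_scale_left tens_scale_right)
    let ?T = "\<lambda>(s::('v, 'a) tensor) (a::'a). tlift_all (\<lambda>b c. b \<otimes>\<^sub>C (c \<otimes>\<^sub>C a)) s"
    have Ttens: "?T (x \<otimes>\<^sub>C y) a = x \<otimes>\<^sub>C (y \<otimes>\<^sub>C a)" for x y a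
      by (rule tlift_tens[OF U U b1]) auto
    have b2: "cbilinear_on UNIV UNIV ?T"
      unfolding cbilinear_on_def
    proof (intro conjI ballI)
      show Tlin: "clinear_on UNIV (\<lambda>s. ?T s a)" for a
        using tlift_clinear[OF U U b1] by simp
      fix s :: "('v, 'a) tensor"
      have lin2: "clinear_on (tensor_space UNIV UNIV) (\<lambda>s. ?T s a + ?T s a')"
        "clinear_on (tensor_space UNIV UNIV) (\<lambda>s. c *\<^sub>C ?T s a)" for a a' c
        using clinear_on_add[OF Tlin Tlin, of a a'] clinear_on_scale[OF Tlin, of c a] by simp_all
      show "clinear_on UNIV (?T s)"
        unfolding clinear_on_def
      proof (intro conjI ballI allI)
        show "?T s (a + a') = ?T s a + ?T s a'" for a a'
        proof (rule tensor_space_ext[OF _ lin2(1)])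
          show "?T (x \<otimes>\<^sub>C y) (a + a') = ?T (x \<otimes>\<^sub>C y) a + ?T (x \<otimes>\<^sub>C y) a'" for x y
            unfolding Ttens by (simp add: tens_add_right)
        qed (simp_all only: tensor_space_UNIV Tlin UNIV_I)
        show "?T s (c *\<^sub>C a) = c *\<^sub>C ?T s a" for c a
        proof (rule tensor_space_ext[OF _ lin2(2)])
          show "?T (x \<otimes>\<^sub>C y) (c *\<^sub>C a) = c *\<^sub>C ?T (x \<otimes>\<^sub>C y) a" for x y
            unfolding Ttens by (simp add: tens_scale_right)
        qed (simp_all only: tensor_space_UNIV Tlin UNIV_I)
      qed
    qed
    have assoc_lin: "clinear_on UNIV (tassoc :: (('v, 'a) tensor, 'a) tensor \<Rightarrow> _)"
      unfolding tassoc_def using tlift_clinear[OF U U b2] by simp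
    have assoc_tens: "tassoc (s \<otimes>\<^sub>C a) = ?T s a" for s :: "('v, 'a) tensor" and a :: 'a
      unfolding tassoc_def by (rule tlift_tens[OF U U b2]) auto
    have T_in: "?T s a \<in> tensor_space ?V UNIV \<and> L2 (?T s a) = L s \<otimes>\<^sub>C a"
      if "s \<in> tensor_space ?V UNIV" for s a
    proof -
      obtain xs where xs: "set xs \<subseteq> ?V \<times> UNIV" "s = pure_sum xs"
        using tensor_space_pure_sum[OF V \<open>s \<in> tensor_space ?V UNIV\<close>] .
      have T: "?T s a = (\<Sum>(b, c)\<leftarrow>xs. b \<otimes>\<^sub>C (c \<otimes>\<^sub>C a))"
        using tlift_pure_sum[OF U U b1] xs by simp
      have Ls: "L s = (\<Sum>(b, c)\<leftarrow>xs. \<phi> b *\<^sub>C c)"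
        unfolding L_def using tlift_pure_sum[OF V U bilL] xs by simp
      have "(\<Sum>(b, c)\<leftarrow>xs. b \<otimes>\<^sub>C (c \<otimes>\<^sub>C a)) \<in> tensor_space ?V UNIV \<and>
          L2 (\<Sum>(b, c)\<leftarrow>xs. b \<otimes>\<^sub>C (c \<otimes>\<^sub>C a)) = (\<Sum>(b, c)\<leftarrow>xs. \<phi> b *\<^sub>C c) \<otimes>\<^sub>C a"
        using xs(1)
      proof (induction xs)
        case Nil
        have "0 \<in> tensor_space ?V (UNIV :: ('a, 'a) tensor set)" by (simp add: cvec.subspace_0 TS)
        moreover have "(0::'a) \<otimes>\<^sub>C a = 0" using tens_scale_left[of 0 0 a] by simp
        ultimately show ?case using clinear_on_0[OF L2_lin] by simp
      next
        case (Cons x xs)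
        obtain b c where x: "x = (b, c)" by force
        have b: "b \<in> ?V" using Cons x by simp
        have bt: "b \<otimes>\<^sub>C (c \<otimes>\<^sub>C a) \<in> tensor_space ?V UNIV"
          by (simp add: b tens_in_tensor_space)
        show ?case
          using Cons bt L2_lin unfolding clinear_on_def
          by (simp add: x L2_tens[OF b] tens_add_left tens_scale_left cvec.subspace_add TS)
      qed
      then show ?thesis unfolding T Ls by simp
    qed
    have "?\<Delta> (\<psi> v) = tlift ?V UNIV (\<lambda>u a. \<phi> u *\<^sub>C ?\<Delta> a) (?\<rho> v)"
      unfolding \<psi>_L[OF v] L_def
      by (rule tlift_compose[OF V U bilL U _ \<Delta>_lin \<rho>_in[OF v]])
        (use \<Delta>_lin in \<open>simp_all add: clinear_on_def\<close>)
    also have "\<dots> = L2 (tmap ?V UNIV id ?\<Delta> (?\<rho> v))"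
      unfolding tmap_def
      by (rule tlift_compose[OF V U tmap_bilinear[OF clinear_on_id \<Delta>_lin] TS[of ?V UNIV]
            _ L2_lin \<rho>_in[OF v], symmetric]) (simp_all add: tens_in_tensor_space L2_tens)
    also have "tmap ?V UNIV id ?\<Delta> (?\<rho> v) = tassoc (tmap ?V UNIV ?\<rho> id (?\<rho> v))"
      using M v by (simp add: g_module_def)
    also have "\<dots> = tlift ?V UNIV (\<lambda>u a. ?T (?\<rho> u) a) (?\<rho> v)"
      unfolding tmap_def
      by (rule tlift_compose[OF V U tmap_bilinear[OF \<rho>_lin clinear_on_id] U _ assoc_lin \<rho>_in[OF v]])
        (simp_all add: assoc_tens)
    also have "L2 \<dots> = tmap ?V UNIV \<psi> id (?\<rho> v)"
      unfolding tmap_def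
    proof (rule tlift_compose[OF V U _ TS[of ?V UNIV] _ L2_lin \<rho>_in[OF v]])
      show "cbilinear_on ?V UNIV (\<lambda>u a. ?T (?\<rho> u) a)"
        using b2 \<rho>_lin unfolding cbilinear_on_def clinear_on_def by simp
      show "?T (?\<rho> u) a \<in> tensor_space ?V UNIV" if "u \<in> ?V" for u a
        using T_in[OF \<rho>_in[OF that]] by simp
      show "L2 (?T (?\<rho> u) a) = \<psi> u \<otimes>\<^sub>C id a" if "u \<in> ?V" for u a
        using T_in[OF \<rho>_in[OF that]] that by (simp add: \<psi>_def)
    qed
    finally show ?thesis .
  qed

  have \<psi>_counit: "counit G (\<psi> v) = \<phi> v" if v: "v \<in> ?V" for v
  proof -
    have "counit G (\<psi> v) = tlift ?V UNIV (\<lambda>u a. \<phi> u * counit G a) (?\<rho> v)"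
      unfolding \<psi>_L[OF v] L_def
      by (rule tlift_compose[OF V U bilL U _ \<epsilon>_lin \<rho>_in[OF v]])
        (use \<epsilon>_lin in \<open>simp_all add: clinear_on_def\<close>)
    also have "\<dots> = \<phi> (tlift ?V UNIV (\<lambda>u a. counit G a *\<^sub>C u) (?\<rho> v))"
    proof (rule tlift_compose[OF V U _ V _ \<phi>_lin \<rho>_in[OF v], symmetric])
      show "cbilinear_on ?V UNIV (\<lambda>u a. counit G a *\<^sub>C u)"
        using \<epsilon>_lin unfolding cbilinear_on_def clinear_on_def
        by (auto simp: scaleC_add_left scaleC_add_right scaleC_scaleC mult.commute)
      show "counit G a *\<^sub>C u \<in> ?V" "\<phi> (counit G a *\<^sub>C u) = \<phi> u * counit G a" if "u \<in> ?V" for u a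
        using that V \<phi>_lin by (auto simp: cvec.subspace_scale clinear_on_def)
    qed
    finally show ?thesis using M v by (simp add: g_module_def)
  qed

  have \<psi>_ind: "tmap UNIV UNIV r id (?\<Delta> (\<psi> v)) = 1 \<otimes>\<^sub>C \<psi> v" if v: "v \<in> ?V" for v
  proof -
    have br: "cbilinear_on UNIV UNIV (\<lambda>a b::'a. r a \<otimes>\<^sub>C id b)"
      by (rule tmap_bilinear[OF r_lin clinear_on_id])
    have "tmap UNIV UNIV r id (?\<Delta> (\<psi> v)) = tmap UNIV UNIV r id (tmap ?V UNIV \<psi> id (?\<rho> v))"
      using \<psi>_eq[OF v] by simp
    also have "\<dots> = tlift ?V UNIV (\<lambda>u a. 1 \<otimes>\<^sub>C (\<phi> u *\<^sub>C a)) (?\<rho> v)"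
      unfolding tmap_def[of ?V]
    proof (rule tlift_compose[OF V U tmap_bilinear[OF \<psi>_lin clinear_on_id] U _ _ \<rho>_in[OF v]])
      show "clinear_on UNIV (tmap UNIV UNIV r (id :: 'a \<Rightarrow> 'a))"
        unfolding tmap_def using tlift_clinear[OF U U br] by simp
      show "tmap UNIV UNIV r id (\<psi> u \<otimes>\<^sub>C id a) = 1 \<otimes>\<^sub>C (\<phi> u *\<^sub>C a)" if "u \<in> ?V" for u and a :: 'a
      proof -
        have "tmap UNIV UNIV r id (\<psi> u \<otimes>\<^sub>C id a) = r (\<psi> u) \<otimes>\<^sub>C id (id a)"
          unfolding tmap_def by (rule tlift_tens[OF U U br]) auto
        then show ?thesis
          using \<psi>_r[OF that] by (simp add: tens_scale_left tens_scale_right)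
      qed
    qed auto
    also have "\<dots> = 1 \<otimes>\<^sub>C L (?\<rho> v)"
      unfolding L_def
      by (rule tlift_compose[OF V U bilL U _ _ \<rho>_in[OF v], symmetric])
        (auto simp: clinear_on_def tens_add_right tens_scale_right)
    finally show ?thesis using v by (simp add: \<psi>_def)
  qed

  have \<psi>_grade: "\<psi> v \<in> part G p" if v: "v \<in> grade M p" for v p
  proof -
    have vV: "v \<in> ?V" using superspace_grade[OF ss] v by blast
    have subp: "cvec.subspace (part G p)" using sG by (simp add: superspace_def)
    have "?\<rho> v \<in> tensor_grade (grade M) (part G) p"
      using M v unfolding g_module_def by blast
    then have "?\<rho> v \<in> tensor_space ?V UNIV \<and> L (?\<rho> v) \<in> part G p"
      unfolding tensor_grade_def
    proof (induction rule: cvec.span_induct_alt)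
      case base
      have "0 \<in> tensor_space ?V (UNIV :: 'a set)" by (simp add: cvec.subspace_0 TS)
      then show ?case
        using clinear_on_0[OF L_lin] subp by (simp add: cvec.subspace_0)
    next
      case (step c x y)
      then obtain u a q q' where x: "x = u \<otimes>\<^sub>C a" "u \<in> grade M q" "a \<in> part G q'" "(q \<noteq> q') = p"
        by auto
      have uV: "u \<in> ?V" using superspace_grade[OF ss] x by blast
      have xt: "x \<in> tensor_space ?V UNIV" using uV x by (simp add: tens_in_tensor_space)
      have "L x = \<phi> u *\<^sub>C a" unfolding L_def x by (rule tlift_tens[OF V U bilL uV]) simp
      moreover have "\<phi> u *\<^sub>C a \<in> part G p"
        using \<phi>_odd x subp by (cases q) (auto simp: cvec.subspace_0 cvec.subspace_scale)
      ultimately have "L x \<in> part G p" by simp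
      then show ?case
        using step xt L_lin subp unfolding clinear_on_def
        by (simp add: cvec.subspace_add cvec.subspace_scale TS)
    qed
    then show ?thesis using vV by (simp add: \<psi>_def)
  qed

  have grade_V: "u \<in> ?V" if "u \<in> grade M p" for u p
    using superspace_grade[OF ss] that by blast
  have \<psi>_hom: "\<psi> \<in> module_hom M (induced_trivial G r)"
    using \<psi>_lin \<psi>_grade \<psi>_ind \<psi>_eq grade_V
    unfolding module_hom_def induced_trivial_def Let_def by (auto simp: \<psi>_def[of "_ :: 'v"])
  have \<psi>_all: "counit G (\<psi> v) = \<phi> v" for v
    using \<psi>_counit \<phi>_out clinear_on_0[OF \<epsilon>_lin] by (cases "v \<in> ?V") (auto simp: \<psi>_def)
  have unique: "\<psi>' = \<psi>"
    if hom: "\<psi>' \<in> module_hom M (induced_trivial G r)" and cou: "\<And>v. counit G (\<psi>' v) = \<phi> v" for \<psi>'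
  proof
    fix v
    show "\<psi>' v = \<psi> v"
    proof (cases "v \<in> ?V")
      case False
      then show ?thesis using hom by (simp add: module_hom_def \<psi>_def)
    next
      case v: True
      have lin: "clinear_on ?V \<psi>'" and eq: "?\<Delta> (\<psi>' v) = tmap ?V UNIV \<psi>' id (?\<rho> v)"
        using hom v by (auto simp: module_hom_def induced_trivial_def Let_def)
      have bc: "cbilinear_on UNIV UNIV (\<lambda>b c. counit G b *\<^sub>C (c :: 'a))"
        using \<epsilon>_lin unfolding cbilinear_on_def clinear_on_def
        by (auto simp: scaleC_add_left scaleC_add_right scaleC_scaleC mult.commute)
      have "\<psi>' v = tlift_all (\<lambda>b c. counit G b *\<^sub>C c) (?\<Delta> (\<psi>' v))"
        using hopf by simp
      also have "\<dots> = tlift ?V UNIV (\<lambda>u a. \<phi> u *\<^sub>C a) (?\<rho> v)"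
        unfolding eq tmap_def
        by (rule tlift_compose[OF V U tmap_bilinear[OF lin clinear_on_id] U _ _ \<rho>_in[OF v]])
          (use tlift_clinear[OF U U bc] in \<open>simp_all add: tlift_tens[OF U U bc] cou\<close>)
      finally show ?thesis using v by (simp add: \<psi>_def L_def)
    qed
  qed
  show ?thesis
    using \<psi>_hom \<psi>_all unique by blast
qed

text \<open>The map from the trivial module adjoint to the identity; see \<open>induction_unit_adjoint\<close> below.\<close>

definition induction_unit :: "complex \<Rightarrow> 'a::complex_algebra_1" where
  "induction_unit c = c *\<^sub>C 1"

lemma induction_unit_adjoint:
  fixes G :: "'a::complex_algebra_1 supergroup" and r :: "'a \<Rightarrow> 'b::complex_algebra_1"
  assumes G: "affine_algebraic_supergroup G" and r: "closed_subgroup G K r"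
  shows "induction_unit \<in> module_hom trivial_module (induced_trivial G r)"
    and "counit G (induction_unit c) = c"
proof -
  note hopf = G[unfolded affine_algebraic_supergroup_def hopf_superalgebra_def]
  note U = cvec.subspace_UNIV
  have alg: "supercomm_algebra (part G)" using G by (simp add: affine_algebraic_supergroup_def)
  have sub: "cvec.subspace (part G p)" for p
    using alg by (simp add: supercomm_algebra_def superspace_def)
  have r_lin: "clinear_on UNIV r" and r1: "r 1 = 1" using r by (auto simp: closed_subgroup_def)
  have \<Delta>1: "comult G (c *\<^sub>C 1) = c *\<^sub>C (1 \<otimes>\<^sub>C 1)" and \<epsilon>1: "counit G (c *\<^sub>C 1) = c" for c
    using hopf by (auto simp: clinear_on_def)
  show "counit G (induction_unit c) = c" by (simp add: induction_unit_def \<epsilon>1)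
  have unit_lin: "clinear_on UNIV (induction_unit :: complex \<Rightarrow> 'a)"
    by (simp add: clinear_on_def induction_unit_def scaleC_add_left scaleC_scaleC)
  have "tmap UNIV UNIV r id (c *\<^sub>C 1 \<otimes>\<^sub>C (1::'a)) = r (c *\<^sub>C 1) \<otimes>\<^sub>C id 1" for c
    unfolding tmap_def by (rule tlift_tens[OF U U tmap_bilinear[OF r_lin clinear_on_id]]) auto
  then have inv: "tmap UNIV UNIV r id (comult G (c *\<^sub>C 1)) = 1 \<otimes>\<^sub>C (c *\<^sub>C 1)" for c
    using r_lin r1 by (simp add: \<Delta>1 clinear_on_def tens_scale_left tens_scale_right)
  have inv0: "tmap UNIV UNIV r id (comult G 0) = 1 \<otimes>\<^sub>C 0" using inv[of 0] by simp
  have "tmap UNIV UNIV (induction_unit :: complex \<Rightarrow> 'a) id (c \<otimes>\<^sub>C (1::'a)) = induction_unit c \<otimes>\<^sub>C id (1::'a)" for c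
    unfolding tmap_def by (rule tlift_tens[OF U U tmap_bilinear[OF unit_lin clinear_on_id]]) auto
  then have eq: "comult G (induction_unit c) = tmap UNIV UNIV (induction_unit :: complex \<Rightarrow> 'a) id (c \<otimes>\<^sub>C (1::'a))" for c
    by (simp add: induction_unit_def \<Delta>1 tens_scale_left)
  have "induction_unit c \<in> part G False" "induction_unit 0 = (0::'a)" for c
    using alg sub by (auto simp: induction_unit_def supercomm_algebra_def cvec.subspace_scale)
  then have "induction_unit ` grade (trivial_module :: (complex, 'a) supermodule) p \<subseteq> part G p" for p
    using sub by (cases p) (auto simp: trivial_module_def cvec.subspace_0)
  then show "induction_unit \<in> module_hom trivial_module (induced_trivial G r)"
    using unit_lin inv inv0 eq
    by (auto simp: module_hom_def trivial_module_def induced_trivial_def Let_def induction_unit_def)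
qed

definition splitting_subgroup :: "'a::complex_algebra_1 supergroup \<Rightarrow> 'b::complex_algebra_1 supergroup \<Rightarrow>
    ('a \<Rightarrow> 'b) \<Rightarrow> bool" where
  "splitting_subgroup G K r \<longleftrightarrow> quasireductive K \<and> closed_subgroup G K r \<and>
     (\<exists>s \<in> module_hom (induced_trivial G r) trivial_module. \<forall>c. s (induction_unit c) = c)"


section \<open>The functors DS and proper pairs\<close>

text \<open>The action \<open>(id \<otimes> x) \<circ> coact\<close> of \<open>x\<close> of parity \<open>p\<close>, with the Koszul sign.\<close>

definition lie_action :: "bool \<Rightarrow> ('a::complex_algebra_1 \<Rightarrow> complex) \<Rightarrow>
    ('v::complex_vector, 'a) supermodule \<Rightarrow> 'v \<Rightarrow> 'v" where
  "lie_action p x M v =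
     tlift (carr M) UNIV (\<lambda>u a. x a *\<^sub>C (\<Sum>q\<in>UNIV. psgn p q *\<^sub>C gproj (grade M) q u)) (coact M v)"

definition DS_ker :: "('a::complex_algebra_1 \<Rightarrow> complex) \<Rightarrow>
    ('v::complex_vector, 'a) supermodule \<Rightarrow> 'v set" where
  "DS_ker x M = {v \<in> carr M. lie_action True x M v = 0}"

definition DS_im :: "('a::complex_algebra_1 \<Rightarrow> complex) \<Rightarrow>
    ('v::complex_vector, 'a) supermodule \<Rightarrow> 'v set" where
  "DS_im x M = lie_action True x M ` carr M"

text \<open>\<open>DS_x M \<cong> W\<close> as super vector spaces: a linear map out of the quotient \<open>DS_ker / (DS_im \<inter> DS_ker)\<close>
  is a linear map on \<open>DS_ker\<close> that kills \<open>DS_im \<inter> DS_ker\<close>.\<close>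

definition DS_iso :: "('a::complex_algebra_1 \<Rightarrow> complex) \<Rightarrow> ('v::complex_vector, 'a) supermodule \<Rightarrow>
    'w::complex_vector set \<Rightarrow> (bool \<Rightarrow> 'w set) \<Rightarrow> bool" where
  "DS_iso x M W gr \<longleftrightarrow> (\<exists>f. clinear_on (DS_ker x M) f \<and>
     (\<forall>p. f ` (DS_ker x M \<inter> grade M p) \<subseteq> gr p) \<and>
     f ` DS_ker x M = W \<and> {v \<in> DS_ker x M. f v = 0} = DS_im x M \<inter> DS_ker x M)"

text \<open>\<open>x \<circ> r\<close> is the image of \<open>x\<close> under the inclusion of the Lie superalgebra of \<open>K\<close> in that of \<open>G\<close>.\<close>

definition proper_pair :: "'a::complex_algebra_1 supergroup \<Rightarrow> 'b::complex_algebra_1 supergroup \<Rightarrow>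
    ('a \<Rightarrow> 'b) \<Rightarrow> bool" where
  "proper_pair G K r \<longleftrightarrow> quasireductive G \<and> splitting_subgroup G K r \<and>
     (\<exists>x\<in>homological K. DS_iso (x \<circ> r) (induced_trivial G r)
        (carr (trivial_module :: (complex, 'a) supermodule))
        (grade (trivial_module :: (complex, 'a) supermodule)))"


section \<open>The trace\<close>

definition dual_carr :: "'v::complex_vector set \<Rightarrow> ('v \<Rightarrow> complex) set" where
  "dual_carr V = {\<phi>. clinear_on V \<phi> \<and> (\<forall>v. v \<notin> V \<longrightarrow> \<phi> v = 0)}"

definition dual_grade :: "'v::complex_vector set \<Rightarrow> (bool \<Rightarrow> 'v set) \<Rightarrow> bool \<Rightarrow> ('v \<Rightarrow> complex) set" where
  "dual_grade V gr p = {\<phi> \<in> dual_carr V. \<forall>v\<in>gr (\<not> p). \<phi> v = 0}"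

text \<open>The image of 1 under coevaluation: the sum of \<open>b \<otimes> b\<^sup>*\<close> over a homogeneous basis \<open>B\<close>;
  \<open>representation B v b\<close> is the \<open>b\<close>-coordinate of \<open>v\<close>, and 0 for \<open>v\<close> outside the span of \<open>B\<close>.\<close>

definition coev :: "('v::complex_vector, 'a::complex_vector) supermodule \<Rightarrow> ('v, 'v \<Rightarrow> complex) tensor" where
  "coev M = (let B = (SOME B. cvec.independent B \<and> cvec.span B = carr M \<and>
       B \<subseteq> grade M False \<union> grade M True)
     in \<Sum>b\<in>B. b \<otimes>\<^sub>C (\<lambda>v. cvec.representation B v b))"

definition braiding :: "'v::complex_vector set \<Rightarrow> (bool \<Rightarrow> 'v set) \<Rightarrow>
    'w::complex_vector set \<Rightarrow> (bool \<Rightarrow> 'w set) \<Rightarrow> ('v, 'w) tensor \<Rightarrow> ('w, 'v) tensor" where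
  "braiding V gr W gr' =
     tlift V W (\<lambda>v w. \<Sum>p\<in>UNIV. \<Sum>q\<in>UNIV. psgn p q *\<^sub>C (gproj gr' q w \<otimes>\<^sub>C gproj gr p v))"

definition evaluation :: "'v::complex_vector set \<Rightarrow> ('v \<Rightarrow> complex, 'v) tensor \<Rightarrow> complex" where
  "evaluation V = tlift (dual_carr V) V (\<lambda>\<phi> v. \<phi> v)"

definition cat_trace :: "('v::complex_vector, 'a::complex_vector) supermodule \<Rightarrow> ('v \<Rightarrow> 'v) \<Rightarrow> complex" where
  "cat_trace M f = evaluation (carr M)
     (braiding (carr M) (grade M) (dual_carr (carr M)) (dual_grade (carr M) (grade M))
       (tmap (carr M) (dual_carr (carr M)) f id (coev M)))"


section \<open>Categories, quotient categories and semisimplification\<close>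

text \<open>\<open>cmp C X Y Z g f\<close> is the composite of \<open>f : X \<rightarrow> Y\<close> and \<open>g : Y \<rightarrow> Z\<close>.\<close>

record ('o, 'm) category =
  obj :: "'o set"
  hom :: "'o \<Rightarrow> 'o \<Rightarrow> 'm set"
  ident :: "'o \<Rightarrow> 'm"
  cmp :: "'o \<Rightarrow> 'o \<Rightarrow> 'o \<Rightarrow> 'm \<Rightarrow> 'm \<Rightarrow> 'm"

record ('o, 'm, 'p, 'n) cat_functor =
  on_obj :: "'o \<Rightarrow> 'p"
  on_mor :: "'o \<Rightarrow> 'o \<Rightarrow> 'm \<Rightarrow> 'n"

definition is_functor :: "('o, 'm) category \<Rightarrow> ('p, 'n) category \<Rightarrow> ('o, 'm, 'p, 'n) cat_functor \<Rightarrow> bool" where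
  "is_functor C D F \<longleftrightarrow>
     (\<forall>X\<in>obj C. on_obj F X \<in> obj D) \<and>
     (\<forall>X\<in>obj C. \<forall>Y\<in>obj C. \<forall>f\<in>hom C X Y. on_mor F X Y f \<in> hom D (on_obj F X) (on_obj F Y)) \<and>
     (\<forall>X\<in>obj C. on_mor F X X (ident C X) = ident D (on_obj F X)) \<and>
     (\<forall>X\<in>obj C. \<forall>Y\<in>obj C. \<forall>Z\<in>obj C. \<forall>f\<in>hom C X Y. \<forall>g\<in>hom C Y Z.
        on_mor F X Z (cmp C X Y Z g f) =
        cmp D (on_obj F X) (on_obj F Y) (on_obj F Z) (on_mor F Y Z g) (on_mor F X Y f))"

definition full_functor :: "('o, 'm) category \<Rightarrow> ('p, 'n) category \<Rightarrow> ('o, 'm, 'p, 'n) cat_functor \<Rightarrow> bool" where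
  "full_functor C D F \<longleftrightarrow> is_functor C D F \<and>
     (\<forall>X\<in>obj C. \<forall>Y\<in>obj C. on_mor F X Y ` hom C X Y = hom D (on_obj F X) (on_obj F Y))"

text \<open>The quotient of a category by a congruence \<open>R\<close> on its hom sets, the quotient functor, and the
  functor induced by \<open>F\<close> between the quotients by \<open>R\<close> and \<open>R'\<close>.\<close>

definition quotient_category :: "('o, 'm) category \<Rightarrow> ('o \<Rightarrow> 'o \<Rightarrow> 'm rel) \<Rightarrow> ('o, 'm set) category" where
  "quotient_category C R = \<lparr>obj = obj C, hom = (\<lambda>X Y. hom C X Y // R X Y),
     ident = (\<lambda>X. R X X `` {ident C X}),
     cmp = (\<lambda>X Y Z d c. \<Union>g\<in>d. \<Union>f\<in>c. R X Z `` {cmp C X Y Z g f})\<rparr>"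

definition quotient_functor :: "('o \<Rightarrow> 'o \<Rightarrow> 'm rel) \<Rightarrow> ('o, 'm, 'o, 'm set) cat_functor" where
  "quotient_functor R = \<lparr>on_obj = (\<lambda>X. X), on_mor = (\<lambda>X Y f. R X Y `` {f})\<rparr>"

definition induced_functor :: "('p \<Rightarrow> 'p \<Rightarrow> 'n rel) \<Rightarrow> ('o, 'm, 'p, 'n) cat_functor \<Rightarrow>
    ('o, 'm set, 'p, 'n set) cat_functor" where
  "induced_functor R' F = \<lparr>on_obj = on_obj F,
     on_mor = (\<lambda>X Y c. \<Union>f\<in>c. R' (on_obj F X) (on_obj F Y) `` {on_mor F X Y f})\<rparr>"

text \<open>The finite-dimensional modules with underlying space inside \<open>'v\<close>; for infinite-dimensional \<open>'v\<close>
  every finite-dimensional module is isomorphic to one of these.\<close>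

definition rep_category :: "'a::complex_algebra_1 supergroup \<Rightarrow>
    (('v::complex_vector, 'a) supermodule, 'v \<Rightarrow> 'v) category" where
  "rep_category G = \<lparr>obj = {M. g_module G M \<and> finite_dim M}, hom = module_hom,
     ident = (\<lambda>M v. if v \<in> carr M then v else 0), cmp = (\<lambda>L M N g f. g \<circ> f)\<rparr>"

definition restriction_functor :: "('a \<Rightarrow> 'b) \<Rightarrow>
    (('v::complex_vector, 'a::complex_algebra_1) supermodule, 'v \<Rightarrow> 'v,
     ('v, 'b::complex_algebra_1) supermodule, 'v \<Rightarrow> 'v) cat_functor" where
  "restriction_functor r = \<lparr>on_obj = restrict_module r, on_mor = (\<lambda>M N f. f)\<rparr>"

definition negligible_mor :: "('v::complex_vector, 'a::complex_vector) supermodule \<Rightarrow>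
    ('v, 'a) supermodule \<Rightarrow> ('v \<Rightarrow> 'v) \<Rightarrow> bool" where
  "negligible_mor M N f \<longleftrightarrow> f \<in> module_hom M N \<and> (\<forall>g\<in>module_hom N M. cat_trace N (f \<circ> g) = 0)"

definition negligible_rel :: "('v::complex_vector, 'a::complex_vector) supermodule \<Rightarrow>
    ('v, 'a) supermodule \<Rightarrow> ('v \<Rightarrow> 'v) rel" where
  "negligible_rel M N =
     {(f, g). f \<in> module_hom M N \<and> g \<in> module_hom M N \<and> negligible_mor M N (\<lambda>v. f v - g v)}"

definition semisimplification :: "'a::complex_algebra_1 supergroup \<Rightarrow>
    (('v::complex_vector, 'a) supermodule, ('v \<Rightarrow> 'v) set) category" where
  "semisimplification G = quotient_category (rep_category G) negligible_rel"

text \<open>If \<open>F\<close> preserves the congruences, then \<open>induced_functor R' F\<close> is the unique functor \<open>H\<close> between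
  the quotients with \<open>H \<circ> quotient_functor R = quotient_functor R' \<circ> F\<close>.\<close>

lemma induced_functor_quotient:
  assumes R: "equiv (hom C X Y) (R X Y)" and R': "equiv (hom D (on_obj F X) (on_obj F Y)) (R' (on_obj F X) (on_obj F Y))"
    and resp: "\<And>f g. (f, g) \<in> R X Y \<Longrightarrow> (on_mor F X Y f, on_mor F X Y g) \<in> R' (on_obj F X) (on_obj F Y)"
    and f: "f \<in> hom C X Y"
  shows "on_mor (induced_functor R' F) X Y (on_mor (quotient_functor R) X Y f) =
    on_mor (quotient_functor R') (on_obj F X) (on_obj F Y) (on_mor F X Y f)"
proof -
  have "R' (on_obj F X) (on_obj F Y) `` {on_mor F X Y g} = R' (on_obj F X) (on_obj F Y) `` {on_mor F X Y f}"
    if "(f, g) \<in> R X Y" for g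
    by (rule equiv_class_eq[OF R' resp[OF that], symmetric])
  moreover have "f \<in> R X Y `` {f}"
    using equiv_class_self[OF R f] .
  ultimately have "(\<Union>g\<in>R X Y `` {f}. R' (on_obj F X) (on_obj F Y) `` {on_mor F X Y g}) =
      R' (on_obj F X) (on_obj F Y) `` {on_mor F X Y f}"
    by blast
  then show ?thesis
    by (simp add: induced_functor_def quotient_functor_def)
qed

lemma induced_functor_unique:
  assumes "equiv (hom C X Y) (R X Y)" and "equiv (hom D (on_obj F X) (on_obj F Y)) (R' (on_obj F X) (on_obj F Y))"
    and "\<And>f g. (f, g) \<in> R X Y \<Longrightarrow> (on_mor F X Y f, on_mor F X Y g) \<in> R' (on_obj F X) (on_obj F Y)"
    and H: "\<And>f. f \<in> hom C X Y \<Longrightarrow> on_mor H X Y (on_mor (quotient_functor R) X Y f) =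
      on_mor (quotient_functor R') (on_obj F X) (on_obj F Y) (on_mor F X Y f)"
    and c: "c \<in> hom (quotient_category C R) X Y"
  shows "on_mor H X Y c = on_mor (induced_functor R' F) X Y c"
proof -
  obtain f where f: "f \<in> hom C X Y" "c = on_mor (quotient_functor R) X Y f"
    using c by (auto simp: quotient_category_def quotient_functor_def quotient_def)
  then show ?thesis
    using H[OF f(1)] induced_functor_quotient[of C X Y R D F R', OF assms(1-3) f(1)] by simp
qed

end

(*
  Averaging: let F be a K-morphism between restrictions of finite-dimensional G-modules M and N. The
  matrix E = (g \<mapsto> g\<inverse> F g) has entries in Ind C, and applying the splitting s : Ind C \<rightarrow> C entrywise gives a
  G-morphism s(E). For any K-morphism H : N \<rightarrow> M the function T = str(E H) is K-invariant, and
  str(s(E) H) = s(T) whereas str(F H) = T(1). Now s and evaluation at 1 are both K-invariant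
  functionals on Ind C, hence kill Im x, and both have value 1 at the constant 1, whose class spans
  DS_x Ind C = C; so they agree on Ker x, which contains T. Hence F - s(E) is negligible over K. That restriction preserves
  negligible morphisms follows by averaging the test morphism H instead.
*)
theory Submission
  imports Defs
begin

section \<open>Linear maps and tensors\<close>

text \<open>The two sides of K enter separately. The entries of E are invariant under left
  translation by K because F commutes with K, and this puts them in Ind C. T is moreover invariant
  under right translation by K, the action on Ind C that x differentiates, because H commutes with
  K. All computations use matrix coefficients in homogeneous bases. These lie in a supercommutative
  ring, so exchanging two of them costs a sign; this is why cyclicity is a property of the
  supertrace, and evenness of F and H makes the remaining signs cancel. The antipode enters only
  through its two convolution identities, which say that the coefficient matrix C of N is
  invertible. E is then the unique solution of C E = F A, with A the coefficient matrix of M, and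
  its coproduct and its value at 1 are obtained by applying the coproduct and the counit to this
  equation, without a formula for the coproduct of the antipode. Restriction changes neither the
  space nor the grading, so a single choice of basis serves both G and K.\<close>

lemma clinear_on_sum:
  assumes "clinear_on V f" "cvec.subspace V" "\<And>i. i \<in> S \<Longrightarrow> g i \<in> V"
  shows "f (\<Sum>i\<in>S. g i) = (\<Sum>i\<in>S. f (g i))"
  using assms(3)
proof (induction S rule: infinite_finite_induct)
  case (insert i S)
  then have "(\<Sum>i\<in>S. g i) \<in> V" "g i \<in> V" using assms(2) by (auto intro: cvec.subspace_sum)
  then show ?case using insert assms(1) by (simp add: clinear_on_def)
qed (use clinear_on_0[OF assms(1)] cvec.subspace_0[OF assms(2)] in auto)

lemma clinear_on_addD: "clinear_on V f \<Longrightarrow> u \<in> V \<Longrightarrow> v \<in> V \<Longrightarrow> f (u + v) = f u + f v"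
  and clinear_on_scaleD: "clinear_on V f \<Longrightarrow> v \<in> V \<Longrightarrow> f (c *\<^sub>C v) = c *\<^sub>C f v"
  by (simp_all add: clinear_on_def)

lemma clinear_on_diffD:
  assumes "clinear_on V f" "cvec.subspace V" "u \<in> V" "v \<in> V"
  shows "f (u - v) = f u - f v"
proof -
  have "f ((u - v) + v) = f (u - v) + f v"
    using assms by (intro clinear_on_addD[of V]) (auto simp: cvec.subspace_diff)
  then show ?thesis by simp
qed

lemmas clinear_sum = clinear_on_sum[OF _ cvec.subspace_UNIV UNIV_I]
lemmas clinear_add = clinear_on_addD[OF _ UNIV_I UNIV_I]
lemmas clinear_scale = clinear_on_scaleD[OF _ UNIV_I]
lemmas clinear_diff = clinear_on_diffD[OF _ cvec.subspace_UNIV UNIV_I UNIV_I]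

lemma clinear_zero: "clinear_on UNIV f \<Longrightarrow> f 0 = 0"
  by (rule clinear_on_0) auto

lemma clinear_on_subset: "clinear_on V f \<Longrightarrow> W \<subseteq> V \<Longrightarrow> clinear_on W f"
  unfolding clinear_on_def by blast

lemma clinear_comp: "clinear_on UNIV f \<Longrightarrow> clinear_on UNIV g \<Longrightarrow> clinear_on UNIV (\<lambda>x. f (g x))"
  by (simp add: clinear_on_def)

lemma clinear_on_diff: "clinear_on V f \<Longrightarrow> clinear_on V g \<Longrightarrow> clinear_on V (\<lambda>v. f v - g v)"
  unfolding clinear_on_def by (simp add: cvec.scale_right_diff_distrib)

lemma clinear_on_sum_fun:
  assumes "\<And>i. i \<in> S \<Longrightarrow> clinear_on V (f i)"
  shows "clinear_on V (\<lambda>v. \<Sum>i\<in>S. f i v)"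
  using assms by (simp add: clinear_on_def sum.distrib cvec.scale_sum_right)

lemma clinear_on_const_scale: "clinear_on V f \<Longrightarrow> clinear_on V (\<lambda>v. f v *\<^sub>C w)"
  by (simp add: clinear_on_def scaleC_add_left scaleC_scaleC)

lemma clinear_mult_left: "clinear_on UNIV (\<lambda>x::'a::complex_algebra_1. a * x)"
  and clinear_mult_right: "clinear_on UNIV (\<lambda>x::'a::complex_algebra_1. x * a)"
  by (simp_all add: clinear_on_def distrib_left distrib_right mult_scaleC_left mult_scaleC_right)

lemma tens_zero_left [simp]: "0 \<otimes>\<^sub>C b = 0"
  and tens_zero_right [simp]: "a \<otimes>\<^sub>C 0 = 0"
  using tens_scale_left[of 0 0 b] tens_scale_right[of a 0 0] by simp_all

lemma tens_sum_left: "(\<Sum>i\<in>S. f i) \<otimes>\<^sub>C b = (\<Sum>i\<in>S. f i \<otimes>\<^sub>C b)"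
  and tens_sum_right: "a \<otimes>\<^sub>C (\<Sum>i\<in>S. g i) = (\<Sum>i\<in>S. a \<otimes>\<^sub>C g i)"
  by (induction S rule: infinite_finite_induct) (simp_all add: tens_add_left tens_add_right)

lemma tens_diff_left: "(a - a') \<otimes>\<^sub>C b = a \<otimes>\<^sub>C b - a' \<otimes>\<^sub>C b"
  by (metis add_diff_cancel_right' diff_add_cancel tens_add_left)

lemma clinear_tens_left: "clinear_on V (\<lambda>a. a \<otimes>\<^sub>C b)"
  and clinear_tens_right: "clinear_on W (\<lambda>b. a \<otimes>\<^sub>C b)"
  by (simp_all add: clinear_on_def tens_add_left tens_add_right tens_scale_left tens_scale_right)

lemma tensor_ext:
  assumes "clinear_on UNIV f" "clinear_on UNIV g" "\<And>a b. f (a \<otimes>\<^sub>C b) = g (a \<otimes>\<^sub>C b)"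
  shows "f t = g t"
  by (rule tensor_space_ext[of UNIV UNIV]) (use assms in auto)

text \<open>Trades the list presentation of a tensor for an indexed sum, the form in which
  \<open>tlift\<close> and \<open>tmap\<close> are evaluated from here on.\<close>

lemma tensor_space_sum:
  assumes "cvec.subspace V" "t \<in> tensor_space V W"
  obtains n :: nat and v w where "\<And>i. i < n \<Longrightarrow> v i \<in> V" "\<And>i. i < n \<Longrightarrow> w i \<in> W"
    "t = (\<Sum>i<n. v i \<otimes>\<^sub>C w i)"
proof -
  obtain xs where xs: "set xs \<subseteq> V \<times> W" "t = pure_sum xs"
    using tensor_space_pure_sum[OF assms] .
  have "t = (\<Sum>i<length xs. fst (xs ! i) \<otimes>\<^sub>C snd (xs ! i))"
    unfolding xs(2) pure_sum_def
    by (simp add: sum_list_sum_nth case_prod_beta atLeast0LessThan)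
  moreover have "fst (xs ! i) \<in> V" "snd (xs ! i) \<in> W" if "i < length xs" for i
    using subsetD[OF xs(1) nth_mem[OF that]] by (auto simp: mem_Times_iff)
  ultimately show ?thesis by (rule that[rotated 2])
qed

lemma tlift_sum:
  assumes V: "cvec.subspace V" and W: "cvec.subspace W" and f: "cbilinear_on V W f"
    and v: "\<And>i. i \<in> S \<Longrightarrow> v i \<in> V" and w: "\<And>i. i \<in> S \<Longrightarrow> w i \<in> W"
  shows "tlift V W f (\<Sum>i\<in>S. v i \<otimes>\<^sub>C w i) = (\<Sum>i\<in>S. f (v i) (w i))"
proof -
  have "tlift V W f (\<Sum>i\<in>S. v i \<otimes>\<^sub>C w i) = (\<Sum>i\<in>S. tlift V W f (v i \<otimes>\<^sub>C w i))"
    by (rule clinear_on_sum[OF tlift_clinear[OF V W f] subspace_tensor_space])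
      (simp add: v w tens_in_tensor_space)
  also have "\<dots> = (\<Sum>i\<in>S. f (v i) (w i))"
    by (intro sum.cong refl tlift_tens[OF V W f]) (simp_all add: v w)
  finally show ?thesis .
qed

lemma cbilinear_onI:
  assumes "\<And>w. w \<in> W \<Longrightarrow> clinear_on V (\<lambda>v. f v w)" "\<And>v. v \<in> V \<Longrightarrow> clinear_on W (f v)"
  shows "cbilinear_on V W f"
  using assms by (simp add: cbilinear_on_def)

lemma cbilinear_scale:
  "clinear_on V f \<Longrightarrow> clinear_on W g \<Longrightarrow> cbilinear_on V W (\<lambda>v w. f v *\<^sub>C g w)"
  "clinear_on V f' \<Longrightarrow> clinear_on W g' \<Longrightarrow> cbilinear_on V W (\<lambda>v w. g' w *\<^sub>C f' v)"
  unfolding cbilinear_on_def clinear_on_def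
  by (auto simp: scaleC_add_left scaleC_add_right scaleC_scaleC mult.commute)

lemma tmap_sum:
  assumes "cvec.subspace V" "clinear_on V f" "clinear_on UNIV g" "\<And>i. i \<in> S \<Longrightarrow> v i \<in> V"
  shows "tmap V UNIV f g (\<Sum>i\<in>S. v i \<otimes>\<^sub>C w i) = (\<Sum>i\<in>S. f (v i) \<otimes>\<^sub>C g (w i))"
  unfolding tmap_def
  by (rule tlift_sum[OF assms(1) cvec.subspace_UNIV tmap_bilinear[OF assms(2,3)]])
    (simp_all add: assms(4))

section \<open>Tensor products of linear maps defined on the whole type\<close>

abbreviation tmap_all :: "('a::complex_vector \<Rightarrow> 'c::complex_vector) \<Rightarrow> ('b::complex_vector \<Rightarrow> 'd::complex_vector) \<Rightarrow>
    ('a, 'b) tensor \<Rightarrow> ('c, 'd) tensor" where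
  "tmap_all \<equiv> tmap UNIV UNIV"

lemma clinear_tlift: "cbilinear_on UNIV UNIV f \<Longrightarrow> clinear_on UNIV (tlift_all f)"
  using tlift_clinear[of UNIV UNIV f] by simp

lemma tlift_all_tens: "cbilinear_on UNIV UNIV f \<Longrightarrow> tlift_all f (a \<otimes>\<^sub>C b) = f a b"
  by (rule tlift_tens) auto

lemma clinear_tmap:
  "clinear_on UNIV f \<Longrightarrow> clinear_on UNIV g \<Longrightarrow> clinear_on UNIV (tmap_all f g)"
  unfolding tmap_def by (intro clinear_tlift tmap_bilinear)

lemma tmap_tens:
  "clinear_on UNIV f \<Longrightarrow> clinear_on UNIV g \<Longrightarrow> tmap_all f g (a \<otimes>\<^sub>C b) = f a \<otimes>\<^sub>C g b"
  unfolding tmap_def by (simp add: tlift_all_tens tmap_bilinear)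

lemma tmap_tmap:
  assumes "clinear_on UNIV f" "clinear_on UNIV g" "clinear_on UNIV f'" "clinear_on UNIV g'"
  shows "tmap_all f g (tmap_all f' g' t) = tmap_all (\<lambda>x. f (f' x)) (\<lambda>x. g (g' x)) t"
  by (rule tensor_ext) (use assms in \<open>simp_all add: tmap_tens clinear_tmap clinear_comp\<close>)

lemma tmap_sum_right:
  assumes "clinear_on UNIV f" "\<And>i. i \<in> S \<Longrightarrow> clinear_on UNIV (g i)"
  shows "(\<Sum>i\<in>S. tmap_all f (g i) t) = tmap_all f (\<lambda>x. \<Sum>i\<in>S. g i x) t"
proof (rule tensor_ext[of "\<lambda>t. \<Sum>i\<in>S. tmap_all f (g i) t"])
  show "clinear_on UNIV (\<lambda>t. \<Sum>i\<in>S. tmap_all f (g i) t)"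
    by (intro clinear_on_sum_fun clinear_tmap assms)
qed (use assms in \<open>simp_all add: tmap_tens clinear_tmap clinear_on_sum_fun tens_sum_right\<close>)

lemma tmap_sum_left:
  assumes "clinear_on UNIV g" "\<And>i. i \<in> S \<Longrightarrow> clinear_on UNIV (f i)"
  shows "(\<Sum>i\<in>S. tmap_all (f i) g t) = tmap_all (\<lambda>x. \<Sum>i\<in>S. f i x) g t"
proof (rule tensor_ext[of "\<lambda>t. \<Sum>i\<in>S. tmap_all (f i) g t"])
  show "clinear_on UNIV (\<lambda>t. \<Sum>i\<in>S. tmap_all (f i) g t)"
    by (intro clinear_on_sum_fun clinear_tmap assms)
qed (use assms in \<open>simp_all add: tmap_tens clinear_tmap clinear_on_sum_fun tens_sum_left\<close>)

lemma clinear_on_ident: "clinear_on V (\<lambda>x. x)"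
  by (simp add: clinear_on_def)

lemma tmap_id: "tmap_all (\<lambda>x. x) (\<lambda>x. x) t = t"
  by (rule tensor_ext[of "tmap_all (\<lambda>x. x) (\<lambda>x. x)" "\<lambda>x. x"])
    (simp_all add: clinear_tmap tmap_tens clinear_on_ident)

text \<open>Iterated lifts such as \<open>tassoc\<close> and \<open>tensor_mult\<close> need
  linearity in a parameter. Since \<open>tlift\<close> picks a presentation depending on its
  argument, additivity in \<open>c\<close> is not visible from the definition; it is checked on pure
  tensors and extended by linearity in \<open>t\<close>.\<close>

lemma cbilinear_tlift_param:
  assumes b: "\<And>c. cbilinear_on UNIV UNIV (\<lambda>a b. f a b c)" and l: "\<And>a b. clinear_on UNIV (f a b)"
  shows "cbilinear_on UNIV UNIV (\<lambda>t c. tlift_all (\<lambda>a b. f a b c) t)"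
proof (rule cbilinear_onI)
  show "clinear_on UNIV (\<lambda>t. tlift_all (\<lambda>a b. f a b c) t)" for c by (rule clinear_tlift[OF b])
  fix t
  show "clinear_on UNIV (\<lambda>c. tlift_all (\<lambda>a b. f a b c) t)"
    unfolding clinear_on_def
  proof (intro conjI ballI allI)
    fix c d
    show "tlift_all (\<lambda>a b. f a b (c + d)) t = tlift_all (\<lambda>a b. f a b c) t + tlift_all (\<lambda>a b. f a b d) t"
    proof (rule tensor_ext)
      show "clinear_on UNIV (\<lambda>t. tlift_all (\<lambda>a b. f a b c) t + tlift_all (\<lambda>a b. f a b d) t)"
        by (intro clinear_on_add clinear_tlift b)
      show "clinear_on UNIV (tlift_all (\<lambda>a b. f a b (c + d)))" by (rule clinear_tlift[OF b])
      show "tlift_all (\<lambda>a b. f a b (c + d)) (a \<otimes>\<^sub>C a') =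
        tlift_all (\<lambda>a b. f a b c) (a \<otimes>\<^sub>C a') + tlift_all (\<lambda>a b. f a b d) (a \<otimes>\<^sub>C a')" for a a'
        unfolding tlift_all_tens[OF b] by (rule clinear_add[OF l])
    qed
  next
    fix z c
    show "tlift_all (\<lambda>a b. f a b (z *\<^sub>C c)) t = z *\<^sub>C tlift_all (\<lambda>a b. f a b c) t"
    proof (rule tensor_ext)
      show "clinear_on UNIV (\<lambda>t. z *\<^sub>C tlift_all (\<lambda>a b. f a b c) t)"
        by (intro clinear_on_scale clinear_tlift b)
      show "clinear_on UNIV (tlift_all (\<lambda>a b. f a b (z *\<^sub>C c)))" by (rule clinear_tlift[OF b])
      show "tlift_all (\<lambda>a b. f a b (z *\<^sub>C c)) (a \<otimes>\<^sub>C a') =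
        z *\<^sub>C tlift_all (\<lambda>a b. f a b c) (a \<otimes>\<^sub>C a')" for a a'
        unfolding tlift_all_tens[OF b] by (rule clinear_scale[OF l])
    qed
  qed
qed

lemma tassoc_bilinear: "cbilinear_on UNIV UNIV (\<lambda>t c. tlift_all (\<lambda>a b. a \<otimes>\<^sub>C (b \<otimes>\<^sub>C c)) t)"
  by (rule cbilinear_tlift_param)
    (auto simp: cbilinear_on_def clinear_on_def tens_add_left tens_add_right tens_scale_left tens_scale_right)

lemma clinear_tassoc: "clinear_on UNIV tassoc"
  unfolding tassoc_def by (rule clinear_tlift[OF tassoc_bilinear])

lemma tassoc_tens: "tassoc ((a \<otimes>\<^sub>C b) \<otimes>\<^sub>C c) = a \<otimes>\<^sub>C (b \<otimes>\<^sub>C c)"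
proof -
  have "cbilinear_on UNIV UNIV (\<lambda>a b. a \<otimes>\<^sub>C (b \<otimes>\<^sub>C c))"
    by (auto simp: cbilinear_on_def clinear_on_def tens_add_left tens_add_right tens_scale_left tens_scale_right)
  from tlift_all_tens[OF this] show ?thesis
    unfolding tassoc_def tlift_all_tens[OF tassoc_bilinear] .
qed

text \<open>Precompose with a linear projection onto \<open>V\<close>. Total maps can be tensored
  with \<open>tmap_all\<close>, which spares the bookkeeping of subspaces; the splitting will be
  extended in this way.\<close>

lemma clinear_on_extend:
  assumes "cvec.subspace V" "clinear_on V f"
  obtains g where "clinear_on UNIV g" "\<And>v. v \<in> V \<Longrightarrow> g v = f v"
proof -
  obtain P where P: "clinear_on UNIV P" "range P \<subseteq> V" "\<And>v. v \<in> V \<Longrightarrow> P v = v"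
    using projection_exists[OF assms(1)] by metis
  show ?thesis
    by (rule that[of "\<lambda>x. f (P x)"]) (use clinear_on_compose[OF P(1,2) assms(2)] P(3) in auto)
qed

text \<open>Carries the equivariance of a map given only on a subspace over to its total
  extension.\<close>

lemma tmap_on_eq_tmap_all:
  assumes V: "cvec.subspace V" and f: "clinear_on V f" and g: "clinear_on UNIV g"
    and f': "clinear_on UNIV f'" and eq: "\<And>v. v \<in> V \<Longrightarrow> f' v = f v" and t: "t \<in> tensor_space V UNIV"
  shows "tmap V UNIV f g t = tmap_all f' g t"
proof -
  obtain n :: nat and v w where v: "\<And>i. i < n \<Longrightarrow> v i \<in> V" and t: "t = (\<Sum>i<n. v i \<otimes>\<^sub>C w i)"
    using tensor_space_sum[OF V t] by metis
  have "tmap V UNIV f g t = (\<Sum>i<n. f (v i) \<otimes>\<^sub>C g (w i))"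
    unfolding t by (rule tmap_sum[OF V f g]) (simp add: v)
  also have "\<dots> = tmap_all f' g t"
    unfolding t by (simp add: tmap_sum[OF cvec.subspace_UNIV f' g] eq v)
  finally show ?thesis .
qed

text \<open>If the coefficients \<open>(id \<otimes> \<phi>) t\<close> all lie in \<open>V\<close>, so does \<open>t\<close> in \<open>V \<otimes> W\<close>: write \<open>t\<close> with
  linearly independent right-hand factors.\<close>

lemma tensor_space_coefficients:
  fixes t :: "('a::complex_vector, 'b::complex_vector) tensor"
  assumes V: "cvec.subspace V"
    and co: "\<And>\<phi>. clinear_on UNIV \<phi> \<Longrightarrow> tlift_all (\<lambda>a b. \<phi> b *\<^sub>C a) t \<in> V"
  shows "t \<in> tensor_space V UNIV"
proof -
  have "t \<in> tensor_space UNIV UNIV" by simp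
  then obtain n :: nat and v w where t: "t = (\<Sum>i<n. v i \<otimes>\<^sub>C w i)"
    using tensor_space_sum[OF cvec.subspace_UNIV] by metis
  obtain B where B: "B \<subseteq> w ` {..<n}" "cvec.independent B" "w ` {..<n} \<subseteq> cvec.span B"
    using cvec.maximal_independent_subset[of "w ` {..<n}"] by metis
  have fin: "finite B" using B(1) finite_subset by blast
  \<comment> \<open>\<open>\<phi> b\<close> extends the \<open>b\<close>-coordinate on
    \<open>cvec.span B\<close> to the whole type, because \<open>co\<close> speaks of total
    functionals.\<close>
  define \<phi> where "\<phi> b = (SOME \<phi>. clinear_on UNIV \<phi> \<and> (\<forall>x\<in>cvec.span B. \<phi> x = cvec.representation B x b))" for b
  have \<phi>: "clinear_on UNIV (\<phi> b)" "\<And>x. x \<in> cvec.span B \<Longrightarrow> \<phi> b x = cvec.representation B x b" for b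
  proof -
    have "clinear_on (cvec.span B) (\<lambda>x. cvec.representation B x b)"
      by (simp add: clinear_on_def cvec.representation_add[OF B(2)] cvec.representation_scale[OF B(2)])
    then obtain g where "clinear_on UNIV g" "\<And>v. v \<in> cvec.span B \<Longrightarrow> g v = cvec.representation B v b"
      using clinear_on_extend[OF cvec.subspace_span] by metis
    then have "\<exists>\<phi>. clinear_on UNIV \<phi> \<and> (\<forall>x\<in>cvec.span B. \<phi> x = cvec.representation B x b)" by blast
    from someI_ex[OF this, folded \<phi>_def] show "clinear_on UNIV (\<phi> b)"
      "\<And>x. x \<in> cvec.span B \<Longrightarrow> \<phi> b x = cvec.representation B x b" by auto
  qed
  have "v i \<otimes>\<^sub>C w i = (\<Sum>b\<in>B. (\<phi> b (w i) *\<^sub>C v i) \<otimes>\<^sub>C b)" if "i < n" for i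
  proof -
    have w: "w i \<in> cvec.span B" using that B(3) by auto
    have "w i = (\<Sum>b\<in>B. \<phi> b (w i) *\<^sub>C b)"
      using cvec.sum_representation_eq[OF B(2) w fin] \<phi>(2)[OF w] by simp
    then have "v i \<otimes>\<^sub>C w i = v i \<otimes>\<^sub>C (\<Sum>b\<in>B. \<phi> b (w i) *\<^sub>C b)" by simp
    then show ?thesis by (simp add: tens_sum_right tens_scale_left tens_scale_right)
  qed
  then have "t = (\<Sum>b\<in>B. (\<Sum>i<n. \<phi> b (w i) *\<^sub>C v i) \<otimes>\<^sub>C b)"
    unfolding t by (simp add: tens_sum_left) (subst sum.swap, simp)
  also have "\<dots> = (\<Sum>b\<in>B. tlift_all (\<lambda>a c. \<phi> b c *\<^sub>C a) t \<otimes>\<^sub>C b)"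
    unfolding t
    by (subst tlift_sum) (simp_all add: cbilinear_scale(2)[OF clinear_on_ident \<phi>(1)])
  also have "\<dots> \<in> tensor_space V UNIV"
    by (intro cvec.subspace_sum subspace_tensor_space tens_in_tensor_space co \<phi>(1)) auto
  finally show ?thesis .
qed


section \<open>Gradings\<close>

text \<open>The operator \<open>v \<mapsto> (-1)^(p|v|) v\<close>, the Koszul sign for moving an
  object of parity \<open>p\<close> past \<open>v\<close>.\<close>

definition twist :: "(bool \<Rightarrow> 'v::complex_vector set) \<Rightarrow> bool \<Rightarrow> 'v \<Rightarrow> 'v" where
  "twist gr p v = (\<Sum>q\<in>UNIV. psgn p q *\<^sub>C gproj gr q v)"

lemma psgn_simps [simp]: "psgn False q = 1" "psgn p False = 1" "psgn True True = -1"
  by (simp_all add: psgn_def)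

lemma
  assumes "superspace V gr"
  shows superspace_subspace: "cvec.subspace V" and superspace_subspace_grade: "cvec.subspace (gr p)"
  using assms unfolding superspace_def by blast+

lemma gproj_eqI:
  assumes V: "superspace V gr" and "u \<in> gr p" "v - u \<in> gr (\<not> p)"
  shows "gproj gr p v = u"
  unfolding gproj_def
proof (rule the_equality)
  fix u' assume u': "u' \<in> gr p \<and> v - u' \<in> gr (\<not> p)"
  have "u' - u \<in> gr p" using u' assms(2) superspace_subspace_grade[OF V] by (simp add: cvec.subspace_diff)
  moreover have "(v - u) - (v - u') \<in> gr (\<not> p)"
    by (rule cvec.subspace_diff[OF superspace_subspace_grade[OF V] assms(3)]) (use u' in simp)
  moreover have "(v - u) - (v - u') = u' - u" by simp
  moreover have "gr p \<inter> gr (\<not> p) = {0}"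
    using V unfolding superspace_def by (cases p) (simp_all add: Int_commute)
  ultimately have "u' - u \<in> {0}" by (metis IntI)
  then show "u' = u" by simp
qed (use assms in simp)

lemma gproj_decomp:
  assumes V: "superspace V gr" and v: "v \<in> V"
  shows "gproj gr p v \<in> gr p" and "v = gproj gr False v + gproj gr True v"
proof -
  obtain u w where uw: "u \<in> gr False" "w \<in> gr True" "v = u + w"
    using V v by (auto simp: superspace_def)
  have "gproj gr False v = u" "gproj gr True v = w"
    using gproj_eqI[OF V, of u False v] gproj_eqI[OF V, of w True v] uw by auto
  then show "gproj gr p v \<in> gr p" "v = gproj gr False v + gproj gr True v"
    using uw by (cases p; simp)+
qed

lemma gproj_homogeneous:
  assumes "superspace V gr" "v \<in> gr q"
  shows "gproj gr p v = (if p = q then v else 0)"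
  by (rule gproj_eqI[OF assms(1)])
    (use assms superspace_subspace_grade[OF assms(1)] in \<open>auto simp: cvec.subspace_0\<close>)

lemma gproj_complement:
  assumes V: "superspace V gr" and v: "v \<in> V"
  shows "v - gproj gr p v \<in> gr (\<not> p)"
proof -
  have "v - gproj gr False v = gproj gr True v" "v - gproj gr True v = gproj gr False v"
    using gproj_decomp(2)[OF V v] by (metis add_diff_cancel_left' add_diff_cancel_right')+
  then show ?thesis
    using gproj_decomp(1)[OF V v, of "\<not> p"] by (cases p) auto
qed

lemma clinear_gproj:
  assumes V: "superspace V gr"
  shows "clinear_on V (gproj gr p)"
  unfolding clinear_on_def
proof (intro conjI ballI allI)
  note sub = superspace_subspace_grade[OF V] and co = gproj_complement[OF V]
  fix u v c assume u: "u \<in> V" and v: "v \<in> V"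
  have "(u - gproj gr p u) + (v - gproj gr p v) \<in> gr (\<not> p)" using co u v sub by (simp add: cvec.subspace_add)
  then show "gproj gr p (u + v) = gproj gr p u + gproj gr p v"
    by (intro gproj_eqI[OF V]) (use u v gproj_decomp(1)[OF V] sub in \<open>simp_all add: cvec.subspace_add algebra_simps\<close>)
  have "c *\<^sub>C (v - gproj gr p v) \<in> gr (\<not> p)" using co v sub by (simp add: cvec.subspace_scale)
  then show "gproj gr p (c *\<^sub>C v) = c *\<^sub>C gproj gr p v"
    by (intro gproj_eqI[OF V]) (use v gproj_decomp(1)[OF V] sub in \<open>simp_all add: cvec.subspace_scale cvec.scale_right_diff_distrib\<close>)
qed

lemma clinear_twist: "superspace V gr \<Longrightarrow> clinear_on V (twist gr p)"
  unfolding twist_def by (intro clinear_on_sum_fun clinear_on_scale clinear_gproj)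

lemma twist_homogeneous: "superspace V gr \<Longrightarrow> v \<in> gr q \<Longrightarrow> twist gr p v = psgn p q *\<^sub>C v"
  by (cases q) (simp_all add: twist_def gproj_homogeneous UNIV_bool)

lemma superspace_ext:
  assumes V: "superspace V gr" and f: "clinear_on V f" "clinear_on V g"
    and eq: "\<And>v p. v \<in> gr p \<Longrightarrow> f v = g v" and v: "v \<in> V"
  shows "f v = g v"
proof -
  have *: "gproj gr p v \<in> gr p" "gproj gr p v \<in> V" for p
    using gproj_decomp(1)[OF V v] superspace_grade[OF V] by blast+
  have "f (gproj gr False v + gproj gr True v) = g (gproj gr False v + gproj gr True v)"
    using clinear_on_addD[OF f(1) *(2) *(2)] clinear_on_addD[OF f(2) *(2) *(2)] eq[OF *(1)] by simp
  then show ?thesis by (simp flip: gproj_decomp(2)[OF V v])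
qed

lemma twist_twist:
  assumes "superspace UNIV gr"
  shows "twist gr p (twist gr q v) = twist gr (p \<noteq> q) v"
proof (rule superspace_ext[OF assms, of "\<lambda>v. twist gr p (twist gr q v)"])
  fix v r assume "v \<in> gr r"
  then show "twist gr p (twist gr q v) = twist gr (p \<noteq> q) v"
    by (simp add: twist_homogeneous[OF assms, of _ r] clinear_scale[OF clinear_twist[OF assms]])
      (simp add: scaleC_scaleC psgn_def)
qed (simp_all add: clinear_twist[OF assms] clinear_comp)

lemma twist_False: "superspace V gr \<Longrightarrow> v \<in> V \<Longrightarrow> twist gr False v = v"
  using gproj_decomp(2)[of V gr v, symmetric] by (simp add: twist_def UNIV_bool add.commute)

lemma tmap_zero_left: "clinear_on UNIV g \<Longrightarrow> tmap_all (\<lambda>x. 0) g t = 0"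
  by (rule tensor_ext[of "tmap_all (\<lambda>x. 0) g" "\<lambda>x. 0"])
    (simp_all add: clinear_tmap tmap_tens clinear_on_def[of UNIV "\<lambda>x. 0"])

lemma tmap_zero_right: "clinear_on UNIV f \<Longrightarrow> tmap_all f (\<lambda>x. 0) t = 0"
  by (rule tensor_ext[of "tmap_all f (\<lambda>x. 0)" "\<lambda>x. 0"])
    (simp_all add: clinear_tmap tmap_tens clinear_on_def[of UNIV "\<lambda>x. 0"])

section \<open>Averaging matrices over a supergroup\<close>

locale affine_supergroup =
  fixes G :: "'a::complex_algebra_1 supergroup"
  assumes affine: "affine_algebraic_supergroup G"
begin

lemma superspace_part: "superspace UNIV (part G)"
  using affine by (simp add: affine_algebraic_supergroup_def supercomm_algebra_def)

lemma one_even: "1 \<in> part G False"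
  and mult_part: "x \<in> part G p \<Longrightarrow> y \<in> part G q \<Longrightarrow> x * y \<in> part G (p \<noteq> q)"
  and mult_supercomm: "x \<in> part G p \<Longrightarrow> y \<in> part G q \<Longrightarrow> y * x = psgn p q *\<^sub>C (x * y)"
  using affine unfolding affine_algebraic_supergroup_def supercomm_algebra_def by blast+

lemmas hopf = affine[unfolded affine_algebraic_supergroup_def hopf_superalgebra_def]

lemma comult_linear: "clinear_on UNIV (comult G)"
  and counit_linear: "clinear_on UNIV (counit G)"
  and antipode_linear: "clinear_on UNIV (antipode G)"
  using hopf by blast+

lemma counit_mult: "counit G (x * y) = counit G x * counit G y"
  and counit_one: "counit G 1 = 1"
  and comult_one: "comult G 1 = 1 \<otimes>\<^sub>C 1"
  and counit_odd: "x \<in> part G True \<Longrightarrow> counit G x = 0"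
  using hopf by blast+

lemma antipode_part: "x \<in> part G p \<Longrightarrow> antipode G x \<in> part G p"
  using hopf by blast

lemma coassoc: "tassoc (tmap_all (comult G) id (comult G x)) = tmap_all id (comult G) (comult G x)"
  using hopf by blast

lemma counit_left: "tlift_all (\<lambda>b c. counit G b *\<^sub>C c) (comult G x) = x"
  and counit_right: "tlift_all (\<lambda>b c. counit G c *\<^sub>C b) (comult G x) = x"
  using hopf by blast+

lemma antipode_left: "tlift_all (\<lambda>b c. antipode G b * c) (comult G x) = counit G x *\<^sub>C 1"
  and antipode_right: "tlift_all (\<lambda>b c. b * antipode G c) (comult G x) = counit G x *\<^sub>C 1"
  using hopf by blast+

lemma subspace_part: "cvec.subspace (part G p)"
  by (rule superspace_subspace_grade[OF superspace_part])

lemma twist_linear: "clinear_on UNIV (twist (part G) p)"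
  by (rule clinear_twist[OF superspace_part])

lemma twist_part: "x \<in> part G q \<Longrightarrow> twist (part G) p x = psgn p q *\<^sub>C x"
  by (rule twist_homogeneous[OF superspace_part])

text \<open>In \<open>(u \<otimes> v) (x \<otimes> y) = (-1)^(|v||x|) u x \<otimes> v y\<close> the
  sign depends on \<open>x\<close> only once \<open>v\<close> is homogeneous. Left multiplication by
  such a tensor is therefore a tensor product of two operators, and products of coproducts can be
  composed leg by leg.\<close>

lemma tensor_mult_sum:
  assumes "\<And>k. k \<in> S \<Longrightarrow> v k \<in> part G (p k)"
  shows "tensor_mult (part G) (\<Sum>k\<in>S. u k \<otimes>\<^sub>C v k) t =
    (\<Sum>k\<in>S. tmap_all (\<lambda>x. u k * twist (part G) (p k) x) (\<lambda>y. v k * y) t)"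
proof -
  define \<Phi> where "\<Phi> a b c d = (\<Sum>p\<in>UNIV. \<Sum>q\<in>UNIV.
    psgn p q *\<^sub>C ((a * gproj (part G) q c) \<otimes>\<^sub>C (gproj (part G) p b * d)))" for a b c d
  \<comment> \<open>Summing over the parity \<open>q\<close> of \<open>c\<close> assembles the signs
    and projections into \<open>twist\<close>.\<close>
  have \<Phi>: "\<Phi> a b c d = (\<Sum>p\<in>UNIV. (a * twist (part G) p c) \<otimes>\<^sub>C (gproj (part G) p b * d))" for a b c d
    by (simp add: \<Phi>_def twist_def sum_distrib_left mult_scaleC_right tens_scale_left tens_sum_left)
  have lin_c: "clinear_on UNIV (\<lambda>c. \<Phi> a b c d)" for a b d
    unfolding \<Phi>
    by (intro clinear_on_sum_fun clinear_comp[OF clinear_tens_left] clinear_comp[OF clinear_mult_left] twist_linear)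
  have lin_d: "clinear_on UNIV (\<lambda>d. \<Phi> a b c d)" for a b c
    unfolding \<Phi> by (intro clinear_on_sum_fun clinear_comp[OF clinear_tens_right] clinear_mult_left)
  have lin_a: "clinear_on UNIV (\<lambda>a. \<Phi> a b c d)" for b c d
    unfolding \<Phi> by (intro clinear_on_sum_fun clinear_comp[OF clinear_tens_left] clinear_mult_right)
  have lin_b: "clinear_on UNIV (\<lambda>b. \<Phi> a b c d)" for a c d
    unfolding \<Phi>
    by (intro clinear_on_sum_fun clinear_comp[OF clinear_tens_right] clinear_comp[OF clinear_mult_right]
        clinear_gproj superspace_part)
  have bil: "cbilinear_on UNIV UNIV (\<lambda>c d. \<Phi> a b c d)" for a b
    by (intro cbilinear_onI lin_c lin_d)
  have "clinear_on UNIV (\<lambda>a. tlift_all (\<lambda>c d. \<Phi> a b c d) t)" for b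
    using cbilinear_tlift_param[where f = "\<lambda>c d a. \<Phi> a b c d", OF bil lin_a]
    by (simp add: cbilinear_on_def)
  moreover have "clinear_on UNIV (\<lambda>b. tlift_all (\<lambda>c d. \<Phi> a b c d) t)" for a
    using cbilinear_tlift_param[where f = "\<lambda>c d b. \<Phi> a b c d", OF bil lin_b]
    by (simp add: cbilinear_on_def)
  ultimately have "cbilinear_on UNIV UNIV (\<lambda>a b. tlift_all (\<lambda>c d. \<Phi> a b c d) t)"
    by (intro cbilinear_onI)
  then have "tensor_mult (part G) (\<Sum>k\<in>S. u k \<otimes>\<^sub>C v k) t = (\<Sum>k\<in>S. tlift_all (\<lambda>c d. \<Phi> (u k) (v k) c d) t)"
    unfolding tensor_mult_def \<Phi>_def[symmetric]
    by (rule tlift_sum[OF cvec.subspace_UNIV cvec.subspace_UNIV]) auto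
  also have "\<dots> = (\<Sum>k\<in>S. tmap_all (\<lambda>x. u k * twist (part G) (p k) x) (\<lambda>y. v k * y) t)"
  proof (rule sum.cong[OF refl])
    fix k assume k: "k \<in> S"
    have "\<Phi> (u k) (v k) c d = (u k * twist (part G) (p k) c) \<otimes>\<^sub>C (v k * d)" for c d
      unfolding \<Phi>
      by (cases "p k") (use assms[OF k] in \<open>simp_all add: UNIV_bool gproj_homogeneous[OF superspace_part]\<close>)
    then show "tlift_all (\<lambda>c d. \<Phi> (u k) (v k) c d) t =
        tmap_all (\<lambda>x. u k * twist (part G) (p k) x) (\<lambda>y. v k * y) t"
      by (simp add: tmap_def)
  qed
  finally show ?thesis .
qed

lemma comult_mult:
  assumes "comult G x = (\<Sum>k\<in>S. u k \<otimes>\<^sub>C v k)" "\<And>k. k \<in> S \<Longrightarrow> v k \<in> part G (p k)"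
  shows "comult G (x * y) = (\<Sum>k\<in>S. tmap_all (\<lambda>x. u k * twist (part G) (p k) x) (\<lambda>y. v k * y) (comult G y))"
proof -
  have "comult G (x * y) = tensor_mult (part G) (comult G x) (comult G y)"
    using hopf by simp
  then show ?thesis unfolding assms(1) by (simp only: tensor_mult_sum[OF assms(2)])
qed

end

section \<open>Matrix coefficients and their inverse\<close>

text \<open>The coefficients of a module in a homogeneous basis, abstracted from the module:
  averaging becomes a matrix computation over arbitrary index sets.\<close>

definition comatrix :: "'a::complex_algebra_1 supergroup \<Rightarrow> 'i set \<Rightarrow> ('i \<Rightarrow> bool) \<Rightarrow> ('i \<Rightarrow> 'i \<Rightarrow> 'a) \<Rightarrow> bool" where
  "comatrix G B par a \<longleftrightarrow> finite B \<and> (\<forall>i\<in>B. \<forall>j\<in>B. a i j \<in> part G (par i \<noteq> par j) \<and>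
     comult G (a i j) = (\<Sum>k\<in>B. a i k \<otimes>\<^sub>C a k j) \<and> counit G (a i j) = (if i = j then 1 else 0))"

text \<open>The matrix equation \<open>c F = F a\<close>: \<open>F\<close> is a morphism from the
  module with coefficients \<open>a\<close> to the one with coefficients \<open>c\<close>.\<close>

definition intertwines :: "'p set \<Rightarrow> ('p \<Rightarrow> 'p \<Rightarrow> 'a::complex_vector) \<Rightarrow> 'j set \<Rightarrow> ('j \<Rightarrow> 'j \<Rightarrow> 'a) \<Rightarrow>
    ('p \<Rightarrow> 'j \<Rightarrow> complex) \<Rightarrow> bool" where
  "intertwines P c J a F \<longleftrightarrow>
     (\<forall>p\<in>P. \<forall>j\<in>J. (\<Sum>q\<in>P. F q j *\<^sub>C c p q) = (\<Sum>i\<in>J. F p i *\<^sub>C a i j))"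

definition even_matrix :: "'p set \<Rightarrow> ('p \<Rightarrow> bool) \<Rightarrow> 'j set \<Rightarrow> ('j \<Rightarrow> bool) \<Rightarrow> ('p \<Rightarrow> 'j \<Rightarrow> complex) \<Rightarrow> bool" where
  "even_matrix P pp J pj F \<longleftrightarrow> (\<forall>p\<in>P. \<forall>j\<in>J. pp p \<noteq> pj j \<longrightarrow> F p j = 0)"

lemma
  assumes "comatrix G B par a"
  shows comatrix_finite: "finite B"
    and comatrix_part: "i \<in> B \<Longrightarrow> j \<in> B \<Longrightarrow> a i j \<in> part G (par i \<noteq> par j)"
    and comatrix_comult: "i \<in> B \<Longrightarrow> j \<in> B \<Longrightarrow> comult G (a i j) = (\<Sum>k\<in>B. a i k \<otimes>\<^sub>C a k j)"
    and comatrix_counit: "i \<in> B \<Longrightarrow> j \<in> B \<Longrightarrow> counit G (a i j) = (if i = j then 1 else 0)"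
  using assms by (simp_all add: comatrix_def)

context affine_supergroup
begin

text \<open>The antipode axioms at a matrix coefficient: the entrywise antipode of \<open>a\<close>
  is its two-sided inverse matrix.\<close>

lemma comatrix_antipode:
  assumes a: "comatrix G B par a" and ij: "i \<in> B" "j \<in> B"
  shows "(\<Sum>k\<in>B. antipode G (a i k) * a k j) = (if i = j then 1 else 0)"
    and "(\<Sum>k\<in>B. a i k * antipode G (a k j)) = (if i = j then 1 else 0)"
proof -
  have "cbilinear_on UNIV UNIV (\<lambda>b c. antipode G b * c)" "cbilinear_on UNIV UNIV (\<lambda>b c. b * antipode G c)"
    by (intro cbilinear_onI clinear_comp[OF clinear_mult_right antipode_linear] clinear_mult_left
        clinear_mult_right clinear_comp[OF clinear_mult_left antipode_linear])+
  note tl = tlift_sum[OF cvec.subspace_UNIV cvec.subspace_UNIV this(1) UNIV_I UNIV_I]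
    tlift_sum[OF cvec.subspace_UNIV cvec.subspace_UNIV this(2) UNIV_I UNIV_I]
  show "(\<Sum>k\<in>B. antipode G (a i k) * a k j) = (if i = j then 1 else 0)"
    using antipode_left[of "a i j"] unfolding comatrix_comult[OF a ij] tl
    by (simp add: comatrix_counit[OF a ij] scaleC_one split: if_splits)
  show "(\<Sum>k\<in>B. a i k * antipode G (a k j)) = (if i = j then 1 else 0)"
    using antipode_right[of "a i j"] unfolding comatrix_comult[OF a ij] tl
    by (simp add: comatrix_counit[OF a ij] scaleC_one split: if_splits)
qed

text \<open>Cancels an invertible matrix that multiplies one leg of a family of tensors. In the
  second form the other leg carries Koszul twists; only \<open>k = t\<close> survives the
  cancellation, where the twist has parity \<open>False\<close> and is the identity.\<close>

lemma comatrix_antipode_cancel: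
  assumes a: "comatrix G B par a" and t: "t \<in> B"
  shows "(\<Sum>p\<in>B. \<Sum>k\<in>B. tmap_all (\<lambda>x. antipode G (a t p) * (a p k * x)) (\<lambda>x. x) (Y k)) = Y t"
    and "superspace UNIV gr \<Longrightarrow> (\<Sum>p\<in>B. \<Sum>k\<in>B. tmap_all (twist gr (par t \<noteq> par k))
      (\<lambda>x. antipode G (a t p) * (a p k * x)) (Y' k)) = Y' t"
proof -
  have lin: "clinear_on UNIV (\<lambda>x. antipode G (a t p) * (a p k * x))" for p k
    by (rule clinear_comp[OF clinear_mult_left clinear_mult_left])
  have eq: "(\<Sum>p\<in>B. antipode G (a t p) * (a p k * x)) = (if t = k then x else 0)" if "k \<in> B" for k x
    using comatrix_antipode(1)[OF a t that, THEN arg_cong, of "\<lambda>y. y * x"]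
    by (simp add: sum_distrib_right mult.assoc)
  have "(\<Sum>p\<in>B. \<Sum>k\<in>B. tmap_all (\<lambda>x. antipode G (a t p) * (a p k * x)) (\<lambda>x. x) (Y k)) =
      (\<Sum>k\<in>B. tmap_all (\<lambda>x. \<Sum>p\<in>B. antipode G (a t p) * (a p k * x)) (\<lambda>x. x) (Y k))"
    by (subst sum.swap, subst tmap_sum_left[OF clinear_on_ident lin]) simp
  also have "\<dots> = (\<Sum>k\<in>B. if t = k then Y k else 0)"
    by (rule sum.cong[OF refl]) (simp add: eq tmap_id tmap_zero_left clinear_on_ident)
  finally show "(\<Sum>p\<in>B. \<Sum>k\<in>B. tmap_all (\<lambda>x. antipode G (a t p) * (a p k * x)) (\<lambda>x. x) (Y k)) = Y t"
    using t comatrix_finite[OF a] by simp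
  assume gr: "superspace UNIV gr"
  note tw = clinear_twist[OF gr]
  have tw0: "twist gr False = (\<lambda>x. x)"
    using twist_False[OF gr] by auto
  have "(\<Sum>p\<in>B. \<Sum>k\<in>B. tmap_all (twist gr (par t \<noteq> par k)) (\<lambda>x. antipode G (a t p) * (a p k * x)) (Y' k)) =
      (\<Sum>k\<in>B. tmap_all (twist gr (par t \<noteq> par k)) (\<lambda>x. \<Sum>p\<in>B. antipode G (a t p) * (a p k * x)) (Y' k))"
    by (subst sum.swap, subst tmap_sum_right[OF tw lin]) simp
  also have "\<dots> = (\<Sum>k\<in>B. if t = k then Y' k else 0)"
    by (rule sum.cong[OF refl]) (simp add: eq tmap_id tmap_zero_right tw tw0)
  finally show "(\<Sum>p\<in>B. \<Sum>k\<in>B. tmap_all (twist gr (par t \<noteq> par k))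
      (\<lambda>x. antipode G (a t p) * (a p k * x)) (Y' k)) = Y' t"
    using t comatrix_finite[OF a] by simp
qed

end

text \<open>The average of the matrix \<open>F\<close> is the matrix of functions \<open>g \<mapsto> g\<inverse> F g\<close> on \<open>G\<close>.\<close>

locale averaging = affine_supergroup G for G :: "'a::complex_algebra_1 supergroup" +
  fixes P :: "'p set" and pp :: "'p \<Rightarrow> bool" and c :: "'p \<Rightarrow> 'p \<Rightarrow> 'a"
    and J :: "'j set" and pj :: "'j \<Rightarrow> bool" and a :: "'j \<Rightarrow> 'j \<Rightarrow> 'a"
    and F :: "'p \<Rightarrow> 'j \<Rightarrow> complex"
  assumes c: "comatrix G P pp c" and a: "comatrix G J pj a" and F: "even_matrix P pp J pj F"
begin

definition avg :: "'p \<Rightarrow> 'j \<Rightarrow> 'a" where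
  "avg p j = (\<Sum>q\<in>P. \<Sum>i\<in>J. F q i *\<^sub>C (antipode G (c p q) * a i j))"

lemma avg_part:
  assumes "p \<in> P" "j \<in> J"
  shows "avg p j \<in> part G (pp p \<noteq> pj j)"
  unfolding avg_def
proof (intro cvec.subspace_sum subspace_part)
  fix q i assume qi: "q \<in> P" "i \<in> J"
  show "F q i *\<^sub>C (antipode G (c p q) * a i j) \<in> part G (pp p \<noteq> pj j)"
  proof (cases "pp q = pj i")
    case True
    have "antipode G (c p q) * a i j \<in> part G ((pp p \<noteq> pp q) \<noteq> (pj i \<noteq> pj j))"
      using qi assms by (intro mult_part antipode_part comatrix_part[OF c] comatrix_part[OF a])
    also have "((pp p \<noteq> pp q) \<noteq> (pj i \<noteq> pj j)) = (pp p \<noteq> pj j)" using True by auto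
    finally show ?thesis by (intro cvec.subspace_scale subspace_part)
  next
    case False
    then have "F q i = 0" using F qi by (simp add: even_matrix_def)
    then show ?thesis by (simp add: cvec.subspace_0 subspace_part)
  qed
qed

text \<open>Cancelling \<open>c\<close> against its inverse leaves \<open>c E = F a\<close>. As
  \<open>c\<close> is invertible this characterizes \<open>avg\<close>, and it replaces the
  definition in the next two lemmas.\<close>

lemma mult_avg:
  assumes p: "p \<in> P" and j: "j \<in> J"
  shows "(\<Sum>q\<in>P. c p q * avg q j) = (\<Sum>i\<in>J. F p i *\<^sub>C a i j)"
proof -
  have "(\<Sum>q\<in>P. c p q * avg q j) =
      (\<Sum>q\<in>P. \<Sum>t\<in>P. \<Sum>i\<in>J. F t i *\<^sub>C (c p q * antipode G (c q t) * a i j))"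
    by (simp add: avg_def sum_distrib_left mult_scaleC_right mult.assoc)
  also have "\<dots> = (\<Sum>t\<in>P. \<Sum>i\<in>J. F t i *\<^sub>C ((\<Sum>q\<in>P. c p q * antipode G (c q t)) * a i j))"
    by (subst sum.swap, rule sum.cong[OF refl], subst sum.swap)
      (simp add: sum_distrib_right cvec.scale_sum_right)
  also have "\<dots> = (\<Sum>t\<in>P. if p = t then \<Sum>i\<in>J. F t i *\<^sub>C a i j else 0)"
    by (rule sum.cong[OF refl]) (simp add: comatrix_antipode(2)[OF c p])
  finally show ?thesis using p comatrix_finite[OF c] by simp
qed

text \<open>At the identity \<open>g^-1 F g\<close> is \<open>F\<close>. Applying the counit to
  \<open>mult_avg\<close> gives this without evaluating the counit on the antipode.\<close>

lemma counit_avg: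
  assumes p: "p \<in> P" and j: "j \<in> J"
  shows "counit G (avg p j) = F p j"
proof -
  have "counit G (\<Sum>q\<in>P. c p q * avg q j) = counit G (\<Sum>i\<in>J. F p i *\<^sub>C a i j)"
    using mult_avg[OF assms] by simp
  then have "(\<Sum>q\<in>P. if p = q then counit G (avg q j) else 0) = (\<Sum>i\<in>J. if i = j then F p i else 0)"
    using comatrix_counit[OF c p] comatrix_counit[OF a _ j]
    by (simp add: clinear_sum[OF counit_linear] clinear_scale[OF counit_linear] counit_mult
        if_distrib[of "\<lambda>x. x * _"] if_distrib[of "\<lambda>x. _ * x"] cong: if_cong)
  then show ?thesis using p j comatrix_finite[OF c] comatrix_finite[OF a] by simp
qed

text \<open>The function-level form of \<open>(g h)^-1 F (g h) = h^-1 (g^-1 F g) h\<close>: the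
  first leg is the variable \<open>g\<close>, the second is \<open>h\<close>. The sign is the price
  of moving an entry of \<open>h^-1\<close> past an entry of \<open>avg\<close>. The proof applies
  the coproduct to \<open>mult_avg\<close> and cancels \<open>c\<close> first in the left and then
  in the right leg.\<close>

lemma comult_avg:
  assumes t: "t \<in> P" and j: "j \<in> J"
  shows "comult G (avg t j) = (\<Sum>p\<in>P. \<Sum>k\<in>J. psgn (pp t \<noteq> pp p) (pp p \<noteq> pj k) *\<^sub>C
    (avg p k \<otimes>\<^sub>C (antipode G (c t p) * a k j)))"
proof -
  let ?L = "\<lambda>p b. tmap_all (twist (part G) p) (\<lambda>y::'a. b * y)"
  have L_lin: "clinear_on UNIV (?L p b)" for p b
    by (intro clinear_tmap twist_linear clinear_mult_left)
  have L1_lin: "clinear_on UNIV (tmap_all (\<lambda>x. b * x) (\<lambda>y::'a. y))" for b :: 'a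
    by (intro clinear_tmap clinear_mult_left clinear_on_ident)
  define X where "X q = comult G (avg q j)" for q
  \<comment> \<open>The coproduct of \<open>c\<close> splits its matrix into a left-leg and a
    right-leg factor. \<open>Y\<close> is the coproduct of the left-hand side of
    \<open>mult_avg\<close> with the left-leg factor stripped off, and \<open>Z\<close> is the same
    for the right-hand side.\<close>
  define Y where "Y k = (\<Sum>q\<in>P. ?L (pp k \<noteq> pp q) (c k q) (X q))" for k
  define Z where "Z q = (\<Sum>k\<in>J. avg q k \<otimes>\<^sub>C a k j)" for q
  have Y: "(\<Sum>k\<in>P. tmap_all (\<lambda>x. c p k * x) (\<lambda>x. x) (Y k)) = comult G (\<Sum>q\<in>P. c p q * avg q j)"
    if p: "p \<in> P" for p
  proof -
    have "comult G (c p q * avg q j) =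
        (\<Sum>k\<in>P. tmap_all (\<lambda>x. c p k * x) (\<lambda>x. x) (?L (pp k \<noteq> pp q) (c k q) (X q)))" if q: "q \<in> P" for q
    proof -
      have "comult G (c p q * avg q j) = (\<Sum>k\<in>P. tmap_all (\<lambda>x. c p k * twist (part G) (pp k \<noteq> pp q) x)
          (\<lambda>y. c k q * y) (X q))"
        unfolding X_def by (rule comult_mult[OF comatrix_comult[OF c p q]]) (rule comatrix_part[OF c _ q])
      then show ?thesis
        by (simp add: tmap_tmap clinear_mult_left clinear_on_ident twist_linear)
    qed
    then have "comult G (\<Sum>q\<in>P. c p q * avg q j) =
        (\<Sum>q\<in>P. \<Sum>k\<in>P. tmap_all (\<lambda>x. c p k * x) (\<lambda>x. x) (?L (pp k \<noteq> pp q) (c k q) (X q)))"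
      by (simp add: clinear_sum[OF comult_linear])
    then show ?thesis
      unfolding Y_def by (simp add: clinear_sum[OF L1_lin]) (rule sum.swap)
  qed
  have Z: "(\<Sum>k\<in>P. tmap_all (\<lambda>x. c p k * x) (\<lambda>x. x) (Z k)) = comult G (\<Sum>q\<in>P. c p q * avg q j)"
    if p: "p \<in> P" for p
  proof -
    have "comult G (\<Sum>q\<in>P. c p q * avg q j) = (\<Sum>i\<in>J. \<Sum>k\<in>J. (F p i *\<^sub>C a i k) \<otimes>\<^sub>C a k j)"
      unfolding mult_avg[OF p j]
      by (simp add: clinear_sum[OF comult_linear] clinear_scale[OF comult_linear]
          comatrix_comult[OF a _ j] cvec.scale_sum_right tens_scale_left)
    also have "\<dots> = (\<Sum>k\<in>J. (\<Sum>q\<in>P. c p q * avg q k) \<otimes>\<^sub>C a k j)"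
      by (subst sum.swap) (simp add: mult_avg[OF p] tens_sum_left)
    also have "\<dots> = (\<Sum>k\<in>P. tmap_all (\<lambda>x. c p k * x) (\<lambda>x. x) (Z k))"
      unfolding Z_def
      by (simp add: clinear_sum[OF L1_lin] tmap_tens clinear_mult_left clinear_on_ident tens_sum_left)
        (rule sum.swap)
    finally show ?thesis by simp
  qed
  \<comment> \<open>The two families agree after multiplication by \<open>c\<close> in the left leg,
    and this factor is invertible.\<close>
  have YZ: "Y u = Z u" if u: "u \<in> P" for u
  proof -
    have *: "W u = (\<Sum>p\<in>P. tmap_all (\<lambda>x. antipode G (c u p) * x) (\<lambda>x. x)
        (\<Sum>k\<in>P. tmap_all (\<lambda>x. c p k * x) (\<lambda>x. x) (W k)))" for W :: "'p \<Rightarrow> ('a, 'a) tensor"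
      by (simp add: clinear_sum[OF L1_lin] tmap_tmap clinear_mult_left clinear_on_ident
          comatrix_antipode_cancel(1)[OF c u])
    show ?thesis
      by (subst *, subst (2) *) (simp add: Y Z)
  qed
  \<comment> \<open>Now the right-leg factor is inverted. The parity \<open>pp p\<close> drops out
    when the two twists are composed, as required by
    \<open>comatrix_antipode_cancel\<close>.\<close>
  have "X t = (\<Sum>p\<in>P. ?L (pp t \<noteq> pp p) (antipode G (c t p)) (Y p))"
  proof -
    have tw: "(((pp t \<noteq> pp p) \<noteq> (pp p \<noteq> pp q))) = (pp t \<noteq> pp q)" for p q by auto
    have "?L (pp t \<noteq> pp p) (antipode G (c t p)) (?L (pp p \<noteq> pp q) (c p q) (X q)) =
        tmap_all (twist (part G) (pp t \<noteq> pp q)) (\<lambda>y. antipode G (c t p) * (c p q * y)) (X q)" for p q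
      by (subst tmap_tmap[OF twist_linear clinear_mult_left twist_linear clinear_mult_left])
        (simp only: twist_twist[OF superspace_part] tw)
    then show ?thesis
      by (simp only: Y_def clinear_sum[OF L_lin] comatrix_antipode_cancel(2)[OF c t superspace_part])
  qed
  also have "\<dots> = (\<Sum>p\<in>P. \<Sum>k\<in>J. ?L (pp t \<noteq> pp p) (antipode G (c t p)) (avg p k \<otimes>\<^sub>C a k j))"
    by (rule sum.cong[OF refl]) (simp add: YZ Z_def clinear_sum[OF L_lin])
  also have "\<dots> = (\<Sum>p\<in>P. \<Sum>k\<in>J. psgn (pp t \<noteq> pp p) (pp p \<noteq> pj k) *\<^sub>C
    (avg p k \<otimes>\<^sub>C (antipode G (c t p) * a k j)))"
    by (intro sum.cong refl)
      (simp add: tmap_tens twist_linear clinear_mult_left twist_part[OF avg_part] tens_scale_left)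
  finally show ?thesis by (simp add: X_def)
qed

end

section \<open>The induced trivial module\<close>

locale supergroup_pair = affine_supergroup G for G :: "'a::complex_algebra_1 supergroup" +
  fixes K :: "'b::complex_algebra_1 supergroup" and r :: "'a \<Rightarrow> 'b"
  assumes K: "affine_algebraic_supergroup K" and r: "closed_subgroup G K r"
begin

lemma r_linear: "clinear_on UNIV r"
  and r_one: "r 1 = 1"
  and r_mult: "r (x * y) = r x * r y"
  and r_part: "x \<in> part G p \<Longrightarrow> r x \<in> part K p"
  and r_comult: "comult K (r x) = tmap_all r r (comult G x)"
  and r_counit: "counit K (r x) = counit G x"
  using r unfolding closed_subgroup_def by blast+

lemma superspace_part_K: "superspace UNIV (part K)"
  using K by (simp add: affine_algebraic_supergroup_def supercomm_algebra_def)

definition invar :: "'a set" where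
  "invar = {x. tmap_all r id (comult G x) = 1 \<otimes>\<^sub>C x}"

abbreviation invar_grade :: "bool \<Rightarrow> 'a set" where
  "invar_grade p \<equiv> invar \<inter> part G p"

lemma induced_trivial_simps:
  "carr (induced_trivial G r) = invar" "grade (induced_trivial G r) = invar_grade"
  "coact (induced_trivial G r) = comult G"
  by (simp_all add: induced_trivial_def invar_def Let_def fun_eq_iff)

lemma invarD: "x \<in> invar \<Longrightarrow> tmap_all r id (comult G x) = 1 \<otimes>\<^sub>C x"
  by (simp add: invar_def)

lemma restrict_left_linear: "clinear_on UNIV (\<lambda>x. tmap_all r id (comult G x))"
  by (intro clinear_comp[OF clinear_tmap comult_linear] r_linear clinear_on_id)

lemma subspace_invar: "cvec.subspace invar"
proof (rule cvec.subspaceI)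
  show "0 \<in> invar" using clinear_zero[OF restrict_left_linear] by (simp add: invar_def)
qed (simp_all add: invar_def clinear_add[OF restrict_left_linear] clinear_scale[OF restrict_left_linear]
    tens_add_right tens_scale_right)

text \<open>The coproduct is even: on a tensor of total degree \<open>q\<close> the signs of the two
  legs multiply to \<open>(-1)^(pq)\<close>.\<close>

lemma comult_twist: "comult G (twist (part G) p x) = tmap_all (twist (part G) p) (twist (part G) p) (comult G x)"
proof -
  let ?t = "twist (part G) p"
  have T_lin: "clinear_on UNIV (tmap_all ?t ?t)" by (intro clinear_tmap twist_linear)
  have graded: "tmap_all ?t ?t t = psgn p q *\<^sub>C t" if "t \<in> tensor_grade (part G) (part G) q" for q t
    using that unfolding tensor_grade_def
  proof (induction rule: cvec.span_induct_alt)
    case base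
    show ?case by (simp add: clinear_zero[OF T_lin])
  next
    case (step z t t')
    then obtain v w q1 q2 where t: "t = v \<otimes>\<^sub>C w" "v \<in> part G q1" "w \<in> part G q2" "(q1 \<noteq> q2) = q" by auto
    have "tmap_all ?t ?t t = psgn p q *\<^sub>C t"
      using t(4) by (auto simp: t(1) tmap_tens twist_linear twist_part[OF t(2)] twist_part[OF t(3)]
          tens_scale_left tens_scale_right scaleC_scaleC psgn_def scaleC_one)
    then show ?case
      using step by (simp add: clinear_add[OF T_lin] clinear_scale[OF T_lin] scaleC_add_right scaleC_scaleC mult.commute)
  qed
  show ?thesis
  proof (rule superspace_ext[OF superspace_part, of "\<lambda>x. comult G (?t x)" "\<lambda>x. tmap_all ?t ?t (comult G x)"])
    show "clinear_on UNIV (\<lambda>x. comult G (?t x))" "clinear_on UNIV (\<lambda>x. tmap_all ?t ?t (comult G x))"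
      by (rule clinear_comp[OF comult_linear twist_linear] clinear_comp[OF T_lin comult_linear])+
    fix v q assume v: "v \<in> part G q"
    have "comult G ` part G q \<subseteq> tensor_grade (part G) (part G) q" using hopf by simp
    with v have "comult G v \<in> tensor_grade (part G) (part G) q" by blast
    then show "comult G (?t v) = tmap_all ?t ?t (comult G v)"
      by (simp add: graded twist_part[OF v] clinear_scale[OF comult_linear])
  qed simp
qed

lemma r_twist: "r (twist (part G) p x) = twist (part K) p (r x)"
proof (rule superspace_ext[OF superspace_part, of "\<lambda>x. r (twist (part G) p x)" "\<lambda>x. twist (part K) p (r x)"])
  fix v q assume "v \<in> part G q"
  then show "r (twist (part G) p v) = twist (part K) p (r v)"
    by (simp add: twist_part clinear_scale[OF r_linear] twist_homogeneous[OF superspace_part_K r_part])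
qed (simp_all add: clinear_comp r_linear twist_linear clinear_twist[OF superspace_part_K])

lemma twist_invar:
  assumes x: "x \<in> invar"
  shows "twist (part G) p x \<in> invar"
proof -
  note tw = twist_linear clinear_twist[OF superspace_part_K] r_linear clinear_on_id
  have "twist (part K) p 1 = 1"
    using twist_homogeneous[OF superspace_part_K r_part[OF one_even]] by (simp add: r_one scaleC_one)
  have "tmap_all r id (comult G (twist (part G) p x)) =
      tmap_all (\<lambda>x. r (twist (part G) p x)) (\<lambda>x. id (twist (part G) p x)) (comult G x)"
    by (simp add: comult_twist tmap_tmap tw)
  also have "\<dots> = tmap_all (twist (part K) p) (twist (part G) p) (tmap_all r id (comult G x))"
    by (simp add: r_twist tmap_tmap tw)
  also have "\<dots> = 1 \<otimes>\<^sub>C twist (part G) p x"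
    using \<open>twist (part K) p 1 = 1\<close> by (simp add: invarD[OF x] tmap_tens tw)
  finally show ?thesis by (simp add: invar_def)
qed

text \<open>The components are half the sum and half the difference of \<open>x\<close> and its
  image under the parity automorphism, which preserves invariance. Hence the induced module is
  graded.\<close>

lemma gproj_invar:
  assumes x: "x \<in> invar"
  shows "gproj (part G) p x \<in> invar"
proof -
  define u w where "u = gproj (part G) False x" and "w = gproj (part G) True x"
  have tw: "twist (part G) True x = u - w" and x_eq: "x = u + w"
    using gproj_decomp(2)[OF superspace_part UNIV_I, of x]
    by (simp_all add: u_def w_def twist_def UNIV_bool scaleC_one)
  have "x + twist (part G) True x = 2 *\<^sub>C u" "x - twist (part G) True x = 2 *\<^sub>C w"
    using scaleC_add_left[of 1 1 u] scaleC_add_left[of 1 1 w] unfolding tw by (simp_all add: x_eq scaleC_one)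
  moreover have "x + twist (part G) True x \<in> invar" "x - twist (part G) True x \<in> invar"
    using x twist_invar[OF x] by (simp_all add: cvec.subspace_add cvec.subspace_diff subspace_invar)
  ultimately have "2 *\<^sub>C gproj (part G) p x \<in> invar" by (cases p) (simp_all add: u_def w_def)
  then have "(1/2) *\<^sub>C 2 *\<^sub>C gproj (part G) p x \<in> invar"
    by (rule cvec.subspace_scale[OF subspace_invar])
  then show ?thesis by (simp add: scaleC_scaleC scaleC_one)
qed

lemma superspace_invar: "superspace invar invar_grade"
  unfolding superspace_def
proof (intro conjI allI)
  have zero: "0 \<in> invar" using subspace_invar by (rule cvec.subspace_0)
  show "cvec.subspace (invar_grade p)" for p
    by (intro cvec.subspace_inter subspace_invar subspace_part)
  have "part G False \<inter> part G True = {0}"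
    using superspace_part unfolding superspace_def by blast
  then show "invar_grade False \<inter> invar_grade True = {0}" using zero by blast
  have "x \<in> {u + w |u w. u \<in> invar_grade False \<and> w \<in> invar_grade True}" if x: "x \<in> invar" for x
    using gproj_invar[OF x] gproj_decomp[OF superspace_part UNIV_I, where v = x] by blast
  moreover have "u + w \<in> invar" if "u \<in> invar_grade False" "w \<in> invar_grade True" for u w
    using that by (simp add: cvec.subspace_add subspace_invar)
  ultimately show "invar = {u + w |u w. u \<in> invar_grade False \<and> w \<in> invar_grade True}" by blast
qed (rule subspace_invar)

text \<open>The action of a Lie algebra element uses the grading of the induced module; by
  uniqueness of components it may be computed with that of the ambient ring.\<close>

lemma twist_invar_grade:
  assumes x: "x \<in> invar"
  shows "twist invar_grade p x = twist (part G) p x"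
proof -
  have "gproj (part G) q x = gproj invar_grade q x" for q
    using gproj_decomp(1)[OF superspace_invar x, of q] gproj_complement[OF superspace_invar x, of q]
    by (intro gproj_eqI[OF superspace_part]) auto
  then show ?thesis by (simp add: twist_def)
qed

text \<open>Left invariance under K survives right translation by G. In terms of functionals, every
  coefficient \<open>(id \<otimes> \<phi>) (\<Delta> x)\<close> is again invariant, and
  \<open>tensor_space_coefficients\<close> assembles these.\<close>

lemma comult_invar:
  assumes x: "x \<in> invar"
  shows "comult G x \<in> tensor_space invar UNIV"
proof (rule tensor_space_coefficients[OF subspace_invar])
  fix \<phi> :: "'a \<Rightarrow> complex" assume \<phi>: "clinear_on UNIV \<phi>"
  let ?e = "tlift_all (\<lambda>(b::'a) c. \<phi> c *\<^sub>C b)"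
  have bil: "cbilinear_on UNIV UNIV (\<lambda>(b::'a) c. \<phi> c *\<^sub>C b)"
    by (rule cbilinear_scale(2)[OF clinear_on_ident \<phi>])
  note e_lin = clinear_tlift[OF bil]
  note lins = e_lin clinear_tassoc comult_linear clinear_on_id r_linear
  have e: "tmap_all id ?e (tassoc (w \<otimes>\<^sub>C y)) = \<phi> y *\<^sub>C w" for w :: "('a, 'a) tensor" and y
  proof (rule tensor_ext[of "\<lambda>w. tmap_all id ?e (tassoc (w \<otimes>\<^sub>C y))" "\<lambda>w. \<phi> y *\<^sub>C w"])
    show "clinear_on UNIV (\<lambda>w. tmap_all id ?e (tassoc (w \<otimes>\<^sub>C y)))"
      by (intro clinear_comp[OF clinear_tmap] clinear_comp[OF clinear_tassoc] clinear_tens_left lins)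
  qed (simp_all add: clinear_on_scale clinear_on_ident tassoc_tens tmap_tens lins tlift_all_tens[OF bil] tens_scale_right)
  \<comment> \<open>With coassociativity this makes
    \<open>(id \<otimes> ?e \<circ> \<Delta>) (\<Delta> x)\<close> the coproduct of the coefficient
    \<open>?e (\<Delta> x)\<close>. Its left leg is the one of \<open>\<Delta> x\<close>, to which
    invariance of \<open>x\<close> applies.\<close>
  have "comult G (?e t) = tmap_all id ?e (tassoc (tmap_all (comult G) id t))" for t
  proof (rule tensor_ext[of "\<lambda>t. comult G (?e t)" "\<lambda>t. tmap_all id ?e (tassoc (tmap_all (comult G) id t))"])
    show "clinear_on UNIV (\<lambda>t. tmap_all id ?e (tassoc (tmap_all (comult G) id t)))"
      by (intro clinear_comp[OF clinear_tmap] clinear_comp[OF clinear_tassoc] clinear_tmap lins)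
  qed (simp_all add: clinear_comp lins tmap_tens e tlift_all_tens[OF bil] clinear_scale[OF comult_linear])
  then have "comult G (?e (comult G x)) = tmap_all id (\<lambda>y. ?e (comult G y)) (comult G x)"
    by (simp add: coassoc tmap_tmap lins) (simp add: id_def)
  then have "tmap_all r id (comult G (?e (comult G x))) = tmap_all r (\<lambda>y. ?e (comult G y)) (comult G x)"
    by (simp add: tmap_tmap lins clinear_comp)
  also have "\<dots> = tmap_all id (\<lambda>y. ?e (comult G y)) (tmap_all r id (comult G x))"
    by (simp add: tmap_tmap lins clinear_comp)
  also have "\<dots> = 1 \<otimes>\<^sub>C ?e (comult G x)"
    by (simp add: invarD[OF x] tmap_tens lins clinear_comp)
  finally show "?e (comult G x) \<in> invar" by (simp add: invar_def)
qed

text \<open>Put \<open>g = 1\<close> in \<open>f (k g) = f g\<close>: an invariant function is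
  constant on K.\<close>

lemma r_invar:
  assumes x: "x \<in> invar"
  shows "r x = counit G x *\<^sub>C 1"
proof -
  have bilA: "cbilinear_on UNIV UNIV (\<lambda>(b::'a) c. counit G c *\<^sub>C b)"
    and bilB: "cbilinear_on UNIV UNIV (\<lambda>(b::'b) c. counit G c *\<^sub>C b)"
    by (rule cbilinear_scale(2)[OF clinear_on_ident counit_linear])+
  have "r (tlift_all (\<lambda>b c. counit G c *\<^sub>C b) t) = tlift_all (\<lambda>b c. counit G c *\<^sub>C b) (tmap_all r id t)" for t
    by (rule tensor_ext[of "\<lambda>t. r (tlift_all (\<lambda>b c. counit G c *\<^sub>C b) t)"])
      (simp_all add: clinear_comp[OF r_linear] clinear_comp[OF clinear_tlift[OF bilB]] clinear_tlift[OF bilA]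
        clinear_tmap r_linear clinear_on_id clinear_on_ident tlift_all_tens[OF bilA] tlift_all_tens[OF bilB] tmap_tens clinear_scale[OF r_linear])
  from this[of "comult G x"] show ?thesis
    by (simp add: counit_right invarD[OF x] tlift_all_tens[OF bilB])
qed

end

section \<open>The splitting as an invariant functional\<close>

text \<open>\<open>s\<close> stands for a linear extension of the splitting to the whole coordinate
  ring, so that it can be tensored with the identity. Parity and equivariance are demanded on
  \<open>invar\<close> alone; \<open>s_invariant\<close> is equivariance towards the trivial
  module.\<close>

locale splitting_pair = supergroup_pair G K r for G :: "'a::complex_algebra_1 supergroup"
  and K :: "'b::complex_algebra_1 supergroup" and r :: "'a \<Rightarrow> 'b" +
  fixes s :: "'a \<Rightarrow> complex"
  assumes s_linear: "clinear_on UNIV s" and s_one: "s 1 = 1"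
    and s_odd: "x \<in> invar_grade True \<Longrightarrow> s x = 0"
    and s_invariant: "x \<in> invar \<Longrightarrow> tmap_all s id (comult G x) = s x \<otimes>\<^sub>C 1"
begin

text \<open>Both \<open>s\<close> and the counit are \<open>K\<close>-invariant functionals on the induced module, so both kill the
  image of \<open>x\<close>. As they agree on 1, which spans \<open>DS_x\<close>, they agree on the kernel of \<open>x\<close>.\<close>

lemma splitting_eq_counit:
  assumes x: "x \<in> lie K True" and DS: "DS_iso (x \<circ> r) (induced_trivial G r) (UNIV :: complex set) gr"
    and T: "T \<in> invar" and inv: "tmap_all id r (comult G T) = T \<otimes>\<^sub>C 1"
  shows "s T = counit G T"
proof -
  let ?I = "induced_trivial G r" and ?y = "\<lambda>b. x (r b)"
  let ?act = "lie_action True (x \<circ> r) ?I"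
  have x_lin: "clinear_on UNIV x" using x by (simp add: lie_def)
  have y_lin: "clinear_on UNIV ?y" by (rule clinear_comp[OF x_lin r_linear])
  have "counit K 1 = 1" using r_counit[of 1] by (simp add: r_one counit_one)
  moreover have "x (1 * 1) = x 1 * counit K 1 + counit K 1 * x 1"
    using x unfolding lie_def by blast
  ultimately have x1: "x 1 = 0" by simp
  have act_sum: "?act u = (\<Sum>i\<in>S. ?y (w i) *\<^sub>C twist (part G) True (v i))"
    if "comult G u = (\<Sum>i\<in>S. v i \<otimes>\<^sub>C w i)" "\<And>i. i \<in> S \<Longrightarrow> v i \<in> invar"
    for u v w and S :: "nat set"
  proof -
    have "?act u = tlift invar UNIV (\<lambda>u b. ?y b *\<^sub>C twist invar_grade True u) (comult G u)"
      by (simp add: lie_action_def induced_trivial_simps twist_def)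
    also have "\<dots> = (\<Sum>i\<in>S. ?y (w i) *\<^sub>C twist invar_grade True (v i))"
      unfolding that(1)
      by (rule tlift_sum[OF subspace_invar cvec.subspace_UNIV
            cbilinear_scale(2)[OF clinear_twist[OF superspace_invar] y_lin]]) (simp_all add: that)
    also have "\<dots> = (\<Sum>i\<in>S. ?y (w i) *\<^sub>C twist (part G) True (v i))"
      by (simp add: that twist_invar_grade)
    finally show ?thesis .
  qed
  \<comment> \<open>By \<open>act_eq\<close>, \<open>x\<close> acts through the coaction restricted
    to K. In \<open>kill\<close>, a functional vanishing on odd elements does not see the Koszul
    twist, so its value on \<open>?act u\<close> is the contraction of \<open>\<Delta> u\<close>
    with \<open>\<eta>\<close> and \<open>x \<circ> r\<close>.\<close>
  have act_eq: "?act u = tlift_all (\<lambda>u b. x b *\<^sub>C twist (part G) True u) (tmap_all id r (comult G u))"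
    and kill: "\<And>\<eta>. clinear_on UNIV \<eta> \<Longrightarrow> (\<And>v. v \<in> invar_grade True \<Longrightarrow> \<eta> v = 0) \<Longrightarrow>
      tlift_all (\<lambda>v w. \<eta> v * ?y w) (comult G u) = 0 \<Longrightarrow> \<eta> (?act u) = (0::complex)"
    if u: "u \<in> invar" for u
  proof -
    obtain n :: nat and v w where vw: "\<And>i. i < n \<Longrightarrow> v i \<in> invar" "comult G u = (\<Sum>i<n. v i \<otimes>\<^sub>C w i)"
      using tensor_space_sum[OF subspace_invar comult_invar[OF u]] by metis
    have act: "?act u = (\<Sum>i<n. ?y (w i) *\<^sub>C twist (part G) True (v i))"
      by (rule act_sum[OF vw(2)]) (simp add: vw(1))
    show "?act u = tlift_all (\<lambda>u b. x b *\<^sub>C twist (part G) True u) (tmap_all id r (comult G u))"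
      unfolding act vw(2) tmap_sum[OF cvec.subspace_UNIV clinear_on_id r_linear UNIV_I]
      by (subst tlift_sum[OF cvec.subspace_UNIV cvec.subspace_UNIV
            cbilinear_scale(2)[OF twist_linear x_lin] UNIV_I UNIV_I]) simp
    fix \<eta> :: "'a \<Rightarrow> complex"
    assume \<eta>: "clinear_on UNIV \<eta>" "\<And>v. v \<in> invar_grade True \<Longrightarrow> \<eta> v = 0"
      "tlift_all (\<lambda>v w. \<eta> v * ?y w) (comult G u) = 0"
    have tw: "\<eta> (twist (part G) True v) = \<eta> v" if v: "v \<in> invar" for v
    proof (rule superspace_ext[OF superspace_invar _ _ _ v, of "\<lambda>v. \<eta> (twist (part G) True v)"])
      fix v p assume v: "v \<in> invar_grade p"
      then have "v \<in> part G p" by simp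
      then have "\<eta> (twist (part G) True v) = psgn True p *\<^sub>C \<eta> v"
        by (simp only: twist_part[of v p] clinear_scale[OF \<eta>(1)])
      then show "\<eta> (twist (part G) True v) = \<eta> v"
        using \<eta>(2)[of v] v by (cases p) (simp_all add: scaleC_one)
    qed (auto intro: clinear_on_subset[OF clinear_comp[OF \<eta>(1) twist_linear]] clinear_on_subset[OF \<eta>(1)])
    have "\<eta> (?act u) = (\<Sum>i<n. \<eta> (v i) * ?y (w i))"
      unfolding act by (simp add: clinear_sum[OF \<eta>(1)] clinear_scale[OF \<eta>(1)] tw vw(1) mult.commute)
    also have "\<dots> = tlift_all (\<lambda>v w. \<eta> v * ?y w) (comult G u)"
      unfolding vw(2)
      by (rule tlift_sum[OF cvec.subspace_UNIV cvec.subspace_UNIV _ UNIV_I UNIV_I, symmetric])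
        (use cbilinear_scale(1)[OF \<eta>(1) y_lin] in simp)
    finally show "\<eta> (?act u) = 0" using \<eta>(3) by simp
  qed
  \<comment> \<open>By invariance of \<open>s\<close> the contraction is
    \<open>s u * x (r 1)\<close>, and a derivation vanishes on 1.\<close>
  have s_act: "s (?act u) = 0" if u: "u \<in> invar" for u
  proof (rule kill[OF u s_linear s_odd])
    have b: "cbilinear_on UNIV UNIV (\<lambda>(z::complex) w. z * ?y w)"
      "cbilinear_on UNIV UNIV (\<lambda>v w. s v * ?y w)"
      using cbilinear_scale(1)[OF clinear_on_ident y_lin] cbilinear_scale(1)[OF s_linear y_lin] by simp_all
    have "tlift_all (\<lambda>v w. s v * ?y w) t = tlift_all (\<lambda>z w. z * ?y w) (tmap_all s id t)" for t
      by (rule tensor_ext[of "tlift_all (\<lambda>v w. s v * ?y w)"])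
        (simp_all add: clinear_comp[OF clinear_tlift[OF b(1)]] clinear_tlift[OF b(2)] clinear_tmap s_linear
          clinear_on_id clinear_on_ident tlift_all_tens[OF b(1)] tlift_all_tens[OF b(2)] tmap_tens)
    then show "tlift_all (\<lambda>v w. s v * ?y w) (comult G u) = 0"
      by (simp add: s_invariant[OF u] tlift_all_tens[OF b(1)] r_one x1)
  qed
  \<comment> \<open>Here the contraction is \<open>x (r u)\<close> by the counit axiom, and
    \<open>r u\<close> is a constant by \<open>r_invar\<close>.\<close>
  have counit_act: "counit G (?act u) = 0" if u: "u \<in> invar" for u
  proof (rule kill[OF u counit_linear])
    have b: "cbilinear_on UNIV UNIV (\<lambda>(v::'a) w. counit G v *\<^sub>C w)"
      "cbilinear_on UNIV UNIV (\<lambda>v w. counit G v * ?y w)"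
      using cbilinear_scale(1)[OF counit_linear clinear_on_ident] cbilinear_scale(1)[OF counit_linear y_lin] by simp_all
    have "tlift_all (\<lambda>v w. counit G v * ?y w) t = ?y (tlift_all (\<lambda>v w. counit G v *\<^sub>C w) t)" for t
      by (rule tensor_ext[of "tlift_all (\<lambda>v w. counit G v * ?y w)"])
        (simp_all add: clinear_comp[OF y_lin] clinear_tlift b tlift_all_tens[OF b(1)]
          tlift_all_tens[OF b(2)] clinear_scale[OF y_lin])
    then show "tlift_all (\<lambda>v w. counit G v * ?y w) (comult G u) = 0"
      by (simp add: counit_left r_invar[OF u] clinear_scale[OF x_lin] x1)
  qed (simp add: counit_odd)
  let ?Ker = "DS_ker (x \<circ> r) ?I"
  \<comment> \<open>By \<open>act_eq\<close> the action depends only on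
    \<open>(id \<otimes> r) (\<Delta> u)\<close>; for a right K-invariant \<open>u\<close> the
    second leg is 1, where \<open>x\<close> vanishes.\<close>
  have act_zero: "?act u = 0" if "u \<in> invar" "tmap_all id r (comult G u) = u \<otimes>\<^sub>C 1" for u
    using that by (simp add: act_eq tlift_all_tens[OF cbilinear_scale(2)[OF twist_linear x_lin]] x1)
  have one_invar: "1 \<in> invar"
    by (simp add: invar_def comult_one tmap_tens r_linear clinear_on_id clinear_on_ident r_one)
  have one: "1 \<in> ?Ker"
    using act_zero[OF one_invar] one_invar
    by (simp add: DS_ker_def induced_trivial_simps comult_one tmap_tens r_linear clinear_on_id clinear_on_ident r_one)
  have TK: "T \<in> ?Ker"
    using T act_zero[OF T inv] by (simp add: DS_ker_def induced_trivial_simps)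
  obtain f where f: "clinear_on ?Ker f" and ker: "{v \<in> ?Ker. f v = (0::complex)} = DS_im (x \<circ> r) ?I \<inter> ?Ker"
    using DS unfolding DS_iso_def by blast
  have im: "s v = 0 \<and> counit G v = 0" if "v \<in> ?Ker" "f v = 0" for v
  proof -
    have "v \<in> DS_im (x \<circ> r) ?I" using that ker by blast
    then show ?thesis using s_act counit_act by (auto simp: DS_im_def induced_trivial_simps)
  qed
  \<comment> \<open>Otherwise 1 would lie in the image of \<open>x\<close>, where \<open>s\<close>
    vanishes, against \<open>s 1 = 1\<close>.\<close>
  have f1: "f 1 \<noteq> 0" using im[OF one] s_one by auto
  \<comment> \<open>Since \<open>f\<close> has scalar values, \<open>T\<close> and 1 are
    proportional modulo its kernel, that is modulo the image of \<open>x\<close>. Both functionals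
    then take the value \<open>z\<close> at \<open>T\<close>.\<close>
  define z where "z = f T / f 1"
  have act_lin: "clinear_on invar ?act"
  proof -
    have "clinear_on UNIV (\<lambda>u. tlift_all (\<lambda>u b. x b *\<^sub>C twist (part G) True u) (tmap_all id r (comult G u)))"
      by (intro clinear_comp[OF clinear_tlift] clinear_comp[OF clinear_tmap] cbilinear_scale(2)
          twist_linear x_lin r_linear clinear_on_id comult_linear)
    then show ?thesis
      using subspace_invar by (simp add: clinear_on_def act_eq cvec.subspace_add cvec.subspace_scale)
  qed
  have sub: "cvec.subspace ?Ker"
    using subspace_invar clinear_on_0[OF act_lin cvec.subspace_0[OF subspace_invar]]
    by (intro cvec.subspaceI)
      (auto simp: DS_ker_def induced_trivial_simps cvec.subspace_0 cvec.subspace_add cvec.subspace_scale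
        clinear_on_addD[OF act_lin] clinear_on_scaleD[OF act_lin])
  have z1: "z *\<^sub>C 1 \<in> ?Ker" using one sub by (simp add: cvec.subspace_scale)
  have "f (T - z *\<^sub>C 1) = f T - z * f 1"
    using clinear_on_diffD[OF f sub TK z1] clinear_on_scaleD[OF f one, of z] by simp
  also have "\<dots> = 0" using f1 by (simp add: z_def)
  finally have "f (T - z *\<^sub>C 1) = 0" .
  moreover have "T - z *\<^sub>C 1 \<in> ?Ker" by (rule cvec.subspace_diff[OF sub TK z1])
  ultimately have "s (T - z *\<^sub>C 1) = 0" "counit G (T - z *\<^sub>C 1) = 0" using im by blast+
  then show ?thesis
    by (simp add: clinear_diff[OF s_linear] clinear_diff[OF counit_linear] clinear_scale[OF s_linear]
        clinear_scale[OF counit_linear] s_one counit_one)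
qed

end

section \<open>Averaging a matrix that commutes with K\<close>

locale averaging_pair = splitting_pair G K r s + averaging G P pp c J pj a F
  for G :: "'a::complex_algebra_1 supergroup" and K :: "'b::complex_algebra_1 supergroup"
    and r :: "'a \<Rightarrow> 'b" and s :: "'a \<Rightarrow> complex"
    and P :: "'p set" and pp :: "'p \<Rightarrow> bool" and c :: "'p \<Rightarrow> 'p \<Rightarrow> 'a"
    and J :: "'j set" and pj :: "'j \<Rightarrow> bool" and a :: "'j \<Rightarrow> 'j \<Rightarrow> 'a"
    and F :: "'p \<Rightarrow> 'j \<Rightarrow> complex" +
  assumes F_intertwines: "intertwines P (\<lambda>p q. r (c p q)) J (\<lambda>i j. r (a i j)) F"
begin

text \<open>On K the average is constant: \<open>k^-1 F k = F\<close>, since \<open>F\<close>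
  commutes with K.\<close>

lemma r_avg:
  assumes p: "p \<in> P" and j: "j \<in> J"
  shows "r (avg p j) = F p j *\<^sub>C 1"
proof -
  have "r (avg p j) = (\<Sum>q\<in>P. r (antipode G (c p q)) * (\<Sum>i\<in>J. F q i *\<^sub>C r (a i j)))"
    by (simp add: avg_def clinear_sum[OF r_linear] clinear_scale[OF r_linear] r_mult sum_distrib_left
        mult_scaleC_right)
  also have "\<dots> = (\<Sum>q\<in>P. r (antipode G (c p q)) * (\<Sum>u\<in>P. F u j *\<^sub>C r (c q u)))"
    using F_intertwines j by (intro sum.cong refl) (simp add: intertwines_def)
  also have "\<dots> = (\<Sum>u\<in>P. F u j *\<^sub>C r (\<Sum>q\<in>P. antipode G (c p q) * c q u))"
    by (simp add: sum_distrib_left mult_scaleC_right clinear_sum[OF r_linear] r_mult cvec.scale_sum_right)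
      (rule sum.swap)
  also have "\<dots> = (\<Sum>u\<in>P. if p = u then F u j *\<^sub>C 1 else 0)"
    by (rule sum.cong[OF refl])
      (simp add: comatrix_antipode(1)[OF c p] r_one clinear_zero[OF r_linear])
  finally show ?thesis using p comatrix_finite[OF c] by simp
qed

text \<open>\<open>(k g)^-1 F (k g) = g^-1 F g\<close>: apply \<open>r\<close> to the left leg in
  \<open>comult_avg\<close>, where \<open>r_avg\<close> turns the entries into those of
  \<open>F\<close>. The sign can differ from 1 only where the entry of \<open>F\<close> is
  zero.\<close>

lemma avg_invar:
  assumes t: "t \<in> P" and j: "j \<in> J"
  shows "avg t j \<in> invar"
proof -
  note lin = clinear_tmap[OF r_linear clinear_on_id]
  have "tmap_all r id (comult G (avg t j)) = (\<Sum>p\<in>P. \<Sum>k\<in>J. psgn (pp t \<noteq> pp p) (pp p \<noteq> pj k) *\<^sub>C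
      (r (avg p k) \<otimes>\<^sub>C (antipode G (c t p) * a k j)))"
    by (simp add: comult_avg[OF t j] clinear_sum[OF lin] clinear_scale[OF lin]
        tmap_tens[OF r_linear clinear_on_id])
  also have "\<dots> = (\<Sum>p\<in>P. \<Sum>k\<in>J. 1 \<otimes>\<^sub>C (F p k *\<^sub>C (antipode G (c t p) * a k j)))"
  proof (intro sum.cong refl)
    fix p k assume pk: "p \<in> P" "k \<in> J"
    then have "pp p = pj k \<or> F p k = 0" using F by (auto simp: even_matrix_def)
    then show "psgn (pp t \<noteq> pp p) (pp p \<noteq> pj k) *\<^sub>C (r (avg p k) \<otimes>\<^sub>C (antipode G (c t p) * a k j)) =
        1 \<otimes>\<^sub>C (F p k *\<^sub>C (antipode G (c t p) * a k j))"
      by (auto simp: r_avg[OF pk] tens_scale_left tens_scale_right scaleC_one)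
  qed
  also have "\<dots> = 1 \<otimes>\<^sub>C avg t j" by (simp add: avg_def tens_sum_right)
  finally show ?thesis by (simp add: invar_def)
qed

definition favg :: "'p \<Rightarrow> 'j \<Rightarrow> complex" where
  "favg p j = s (avg p j)"

text \<open>The entries of \<open>avg\<close> in odd position are odd functions, which the splitting
  kills.\<close>

lemma favg_even: "even_matrix P pp J pj favg"
  unfolding even_matrix_def favg_def
proof (intro ballI impI s_odd)
  fix p j assume "p \<in> P" "j \<in> J" "pp p \<noteq> pj j"
  then show "avg p j \<in> invar_grade True" using avg_part[of p j] avg_invar[of p j] by simp
qed

text \<open>Applying \<open>s\<close> to the first leg of \<open>comult_avg\<close> turns invariance
  of \<open>s\<close> into \<open>s(E) = h^-1 s(E) h\<close> for \<open>h\<close> in G. Multiplying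
  by the matrix \<open>c\<close> on the left gives the intertwining relation.\<close>

lemma favg_intertwines: "intertwines P c J a favg"
  unfolding intertwines_def
proof (intro ballI)
  fix q j assume q: "q \<in> P" and j: "j \<in> J"
  have b: "cbilinear_on UNIV UNIV (\<lambda>(z::complex) (b::'a). z *\<^sub>C b)"
    by (rule cbilinear_scale(1)[OF clinear_on_ident clinear_on_ident])
  note b_lin = clinear_tlift[OF b] and s_lin = clinear_tmap[OF s_linear clinear_on_id]
  have avg: "favg t j *\<^sub>C 1 = (\<Sum>p\<in>P. \<Sum>k\<in>J. favg p k *\<^sub>C (antipode G (c t p) * a k j))" if t: "t \<in> P" for t
  proof -
    have "favg t j *\<^sub>C 1 = tlift_all (\<lambda>(z::complex) (b::'a). z *\<^sub>C b) (tmap_all s id (comult G (avg t j)))"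
      by (simp add: s_invariant[OF avg_invar[OF t j]] tlift_all_tens[OF b] favg_def)
    also have "\<dots> = (\<Sum>p\<in>P. \<Sum>k\<in>J. psgn (pp t \<noteq> pp p) (pp p \<noteq> pj k) *\<^sub>C
        (favg p k *\<^sub>C (antipode G (c t p) * a k j)))"
      by (simp only: comult_avg[OF t j] clinear_sum[OF s_lin] clinear_scale[OF s_lin] clinear_sum[OF b_lin]
          clinear_scale[OF b_lin] tmap_tens[OF s_linear clinear_on_id] tlift_all_tens[OF b] favg_def id_apply)
    also have "\<dots> = (\<Sum>p\<in>P. \<Sum>k\<in>J. favg p k *\<^sub>C (antipode G (c t p) * a k j))"
    proof (intro sum.cong refl)
      fix p k assume pk: "p \<in> P" "k \<in> J"
      then have "pp p = pj k \<or> favg p k = 0" using favg_even by (auto simp: even_matrix_def)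
      then show "psgn (pp t \<noteq> pp p) (pp p \<noteq> pj k) *\<^sub>C (favg p k *\<^sub>C (antipode G (c t p) * a k j)) =
          favg p k *\<^sub>C (antipode G (c t p) * a k j)"
        by (auto simp: scaleC_one)
    qed
    finally show ?thesis .
  qed
  have "(\<Sum>t\<in>P. favg t j *\<^sub>C c q t) = (\<Sum>t\<in>P. c q t * (favg t j *\<^sub>C 1))"
    by (simp add: mult_scaleC_right)
  also have "\<dots> = (\<Sum>t\<in>P. \<Sum>p\<in>P. \<Sum>k\<in>J. favg p k *\<^sub>C (c q t * antipode G (c t p) * a k j))"
    by (simp add: avg sum_distrib_left mult_scaleC_right mult.assoc)
  also have "\<dots> = (\<Sum>p\<in>P. \<Sum>k\<in>J. favg p k *\<^sub>C ((\<Sum>t\<in>P. c q t * antipode G (c t p)) * a k j))"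
    by (subst sum.swap, rule sum.cong[OF refl], subst sum.swap)
      (simp add: sum_distrib_right cvec.scale_sum_right)
  also have "\<dots> = (\<Sum>p\<in>P. if q = p then \<Sum>k\<in>J. favg p k *\<^sub>C a k j else 0)"
    by (rule sum.cong[OF refl]) (simp add: comatrix_antipode(2)[OF c q])
  finally show "(\<Sum>t\<in>P. favg t j *\<^sub>C c q t) = (\<Sum>k\<in>J. favg q k *\<^sub>C a k j)"
    using q comatrix_finite[OF c] by simp
qed

text \<open>The supertrace of \<open>avg H\<close> is the function \<open>g \<mapsto> str (g\<inverse> F g H)\<close>, which is right
  \<open>K\<close>-invariant as \<open>H\<close> commutes with \<open>K\<close>.\<close>

lemma supertrace_favg:
  assumes x: "x \<in> lie K True" and DS: "DS_iso (x \<circ> r) (induced_trivial G r) (UNIV :: complex set) gr"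
    and H: "even_matrix J pj P pp H" and HK: "intertwines J (\<lambda>i j. r (a i j)) P (\<lambda>p q. r (c p q)) H"
  shows "(\<Sum>p\<in>P. \<Sum>j\<in>J. psgn True (pp p) * H j p * favg p j) =
    (\<Sum>p\<in>P. \<Sum>j\<in>J. psgn True (pp p) * H j p * F p j)"
proof -
  define T where "T = (\<Sum>p\<in>P. \<Sum>j\<in>J. (psgn True (pp p) * H j p) *\<^sub>C avg p j)"
  note r_lin = clinear_tmap[OF clinear_on_id r_linear]
  have T: "T \<in> invar"
    unfolding T_def
    by (intro cvec.subspace_sum cvec.subspace_scale subspace_invar avg_invar)
  \<comment> \<open>The sum over \<open>j\<close> is an entry of \<open>a H\<close>, which over K
    equals \<open>H c\<close>. This brings the coefficients of N and their antipodes together, but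
    in the wrong order.\<close>
  have summand: "(\<Sum>j\<in>J. (psgn True (pp t) * H j t) *\<^sub>C (psgn (pp t \<noteq> pp p) (pp p \<noteq> pj k) *\<^sub>C
        (avg p k \<otimes>\<^sub>C r (antipode G (c t p) * a k j)))) =
      avg p k \<otimes>\<^sub>C r (\<Sum>u\<in>P. (psgn True (pp p) * H k u) *\<^sub>C (c u t * antipode G (c t p)))"
    if t: "t \<in> P" and p: "p \<in> P" and k: "k \<in> J" for t p k
  proof -
    let ?z = "psgn True (pp t) * psgn (pp t \<noteq> pp p) (pp p \<noteq> pj k)"
    \<comment> \<open>The exchange costs a sign. For \<open>pj k = pp u\<close>, the only case with
      \<open>H k u\<close> nonzero, the signs combine to \<open>(-1)^(|t|+|p|)\<close>, which moves
      the supertrace sign from \<open>t\<close> to \<open>p\<close>: graded cyclicity of the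
      supertrace.\<close>
    have comm: "(?z * H k u) *\<^sub>C (antipode G (c t p) * c u t) =
        (psgn True (pp p) * H k u) *\<^sub>C (c u t * antipode G (c t p))" if u: "u \<in> P" for u
    proof -
      have "antipode G (c t p) * c u t = psgn (pp u \<noteq> pp t) (pp t \<noteq> pp p) *\<^sub>C (c u t * antipode G (c t p))"
        by (rule mult_supercomm[OF comatrix_part[OF c u t] antipode_part[OF comatrix_part[OF c t p]]])
      moreover have "?z * H k u * psgn (pp u \<noteq> pp t) (pp t \<noteq> pp p) = psgn True (pp p) * H k u"
        using H k u by (cases "pj k = pp u") (auto simp: even_matrix_def psgn_def)
      ultimately show ?thesis by (simp only: scaleC_scaleC)
    qed
    have "(\<Sum>j\<in>J. (psgn True (pp t) * H j t) *\<^sub>C (psgn (pp t \<noteq> pp p) (pp p \<noteq> pj k) *\<^sub>C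
        (avg p k \<otimes>\<^sub>C r (antipode G (c t p) * a k j)))) =
      avg p k \<otimes>\<^sub>C (?z *\<^sub>C (r (antipode G (c t p)) * (\<Sum>j\<in>J. H j t *\<^sub>C r (a k j))))"
      by (simp add: r_mult tens_sum_right tens_scale_right sum_distrib_left mult_scaleC_right
          scaleC_scaleC cvec.scale_sum_right mult_ac)
    also have "(\<Sum>j\<in>J. H j t *\<^sub>C r (a k j)) = (\<Sum>u\<in>P. H k u *\<^sub>C r (c u t))"
      using HK k t by (simp add: intertwines_def)
    also have "?z *\<^sub>C (r (antipode G (c t p)) * \<dots>) =
        r (\<Sum>u\<in>P. (?z * H k u) *\<^sub>C (antipode G (c t p) * c u t))"
      by (simp add: r_mult sum_distrib_left mult_scaleC_right scaleC_scaleC cvec.scale_sum_right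
          clinear_sum[OF r_linear] clinear_scale[OF r_linear])
    finally show ?thesis by (simp only: comm cong: sum.cong)
  qed
  have inv: "tmap_all id r (comult G T) = T \<otimes>\<^sub>C 1"
  proof -
    have "tmap_all id r (comult G T) = (\<Sum>t\<in>P. \<Sum>j\<in>J. \<Sum>p\<in>P. \<Sum>k\<in>J. (psgn True (pp t) * H j t) *\<^sub>C
        (psgn (pp t \<noteq> pp p) (pp p \<noteq> pj k) *\<^sub>C (avg p k \<otimes>\<^sub>C r (antipode G (c t p) * a k j))))"
      unfolding T_def
      by (simp only: clinear_sum[OF comult_linear] clinear_scale[OF comult_linear] comult_avg
          clinear_sum[OF r_lin] clinear_scale[OF r_lin] tmap_tens[OF clinear_on_id r_linear] id_apply
          cvec.scale_sum_right cong: sum.cong)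
    also have "\<dots> = (\<Sum>t\<in>P. \<Sum>p\<in>P. \<Sum>k\<in>J. \<Sum>j\<in>J. (psgn True (pp t) * H j t) *\<^sub>C
        (psgn (pp t \<noteq> pp p) (pp p \<noteq> pj k) *\<^sub>C (avg p k \<otimes>\<^sub>C r (antipode G (c t p) * a k j))))"
      by (rule sum.cong[OF refl], subst sum.swap, rule sum.cong[OF refl], rule sum.swap)
    also have "\<dots> = (\<Sum>t\<in>P. \<Sum>p\<in>P. \<Sum>k\<in>J.
        avg p k \<otimes>\<^sub>C r (\<Sum>u\<in>P. (psgn True (pp p) * H k u) *\<^sub>C (c u t * antipode G (c t p))))"
      by (simp only: summand cong: sum.cong)
    also have "\<dots> = (\<Sum>p\<in>P. \<Sum>k\<in>J. \<Sum>t\<in>P.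
        avg p k \<otimes>\<^sub>C r (\<Sum>u\<in>P. (psgn True (pp p) * H k u) *\<^sub>C (c u t * antipode G (c t p))))"
      by (subst sum.swap, rule sum.cong[OF refl], rule sum.swap)
    \<comment> \<open>In the new order the summation index \<open>t\<close> joins \<open>c\<close>
      to its inverse, so only \<open>u = p\<close> survives and the second leg becomes 1.\<close>
    also have "\<dots> = (\<Sum>p\<in>P. \<Sum>k\<in>J. ((psgn True (pp p) * H k p) *\<^sub>C avg p k) \<otimes>\<^sub>C 1)"
    proof (intro sum.cong refl)
      fix p k assume p: "p \<in> P" and k: "k \<in> J"
      have "(\<Sum>t\<in>P. \<Sum>u\<in>P. (psgn True (pp p) * H k u) *\<^sub>C (c u t * antipode G (c t p))) =
          (\<Sum>u\<in>P. (psgn True (pp p) * H k u) *\<^sub>C (\<Sum>t\<in>P. c u t * antipode G (c t p)))"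
        by (subst sum.swap) (simp add: cvec.scale_sum_right)
      also have "\<dots> = (\<Sum>u\<in>P. if u = p then (psgn True (pp p) * H k u) *\<^sub>C 1 else 0)"
        by (rule sum.cong[OF refl]) (simp add: comatrix_antipode(2)[OF c _ p])
      also have "\<dots> = (psgn True (pp p) * H k p) *\<^sub>C 1"
        using p comatrix_finite[OF c] by simp
      finally have "r (\<Sum>t\<in>P. \<Sum>u\<in>P. (psgn True (pp p) * H k u) *\<^sub>C (c u t * antipode G (c t p))) =
          (psgn True (pp p) * H k p) *\<^sub>C 1"
        by (simp only: clinear_scale[OF r_linear] r_one)
      then show "(\<Sum>t\<in>P. avg p k \<otimes>\<^sub>C r (\<Sum>u\<in>P. (psgn True (pp p) * H k u) *\<^sub>C (c u t * antipode G (c t p)))) =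
          ((psgn True (pp p) * H k p) *\<^sub>C avg p k) \<otimes>\<^sub>C 1"
        by (simp only: clinear_sum[OF r_linear, of _ P, symmetric] tens_sum_right[symmetric] tens_scale_left
            tens_scale_right)
    qed
    also have "\<dots> = T \<otimes>\<^sub>C 1" by (simp add: T_def tens_sum_left)
    finally show ?thesis .
  qed
  have "s T = counit G T"
    by (rule splitting_eq_counit[OF x DS T inv])
  then show ?thesis
    unfolding T_def
    by (simp add: clinear_sum[OF s_linear] clinear_scale[OF s_linear] clinear_sum[OF counit_linear]
        clinear_scale[OF counit_linear] counit_avg favg_def)
qed

end

section \<open>Finite-dimensional modules in coordinates\<close>

text \<open>Chosen by the same expression as the basis inside \<open>coev\<close>, so both are the
  same set and the trace can be computed in this basis.\<close>

definition hbasis :: "('v::complex_vector, 'a::complex_vector) supermodule \<Rightarrow> 'v set" where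
  "hbasis M = (SOME B. cvec.independent B \<and> cvec.span B = carr M \<and> B \<subseteq> grade M False \<union> grade M True)"

definition parity :: "('v::complex_vector, 'a::complex_vector) supermodule \<Rightarrow> 'v \<Rightarrow> bool" where
  "parity M b \<longleftrightarrow> b \<in> grade M True"

definition coord :: "('v::complex_vector, 'a::complex_vector) supermodule \<Rightarrow> 'v \<Rightarrow> 'v \<Rightarrow> complex" where
  "coord M b v = cvec.representation (hbasis M) v b"

text \<open>The factors of \<open>coact M v\<close> at the basis vectors; with \<open>v\<close> in
  the basis these are the matrix coefficients of the module.\<close>

definition coef :: "('v::complex_vector, 'a::complex_vector) supermodule \<Rightarrow> 'v \<Rightarrow> 'v \<Rightarrow> 'a" where
  "coef M b v = tlift (carr M) UNIV (\<lambda>u a. coord M b u *\<^sub>C a) (coact M v)"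

text \<open>The supergroup is kept out of the interface, so that a G-module and its restriction to K
  share the coordinate calculus.\<close>

locale fd_supermodule =
  fixes M :: "('v::complex_vector, 'a::complex_vector) supermodule"
  assumes superspace: "superspace (carr M) (grade M)" and fd: "finite_dim M"
    and coact_linear: "clinear_on (carr M) (coact M)"
    and coact_in: "v \<in> carr M \<Longrightarrow> coact M v \<in> tensor_space (carr M) UNIV"
begin

lemma subspace_carr: "cvec.subspace (carr M)"
  by (rule superspace_subspace[OF superspace])

lemma
  shows independent_hbasis: "cvec.independent (hbasis M)"
    and span_hbasis: "cvec.span (hbasis M) = carr M"
    and hbasis_homogeneous: "hbasis M \<subseteq> grade M False \<union> grade M True"
proof -
  let ?S = "grade M False \<union> grade M True"
  obtain B where B: "B \<subseteq> ?S" "cvec.independent B" "?S \<subseteq> cvec.span B"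
    using cvec.maximal_independent_subset by blast
  have "?S \<subseteq> carr M" using superspace_grade[OF superspace] by blast
  then have "cvec.span B \<subseteq> carr M"
    using B(1) subspace_carr by (intro cvec.span_minimal) auto
  moreover have "carr M \<subseteq> cvec.span B"
  proof
    fix v assume "v \<in> carr M"
    then obtain u w where "v = u + w" "u \<in> grade M False" "w \<in> grade M True"
      using superspace by (auto simp: superspace_def)
    then show "v \<in> cvec.span B" using B(3) by (auto intro: cvec.span_add)
  qed
  ultimately have "cvec.independent B \<and> cvec.span B = carr M \<and> B \<subseteq> ?S" using B by blast
  then have "cvec.independent (hbasis M) \<and> cvec.span (hbasis M) = carr M \<and> hbasis M \<subseteq> ?S"
    unfolding hbasis_def by (rule someI)
  then show "cvec.independent (hbasis M)" "cvec.span (hbasis M) = carr M" "hbasis M \<subseteq> ?S" by auto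
qed

lemma finite_hbasis: "finite (hbasis M)"
proof -
  obtain B where "finite B" "cvec.span B = carr M" using fd by (auto simp: finite_dim_def)
  then show ?thesis
    using cvec.independent_span_bound[OF _ independent_hbasis] cvec.span_superset[of "hbasis M"]
    by (auto simp: span_hbasis)
qed

lemma hbasis_carr: "b \<in> hbasis M \<Longrightarrow> b \<in> carr M"
  using cvec.span_superset[of "hbasis M"] by (auto simp: span_hbasis)

lemma hbasis_grade: "b \<in> hbasis M \<Longrightarrow> b \<in> grade M (parity M b)"
  using hbasis_homogeneous by (cases "parity M b") (auto simp: parity_def)

lemma coord_linear: "clinear_on (carr M) (coord M b)"
  by (simp add: clinear_on_def coord_def cvec.representation_add[OF independent_hbasis]
      cvec.representation_scale[OF independent_hbasis] span_hbasis)

lemma coord_expansion: "v \<in> carr M \<Longrightarrow> v = (\<Sum>b\<in>hbasis M. coord M b v *\<^sub>C b)"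
  by (simp add: coord_def cvec.sum_representation_eq[OF independent_hbasis _ finite_hbasis] span_hbasis)

lemma coord_hbasis: "b' \<in> hbasis M \<Longrightarrow> coord M b b' = (if b = b' then 1 else 0)"
  by (auto simp: coord_def cvec.representation_basis[OF independent_hbasis])

lemma coord_outside: "v \<notin> carr M \<Longrightarrow> coord M b v = 0"
  by (simp add: coord_def cvec.representation_def span_hbasis)

text \<open>The component of \<open>v\<close> of the opposite parity is zero, and it is the part of
  the expansion over basis vectors of that parity; independence makes each coefficient zero.\<close>

lemma coord_parity:
  assumes v: "v \<in> grade M p" and b: "b \<in> hbasis M" and ne: "parity M b \<noteq> p"
  shows "coord M b v = 0"
proof -
  have vc: "v \<in> carr M" using v superspace_grade[OF superspace] by blast
  let ?g = "gproj (grade M) (\<not> p)"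
  have "?g v = ?g (\<Sum>b\<in>hbasis M. coord M b v *\<^sub>C b)"
    using coord_expansion[OF vc] by simp
  also have "\<dots> = (\<Sum>b\<in>hbasis M. ?g (coord M b v *\<^sub>C b))"
    by (rule clinear_on_sum[OF clinear_gproj[OF superspace] subspace_carr])
      (simp add: cvec.subspace_scale[OF subspace_carr] hbasis_carr)
  also have "\<dots> = (\<Sum>b\<in>hbasis M. (if parity M b = p then 0 else coord M b v) *\<^sub>C b)"
  proof (intro sum.cong refl)
    fix b assume b: "b \<in> hbasis M"
    have "?g (coord M b v *\<^sub>C b) = coord M b v *\<^sub>C ?g b"
      by (rule clinear_on_scaleD[OF clinear_gproj[OF superspace] hbasis_carr[OF b]])
    then show "?g (coord M b v *\<^sub>C b) = (if parity M b = p then 0 else coord M b v) *\<^sub>C b"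
      by (auto simp: gproj_homogeneous[OF superspace hbasis_grade[OF b]])
  qed
  finally have "(\<Sum>b\<in>hbasis M. (if parity M b = p then 0 else coord M b v) *\<^sub>C b) = 0"
    using gproj_homogeneous[OF superspace v, of "\<not> p"] by simp
  from cvec.independentD[OF independent_hbasis finite_hbasis order_refl this b] ne
  show ?thesis by simp
qed

lemma hbasis_ext:
  assumes "clinear_on (carr M) f" "clinear_on (carr M) g" "\<And>b. b \<in> hbasis M \<Longrightarrow> f b = g b" "v \<in> carr M"
  shows "f v = g v"
proof -
  have c: "coord M b v *\<^sub>C b \<in> carr M" if "b \<in> hbasis M" for b
    using that by (simp add: cvec.subspace_scale[OF subspace_carr] hbasis_carr)
  have "f (\<Sum>b\<in>hbasis M. coord M b v *\<^sub>C b) = g (\<Sum>b\<in>hbasis M. coord M b v *\<^sub>C b)"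
    using assms(3)
    by (simp add: clinear_on_sum[OF assms(1) subspace_carr c] clinear_on_sum[OF assms(2) subspace_carr c]
        clinear_on_scaleD[OF assms(1) hbasis_carr] clinear_on_scaleD[OF assms(2) hbasis_carr])
  then show ?thesis by (simp flip: coord_expansion[OF assms(4)])
qed

text \<open>Contract the left factor with a coordinate functional. This is what allows comodule
  identities to be compared entry by entry.\<close>

lemma tens_hbasis_unique:
  assumes "(\<Sum>b\<in>hbasis M. b \<otimes>\<^sub>C x b) = (\<Sum>b\<in>hbasis M. b \<otimes>\<^sub>C y b)" "b \<in> hbasis M"
  shows "x b = y b"
proof -
  have "tlift (carr M) UNIV (\<lambda>u a. coord M b u *\<^sub>C a) (\<Sum>b\<in>hbasis M. b \<otimes>\<^sub>C z b) = z b" for z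
  proof -
    have "tlift (carr M) UNIV (\<lambda>u a. coord M b u *\<^sub>C a) (\<Sum>b\<in>hbasis M. b \<otimes>\<^sub>C z b) =
        (\<Sum>b'\<in>hbasis M. coord M b b' *\<^sub>C z b')"
      by (rule tlift_sum[OF subspace_carr cvec.subspace_UNIV cbilinear_scale(1)[OF coord_linear clinear_on_ident]])
        (simp_all add: hbasis_carr)
    also have "\<dots> = (\<Sum>b'\<in>hbasis M. if b = b' then z b' else 0)"
      by (intro sum.cong refl) (simp add: coord_hbasis scaleC_one)
    finally show ?thesis using assms(2) finite_hbasis by simp
  qed
  from this[of x] this[of y] show ?thesis by (simp add: assms(1))
qed

lemma coef_linear: "clinear_on (carr M) (coef M b)"
  unfolding coef_def
  by (rule clinear_on_compose[OF coact_linear _ tlift_clinear[OF subspace_carr cvec.subspace_UNIV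
        cbilinear_scale(1)[OF coord_linear clinear_on_ident]]])
    (use coact_in in auto)

lemma coact_coef:
  assumes v: "v \<in> carr M"
  shows "coact M v = (\<Sum>b\<in>hbasis M. b \<otimes>\<^sub>C coef M b v)"
proof -
  obtain n :: nat and u w where u: "\<And>i. i < n \<Longrightarrow> u i \<in> carr M" and eq: "coact M v = (\<Sum>i<n. u i \<otimes>\<^sub>C w i)"
    using tensor_space_sum[OF subspace_carr coact_in[OF v]] by metis
  have coef: "coef M b v = (\<Sum>i<n. coord M b (u i) *\<^sub>C w i)" for b
    unfolding coef_def eq
    by (rule tlift_sum[OF subspace_carr cvec.subspace_UNIV cbilinear_scale(1)[OF coord_linear clinear_on_ident]])
      (simp_all add: u)
  have "coact M v = (\<Sum>i<n. (\<Sum>b\<in>hbasis M. coord M b (u i) *\<^sub>C b) \<otimes>\<^sub>C w i)"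
    unfolding eq by (intro sum.cong refl) (simp add: u flip: coord_expansion)
  also have "\<dots> = (\<Sum>b\<in>hbasis M. b \<otimes>\<^sub>C coef M b v)"
    by (simp add: coef tens_sum_left tens_sum_right tens_scale_left tens_scale_right) (rule sum.swap)
  finally show ?thesis .
qed

lemma coact_coef_unique:
  assumes "v \<in> carr M" "coact M v = (\<Sum>b\<in>hbasis M. b \<otimes>\<^sub>C x b)" "b \<in> hbasis M"
  shows "coef M b v = x b"
  using tens_hbasis_unique[of "\<lambda>b. coef M b v" x] assms coact_coef[OF assms(1)] by simp

lemma tmap_coact:
  assumes "clinear_on (carr M) f" "clinear_on UNIV g" "v \<in> carr M"
  shows "tmap (carr M) UNIV f g (coact M v) = (\<Sum>b\<in>hbasis M. f b \<otimes>\<^sub>C g (coef M b v))"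
  unfolding coact_coef[OF assms(3)]
  by (rule tmap_sum[OF subspace_carr assms(1,2)]) (rule hbasis_carr)

lemma coef_expansion:
  assumes v: "v \<in> carr M"
  shows "coef M b v = (\<Sum>j\<in>hbasis M. coord M j v *\<^sub>C coef M b j)"
proof -
  have "coef M b v = coef M b (\<Sum>j\<in>hbasis M. coord M j v *\<^sub>C j)" using coord_expansion[OF v] by simp
  then show ?thesis
    by (simp add: clinear_on_sum[OF coef_linear subspace_carr] clinear_on_scaleD[OF coef_linear hbasis_carr]
        cvec.subspace_scale[OF subspace_carr] hbasis_carr)
qed

lemma superspace_dual: "superspace (dual_carr (carr M)) (dual_grade (carr M) (grade M))"
  unfolding superspace_def
proof (intro conjI allI)
  note V = subspace_carr
  show sub: "cvec.subspace (dual_carr (carr M))"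
    by (rule cvec.subspaceI) (auto simp: dual_carr_def clinear_on_def scaleC_add_right algebra_simps)
  show "cvec.subspace (dual_grade (carr M) (grade M) p)" for p
    by (rule cvec.subspaceI)
      (auto simp: dual_grade_def cvec.subspace_0 cvec.subspace_add cvec.subspace_scale sub)
  show "dual_grade (carr M) (grade M) False \<inter> dual_grade (carr M) (grade M) True = {0}"
  proof (intro equalityI subsetI)
    fix \<phi> assume \<phi>: "\<phi> \<in> dual_grade (carr M) (grade M) False \<inter> dual_grade (carr M) (grade M) True"
    have "\<phi> v = 0" for v
    proof (cases "v \<in> carr M")
      case True
      have z: "clinear_on (carr M) (\<lambda>v. 0::complex)" by (simp add: clinear_on_def)
      show ?thesis
        by (rule superspace_ext[OF superspace _ z _ True])
          (use \<phi> in \<open>auto simp: dual_grade_def dual_carr_def\<close>, metis (full_types))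
    qed (use \<phi> in \<open>auto simp: dual_grade_def dual_carr_def\<close>)
    then show "\<phi> \<in> {0}" by auto
  qed (auto simp: dual_grade_def cvec.subspace_0[OF sub])
  show "dual_carr (carr M) = {\<phi> + \<psi> |\<phi> \<psi>. \<phi> \<in> dual_grade (carr M) (grade M) False \<and>
      \<psi> \<in> dual_grade (carr M) (grade M) True}" (is "_ = ?R")
  proof (intro equalityI subsetI)
    fix \<phi> assume \<phi>: "\<phi> \<in> dual_carr (carr M)"
    then have lin: "clinear_on (carr M) \<phi>" and out: "\<And>v. v \<notin> carr M \<Longrightarrow> \<phi> v = 0"
      by (auto simp: dual_carr_def)
    \<comment> \<open>The components of a functional are its composites with the parity projections;
      the value 0 outside \<open>carr M\<close> is part of \<open>dual_carr\<close>.\<close>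
    define \<psi> where "\<psi> p v = (if v \<in> carr M then \<phi> (gproj (grade M) p v) else 0)" for p v
    have g: "gproj (grade M) p v \<in> carr M" if "v \<in> carr M" for p v
      using gproj_decomp(1)[OF superspace that] superspace_grade[OF superspace] by blast
    have "clinear_on (carr M) (\<lambda>v. \<phi> (gproj (grade M) p v))" for p
      by (rule clinear_on_compose[OF clinear_gproj[OF superspace] _ lin]) (use g in auto)
    then have "\<psi> p \<in> dual_carr (carr M)" for p
      using V by (auto simp: dual_carr_def \<psi>_def clinear_on_def cvec.subspace_add cvec.subspace_scale)
    moreover have "\<psi> p v = 0" if v: "v \<in> grade M (\<not> p)" for p v
      using gproj_homogeneous[OF superspace v, of p] clinear_on_0[OF lin cvec.subspace_0[OF V]]
      by (simp add: \<psi>_def)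
    ultimately have "\<psi> p \<in> dual_grade (carr M) (grade M) p" for p
      by (simp add: dual_grade_def)
    moreover have "\<phi> = \<psi> False + \<psi> True"
    proof
      fix v
      show "\<phi> v = (\<psi> False + \<psi> True) v"
        using clinear_on_addD[OF lin g g, of v v False True] gproj_decomp(2)[OF superspace, of v]
        by (cases "v \<in> carr M") (simp_all add: \<psi>_def out)
    qed
    ultimately show "\<phi> \<in> ?R" by blast
  next
    fix \<phi> assume "\<phi> \<in> ?R"
    then show "\<phi> \<in> dual_carr (carr M)" using sub by (auto simp: dual_grade_def cvec.subspace_add)
  qed
qed

text \<open>\<open>f b\<close> and the dual vector of \<open>b\<close> both have the parity of
  \<open>b\<close>, since \<open>f\<close> is even. The braiding therefore contributes
  \<open>(-1)^(|b||b|) = (-1)^|b|\<close>, the sign of the supertrace.\<close>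

lemma cat_trace_coord:
  assumes f: "clinear_on (carr M) f" "\<And>p. f ` grade M p \<subseteq> grade M p"
  shows "cat_trace M f = (\<Sum>b\<in>hbasis M. psgn True (parity M b) * coord M b (f b))"
proof -
  let ?V = "carr M" and ?D = "dual_carr (carr M)" and ?\<beta> = "coord M"
  let ?g = "gproj (grade M)" and ?dg = "gproj (dual_grade (carr M) (grade M))"
  note V = subspace_carr and D = superspace_subspace[OF superspace_dual]
  have dual: "?\<beta> b \<in> ?D" for b
    using coord_linear coord_outside by (simp add: dual_carr_def)
  have dual_gr: "?\<beta> b \<in> dual_grade (carr M) (grade M) (parity M b)" if b: "b \<in> hbasis M" for b
    using coord_parity[OF _ b] dual by (auto simp: dual_grade_def)
  have fb: "f b \<in> grade M (parity M b)" if "b \<in> hbasis M" for b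
    using f(2) hbasis_grade[OF that] by blast
  have fbV: "f b \<in> carr M" if "b \<in> hbasis M" for b
    using fb[OF that] superspace_grade[OF superspace] by blast
  have coev: "coev M = (\<Sum>b\<in>hbasis M. b \<otimes>\<^sub>C ?\<beta> b)"
    by (simp add: coev_def coord_def[abs_def] Let_def flip: hbasis_def)
  have "tmap ?V ?D f id (coev M) = (\<Sum>b\<in>hbasis M. f b \<otimes>\<^sub>C ?\<beta> b)"
    unfolding coev tmap_def
    by (subst tlift_sum[OF V D tmap_bilinear[OF f(1) clinear_on_id]]) (simp_all add: hbasis_carr dual)
  also have "braiding ?V (grade M) ?D (dual_grade ?V (grade M)) \<dots> =
      (\<Sum>b\<in>hbasis M. \<Sum>p\<in>UNIV. \<Sum>q\<in>UNIV. psgn p q *\<^sub>C (?dg q (?\<beta> b) \<otimes>\<^sub>C ?g p (f b)))"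
    unfolding braiding_def
  proof (rule tlift_sum[OF V D])
    show "cbilinear_on ?V ?D (\<lambda>v w. \<Sum>p\<in>UNIV. \<Sum>q\<in>UNIV. psgn p q *\<^sub>C (?dg q w \<otimes>\<^sub>C ?g p v))"
    proof (rule cbilinear_onI)
      fix w show "clinear_on ?V (\<lambda>v. \<Sum>p\<in>UNIV. \<Sum>q\<in>UNIV. psgn p q *\<^sub>C (?dg q w \<otimes>\<^sub>C ?g p v))"
        by (intro clinear_on_sum_fun clinear_on_scale
            clinear_on_compose[OF clinear_gproj[OF superspace] _ clinear_tens_right[of UNIV]]) simp
    next
      fix v show "clinear_on ?D (\<lambda>w. \<Sum>p\<in>UNIV. \<Sum>q\<in>UNIV. psgn p q *\<^sub>C (?dg q w \<otimes>\<^sub>C ?g p v))"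
        by (intro clinear_on_sum_fun clinear_on_scale
            clinear_on_compose[OF clinear_gproj[OF superspace_dual] _ clinear_tens_left[of UNIV]]) simp
    qed
  qed (simp_all add: fbV dual)
  also have "\<dots> = (\<Sum>b\<in>hbasis M. ?\<beta> b \<otimes>\<^sub>C (psgn True (parity M b) *\<^sub>C f b))"
  proof (intro sum.cong refl)
    fix b assume b: "b \<in> hbasis M"
    show "(\<Sum>p\<in>UNIV. \<Sum>q\<in>UNIV. psgn p q *\<^sub>C (?dg q (?\<beta> b) \<otimes>\<^sub>C ?g p (f b))) =
        ?\<beta> b \<otimes>\<^sub>C (psgn True (parity M b) *\<^sub>C f b)"
      by (cases "parity M b") (simp_all add: UNIV_bool gproj_homogeneous[OF superspace fb[OF b]]
          gproj_homogeneous[OF superspace_dual dual_gr[OF b]] tens_scale_right scaleC_one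
          del: cvec.scale_minus_left)
  qed
  also have "evaluation ?V \<dots> = (\<Sum>b\<in>hbasis M. ?\<beta> b (psgn True (parity M b) *\<^sub>C f b))"
    unfolding evaluation_def
  proof (rule tlift_sum[OF D V])
    show "cbilinear_on ?D ?V (\<lambda>\<phi> v. \<phi> v)"
      by (auto simp: cbilinear_on_def dual_carr_def clinear_on_def)
  qed (simp_all add: fbV dual cvec.subspace_scale[OF V])
  also have "\<dots> = (\<Sum>b\<in>hbasis M. psgn True (parity M b) * ?\<beta> b (f b))"
    by (intro sum.cong refl) (simp add: clinear_on_scaleD[OF coord_linear fbV] del: cvec.scale_minus_left)
  finally show ?thesis unfolding cat_trace_def .
qed

end

section \<open>Morphisms as matrices\<close>

lemma module_hom_linear: "f \<in> module_hom M N \<Longrightarrow> clinear_on (carr M) f"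
  and module_hom_grade: "f \<in> module_hom M N \<Longrightarrow> f ` grade M p \<subseteq> grade N p"
  and module_hom_coact: "f \<in> module_hom M N \<Longrightarrow> v \<in> carr M \<Longrightarrow>
    coact N (f v) = tmap (carr M) UNIV f id (coact M v)"
  and module_hom_outside: "f \<in> module_hom M N \<Longrightarrow> v \<notin> carr M \<Longrightarrow> f v = 0"
  by (simp_all add: module_hom_def)

definition hom_matrix :: "('v::complex_vector, 'a::complex_vector) supermodule \<Rightarrow> ('v \<Rightarrow> 'v) \<Rightarrow> 'v \<Rightarrow> 'v \<Rightarrow> complex" where
  "hom_matrix N f p j = coord N p (f j)"

locale fd_pair = M: fd_supermodule M + N: fd_supermodule N
  for M N :: "('v::complex_vector, 'a::complex_vector) supermodule"
begin

lemma module_hom_carr: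
  assumes "f \<in> module_hom M N" "v \<in> carr M"
  shows "f v \<in> carr N"
proof -
  have "f (gproj (grade M) p v) \<in> carr N" "gproj (grade M) p v \<in> carr M" for p
    using gproj_decomp(1)[OF M.superspace assms(2), of p] module_hom_grade[OF assms(1), of p]
      superspace_grade[OF N.superspace, of p] superspace_grade[OF M.superspace, of p] by blast+
  then have "f (gproj (grade M) False v + gproj (grade M) True v) \<in> carr N"
    using clinear_on_addD[OF module_hom_linear[OF assms(1)]] by (simp add: cvec.subspace_add[OF N.subspace_carr])
  then show ?thesis by (simp flip: gproj_decomp(2)[OF M.superspace assms(2)])
qed

lemma hom_matrix_even:
  assumes "f \<in> module_hom M N"
  shows "even_matrix (hbasis N) (parity N) (hbasis M) (parity M) (hom_matrix N f)"
  unfolding even_matrix_def hom_matrix_def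
  using module_hom_grade[OF assms] M.hbasis_grade N.coord_parity by blast

text \<open>The coaction of \<open>f j\<close> computed in two ways, by equivariance of
  \<open>f\<close> and by expanding \<open>f j\<close> in the basis of N, compared at each basis
  vector.\<close>

lemma hom_matrix_intertwines:
  assumes f: "f \<in> module_hom M N"
  shows "intertwines (hbasis N) (coef N) (hbasis M) (coef M) (hom_matrix N f)"
  unfolding intertwines_def
proof (intro ballI)
  fix p j assume p: "p \<in> hbasis N" and j: "j \<in> hbasis M"
  note jM = M.hbasis_carr[OF j]
  note fN = module_hom_carr[OF f]
  have "coact N (f j) = (\<Sum>i\<in>hbasis M. f i \<otimes>\<^sub>C coef M i j)"
    using module_hom_coact[OF f jM] M.tmap_coact[OF module_hom_linear[OF f] clinear_on_id jM] by simp
  also have "\<dots> = (\<Sum>i\<in>hbasis M. (\<Sum>p\<in>hbasis N. hom_matrix N f p i *\<^sub>C p) \<otimes>\<^sub>C coef M i j)"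
    unfolding hom_matrix_def
    by (intro sum.cong refl) (simp add: fN M.hbasis_carr flip: N.coord_expansion)
  also have "\<dots> = (\<Sum>p\<in>hbasis N. p \<otimes>\<^sub>C (\<Sum>i\<in>hbasis M. hom_matrix N f p i *\<^sub>C coef M i j))"
    by (simp add: tens_sum_left tens_sum_right tens_scale_left tens_scale_right) (rule sum.swap)
  finally have "coef N p (f j) = (\<Sum>i\<in>hbasis M. hom_matrix N f p i *\<^sub>C coef M i j)"
    by (rule N.coact_coef_unique[OF fN[OF jM] _ p])
  then show "(\<Sum>q\<in>hbasis N. hom_matrix N f q j *\<^sub>C coef N p q) = (\<Sum>i\<in>hbasis M. hom_matrix N f p i *\<^sub>C coef M i j)"
    using N.coef_expansion[OF fN[OF jM], of p] by (simp add: hom_matrix_def)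
qed

text \<open>The converse of the two preceding lemmas; it turns the averaged matrix back into a
  morphism of G-modules.\<close>

lemma matrix_hom:
  assumes F: "even_matrix (hbasis N) (parity N) (hbasis M) (parity M) F"
    "intertwines (hbasis N) (coef N) (hbasis M) (coef M) F"
  obtains f where "f \<in> module_hom M N" "\<And>p j. p \<in> hbasis N \<Longrightarrow> j \<in> hbasis M \<Longrightarrow> hom_matrix N f p j = F p j"
proof -
  define \<phi> where "\<phi> v = (\<Sum>j\<in>hbasis M. \<Sum>p\<in>hbasis N. coord M j v *\<^sub>C (F p j *\<^sub>C p))" for v
  define f where "f v = (if v \<in> carr M then \<phi> v else 0)" for v
  have \<phi>_lin: "clinear_on (carr M) \<phi>"
    unfolding \<phi>_def by (intro clinear_on_sum_fun clinear_on_const_scale M.coord_linear)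
  then have f_lin: "clinear_on (carr M) f"
    using M.subspace_carr by (simp add: clinear_on_def f_def cvec.subspace_add cvec.subspace_scale)
  have f_basis: "f j = (\<Sum>p\<in>hbasis N. F p j *\<^sub>C p)" if j: "j \<in> hbasis M" for j
  proof -
    have "f j = (\<Sum>i\<in>hbasis M. if i = j then \<Sum>p\<in>hbasis N. F p i *\<^sub>C p else 0)"
      unfolding f_def \<phi>_def using M.hbasis_carr[OF j]
      by (auto simp: M.coord_hbasis[OF j] scaleC_one intro!: sum.cong)
    then show ?thesis using j M.finite_hbasis by simp
  qed
  have f_grade: "f v \<in> grade N p" if v: "v \<in> grade M p" for v p
  proof -
    have "\<phi> v \<in> grade N p"
      unfolding \<phi>_def
    proof (intro cvec.subspace_sum superspace_subspace_grade[OF N.superspace])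
      fix j q assume j: "j \<in> hbasis M" and q: "q \<in> hbasis N"
      show "coord M j v *\<^sub>C (F q j *\<^sub>C q) \<in> grade N p"
      proof (cases "parity M j = p \<and> parity N q = p")
        case True
        then have "q \<in> grade N p" using N.hbasis_grade[OF q] by simp
        then show ?thesis by (intro cvec.subspace_scale superspace_subspace_grade[OF N.superspace])
      next
        case False
        then have "coord M j v = 0 \<or> F q j = 0"
          using M.coord_parity[OF v j] F(1) j q by (auto simp: even_matrix_def)
        then show ?thesis
          using cvec.subspace_0[OF superspace_subspace_grade[OF N.superspace]] by auto
      qed
    qed
    then show ?thesis using v superspace_grade[OF M.superspace] by (auto simp: f_def)
  qed
  have f_carr: "f j \<in> carr N" if "j \<in> hbasis M" for j
    using f_grade[OF M.hbasis_grade[OF that]] superspace_grade[OF N.superspace] by blast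
  have f_coord: "coord N p (f j) = F p j" if p: "p \<in> hbasis N" and j: "j \<in> hbasis M" for p j
  proof -
    have "coord N p (f j) = (\<Sum>q\<in>hbasis N. if p = q then F q j else 0)"
      unfolding f_basis[OF j]
      by (subst clinear_on_sum[OF N.coord_linear N.subspace_carr])
        (auto simp: N.hbasis_carr cvec.subspace_scale[OF N.subspace_carr] N.coord_hbasis
          clinear_on_scaleD[OF N.coord_linear] intro!: sum.cong)
    then show ?thesis using p N.finite_hbasis by simp
  qed
  have f_out: "f v = 0" if "v \<notin> carr M" for v
    using that by (simp add: f_def)
  have f_in: "f v \<in> carr N" if "v \<in> carr M" for v
  proof -
    have "\<phi> v \<in> carr N"
      unfolding \<phi>_def
      by (intro cvec.subspace_sum[OF N.subspace_carr] cvec.subspace_scale[OF N.subspace_carr])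
        (rule N.hbasis_carr)
    then show ?thesis using that by (simp add: f_def)
  qed
  have f_coact: "coact N (f v) = tmap (carr M) UNIV f id (coact M v)" if v: "v \<in> carr M" for v
  proof (rule M.hbasis_ext[OF _ _ _ v, of "\<lambda>v. coact N (f v)" "\<lambda>v. tmap (carr M) UNIV f id (coact M v)"])
    show "clinear_on (carr M) (\<lambda>v. coact N (f v))"
      by (rule clinear_on_compose[OF f_lin _ N.coact_linear]) (use f_in in auto)
    show "clinear_on (carr M) (\<lambda>v. tmap (carr M) UNIV f id (coact M v))"
      unfolding tmap_def
      by (rule clinear_on_compose[OF M.coact_linear _ tlift_clinear[OF M.subspace_carr cvec.subspace_UNIV
            tmap_bilinear[OF f_lin clinear_on_id]]]) (use M.coact_in in auto)
    fix j assume j: "j \<in> hbasis M"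
    have "coact N (f j) = (\<Sum>p\<in>hbasis N. p \<otimes>\<^sub>C (\<Sum>q\<in>hbasis N. F q j *\<^sub>C coef N p q))"
      unfolding N.coact_coef[OF f_carr[OF j]]
      by (intro sum.cong refl) (simp add: N.coef_expansion[OF f_carr[OF j]] f_coord[OF _ j])
    also have "\<dots> = (\<Sum>p\<in>hbasis N. p \<otimes>\<^sub>C (\<Sum>i\<in>hbasis M. F p i *\<^sub>C coef M i j))"
      using F(2) j by (intro sum.cong refl) (simp add: intertwines_def)
    also have "\<dots> = (\<Sum>i\<in>hbasis M. f i \<otimes>\<^sub>C coef M i j)"
      by (simp add: f_basis tens_sum_left tens_sum_right tens_scale_left tens_scale_right) (rule sum.swap)
    also have "\<dots> = tmap (carr M) UNIV f id (coact M j)"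
      by (simp add: M.tmap_coact[OF f_lin clinear_on_id M.hbasis_carr[OF j]])
    finally show "coact N (f j) = tmap (carr M) UNIV f id (coact M j)" .
  qed
  have "f \<in> module_hom M N"
    unfolding module_hom_def using f_lin f_grade f_coact f_out by blast
  then show ?thesis using that f_coord by (simp add: hom_matrix_def)
qed

end

section \<open>The trace pairing and the congruence of negligible morphisms\<close>

lemma module_hom_comp:
  fixes L M N :: "('v::complex_vector, 'a::complex_vector) supermodule"
  assumes "fd_supermodule L" "fd_supermodule M" "fd_supermodule N"
    and f: "f \<in> module_hom L M" and g: "g \<in> module_hom M N"
  shows "g \<circ> f \<in> module_hom L N"
proof -
  interpret LM: fd_pair L M using assms by (simp add: fd_pair_def)
  interpret MN: fd_pair M N using assms by (simp add: fd_pair_def)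
  note fM = LM.module_hom_carr[OF f]
  note f_lin = module_hom_linear[OF f] and g_lin = module_hom_linear[OF g]
  have gf_lin: "clinear_on (carr L) (\<lambda>v. g (f v))"
    by (rule clinear_on_compose[OF f_lin _ g_lin]) (use fM in auto)
  have "coact N (g (f v)) = tmap (carr L) UNIV (\<lambda>v. g (f v)) id (coact L v)" if v: "v \<in> carr L" for v
  proof -
    have "coact N (g (f v)) = tmap (carr M) UNIV g id (\<Sum>b\<in>hbasis L. f b \<otimes>\<^sub>C coef L b v)"
      using module_hom_coact[OF g fM[OF v]] module_hom_coact[OF f v]
        LM.M.tmap_coact[OF f_lin clinear_on_id v] by simp
    also have "\<dots> = (\<Sum>b\<in>hbasis L. g (f b) \<otimes>\<^sub>C coef L b v)"
      by (subst tmap_sum[OF LM.N.subspace_carr g_lin clinear_on_id]) (simp_all add: fM LM.M.hbasis_carr)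
    finally show ?thesis by (simp add: LM.M.tmap_coact[OF gf_lin clinear_on_id v])
  qed
  \<comment> \<open>Outside \<open>carr L\<close> the map \<open>f\<close> is 0, and the composite
    has to be 0 there too.\<close>
  moreover have "g 0 = 0" by (rule clinear_on_0[OF g_lin cvec.subspace_0[OF LM.N.subspace_carr]])
  ultimately show ?thesis
    using gf_lin module_hom_grade[OF f] module_hom_grade[OF g] module_hom_outside[OF f]
    unfolding module_hom_def by (auto simp: comp_def) blast
qed

lemma module_hom_ident:
  assumes "fd_supermodule M"
  shows "(\<lambda>v. if v \<in> carr M then v else 0) \<in> module_hom M M"
proof -
  interpret fd_supermodule M by fact
  let ?i = "\<lambda>v. if v \<in> carr M then v else 0"
  have lin: "clinear_on (carr M) ?i"
    using subspace_carr by (simp add: clinear_on_def cvec.subspace_add cvec.subspace_scale)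
  have "coact M v = tmap (carr M) UNIV ?i id (coact M v)" if v: "v \<in> carr M" for v
  proof -
    have "tmap (carr M) UNIV ?i id (coact M v) = (\<Sum>b\<in>hbasis M. b \<otimes>\<^sub>C coef M b v)"
      unfolding tmap_coact[OF lin clinear_on_id v] by (intro sum.cong refl) (simp add: hbasis_carr)
    then show ?thesis by (simp add: coact_coef[OF v])
  qed
  then show ?thesis
    using lin superspace_grade[OF superspace] unfolding module_hom_def by auto
qed

lemma module_hom_diff:
  fixes M N :: "('v::complex_vector, 'a::complex_vector) supermodule"
  assumes "fd_supermodule M" "fd_supermodule N" and f: "f \<in> module_hom M N" and g: "g \<in> module_hom M N"
  shows "(\<lambda>v. f v - g v) \<in> module_hom M N"
proof -
  interpret fd_pair M N using assms by (simp add: fd_pair_def)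
  note lin = module_hom_linear[OF f] module_hom_linear[OF g]
  have "coact N (f v - g v) = tmap (carr M) UNIV (\<lambda>v. f v - g v) id (coact M v)" if v: "v \<in> carr M" for v
    by (simp add: M.tmap_coact[OF clinear_on_diff[OF lin] clinear_on_id v] tens_diff_left sum_subtractf
        clinear_on_diffD[OF N.coact_linear N.subspace_carr] module_hom_carr[OF f v] module_hom_carr[OF g v]
        module_hom_coact[OF f v] module_hom_coact[OF g v] M.tmap_coact[OF lin(1) clinear_on_id v]
        M.tmap_coact[OF lin(2) clinear_on_id v])
  moreover have "f v - g v \<in> grade N p" if "v \<in> grade M p" for v p
    using module_hom_grade[OF f, of p] module_hom_grade[OF g, of p] that
    by (intro cvec.subspace_diff superspace_subspace_grade[OF N.superspace]) auto
  ultimately show ?thesis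
    using clinear_on_diff[OF lin] module_hom_outside[OF f] module_hom_outside[OF g]
    by (auto simp: module_hom_def)
qed

context fd_pair
begin

lemma cat_trace_comp:
  assumes f: "f \<in> module_hom M N" and g: "g \<in> module_hom N M"
  shows "cat_trace N (f \<circ> g) = (\<Sum>p\<in>hbasis N. \<Sum>j\<in>hbasis M.
    psgn True (parity N p) * hom_matrix M g j p * hom_matrix N f p j)"
proof -
  interpret NM: fd_pair N M by unfold_locales
  have fg: "f \<circ> g \<in> module_hom N N"
    by (rule module_hom_comp[OF N.fd_supermodule_axioms M.fd_supermodule_axioms N.fd_supermodule_axioms g f])
  have "coord N p (f (g p)) = (\<Sum>j\<in>hbasis M. hom_matrix M g j p * hom_matrix N f p j)" if p: "p \<in> hbasis N" for p
  proof -
    have lin: "clinear_on (carr M) (\<lambda>v. coord N p (f v))"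
      by (rule clinear_on_compose[OF module_hom_linear[OF f] _ N.coord_linear]) (use module_hom_carr[OF f] in auto)
    have "coord N p (f (g p)) = coord N p (f (\<Sum>j\<in>hbasis M. coord M j (g p) *\<^sub>C j))"
      using M.coord_expansion[OF NM.module_hom_carr[OF g N.hbasis_carr[OF p]]] by simp
    also have "\<dots> = (\<Sum>j\<in>hbasis M. coord M j (g p) *\<^sub>C coord N p (f j))"
      by (subst clinear_on_sum[OF lin M.subspace_carr])
        (simp_all add: cvec.subspace_scale[OF M.subspace_carr] M.hbasis_carr clinear_on_scaleD[OF lin]
          del: scaleC_complex_def)
    finally show ?thesis by (simp add: hom_matrix_def)
  qed
  then show ?thesis
    by (simp add: N.cat_trace_coord[OF module_hom_linear[OF fg] module_hom_grade[OF fg]]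
        sum_distrib_left mult.assoc)
qed

text \<open>A nonzero entry of the matrix of \<open>f\<close> joins basis vectors of equal parity,
  so the sign may be read off on either side.\<close>

lemma cat_trace_comm:
  assumes f: "f \<in> module_hom M N" and g: "g \<in> module_hom N M"
  shows "cat_trace N (f \<circ> g) = cat_trace M (g \<circ> f)"
proof -
  interpret NM: fd_pair N M by unfold_locales
  have "cat_trace N (f \<circ> g) = (\<Sum>j\<in>hbasis M. \<Sum>p\<in>hbasis N.
      psgn True (parity N p) * hom_matrix M g j p * hom_matrix N f p j)"
    unfolding cat_trace_comp[OF f g] by (rule sum.swap)
  also have "\<dots> = (\<Sum>j\<in>hbasis M. \<Sum>p\<in>hbasis N.
      psgn True (parity M j) * hom_matrix N f p j * hom_matrix M g j p)"
  proof (intro sum.cong refl)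
    fix j p assume "j \<in> hbasis M" "p \<in> hbasis N"
    then have "parity N p = parity M j \<or> hom_matrix N f p j = 0"
      using hom_matrix_even[OF f] by (auto simp: even_matrix_def)
    then show "psgn True (parity N p) * hom_matrix M g j p * hom_matrix N f p j =
        psgn True (parity M j) * hom_matrix N f p j * hom_matrix M g j p" by auto
  qed
  also have "\<dots> = cat_trace M (g \<circ> f)" by (rule NM.cat_trace_comp[OF g f, symmetric])
  finally show ?thesis .
qed

lemma cat_trace_diff:
  assumes f: "f \<in> module_hom M N" and f': "f' \<in> module_hom M N" and g: "g \<in> module_hom N M"
  shows "cat_trace N ((\<lambda>v. f v - f' v) \<circ> g) = cat_trace N (f \<circ> g) - cat_trace N (f' \<circ> g)"
proof -
  have d: "(\<lambda>v. f v - f' v) \<in> module_hom M N"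
    by (rule module_hom_diff[OF M.fd_supermodule_axioms N.fd_supermodule_axioms f f'])
  have "hom_matrix N (\<lambda>v. f v - f' v) p j = hom_matrix N f p j - hom_matrix N f' p j"
    if "j \<in> hbasis M" for p j
    using module_hom_carr[OF f] module_hom_carr[OF f'] M.hbasis_carr[OF that]
    by (simp add: hom_matrix_def clinear_on_diffD[OF N.coord_linear N.subspace_carr])
  then show ?thesis
    by (simp add: cat_trace_comp d f f' g right_diff_distrib sum_subtractf)
qed

text \<open>By linearity of the trace, congruence means having the same traces against all test
  morphisms. In this form the equivalence properties are immediate.\<close>

lemma negligible_rel_iff:
  "(f, f') \<in> negligible_rel M N \<longleftrightarrow> f \<in> module_hom M N \<and> f' \<in> module_hom M N \<and>
    (\<forall>g\<in>module_hom N M. cat_trace N (f \<circ> g) = cat_trace N (f' \<circ> g))"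
  using module_hom_diff[OF M.fd_supermodule_axioms N.fd_supermodule_axioms]
  by (auto simp: negligible_rel_def negligible_mor_def cat_trace_diff)

lemma negligible_equiv: "equiv (module_hom M N) (negligible_rel M N)"
  by (rule equivI) (auto simp: refl_on_def sym_def trans_def negligible_rel_iff)

end

text \<open>Cyclicity of the trace lets either factor face a test morphism:
  \<open>f \<circ> h\<close> serves as test for \<open>g\<close>, and \<open>h \<circ> g'\<close> as
  test for \<open>f\<close>.\<close>

lemma negligible_rel_comp:
  assumes L: "fd_supermodule L" and M: "fd_supermodule M" and N: "fd_supermodule N"
    and f: "(f, f') \<in> negligible_rel L M" and g: "(g, g') \<in> negligible_rel M N"
  shows "(g \<circ> f, g' \<circ> f') \<in> negligible_rel L N"
proof -
  interpret LM: fd_pair L M using L M by (simp add: fd_pair_def)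
  interpret MN: fd_pair M N using M N by (simp add: fd_pair_def)
  interpret LN: fd_pair L N using L N by (simp add: fd_pair_def)
  have f': "f \<in> module_hom L M" "f' \<in> module_hom L M"
    and eqf: "\<And>h. h \<in> module_hom M L \<Longrightarrow> cat_trace M (f \<circ> h) = cat_trace M (f' \<circ> h)"
    using f by (auto simp: LM.negligible_rel_iff)
  have g': "g \<in> module_hom M N" "g' \<in> module_hom M N"
    and eqg: "\<And>h. h \<in> module_hom N M \<Longrightarrow> cat_trace N (g \<circ> h) = cat_trace N (g' \<circ> h)"
    using g by (auto simp: MN.negligible_rel_iff)
  have "cat_trace N ((g \<circ> f) \<circ> h) = cat_trace N ((g' \<circ> f') \<circ> h)" if h: "h \<in> module_hom N L" for h
  proof -
    have fh: "f \<circ> h \<in> module_hom N M" "f' \<circ> h \<in> module_hom N M"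
      by (rule module_hom_comp[OF N L M h f'(1)] module_hom_comp[OF N L M h f'(2)])+
    have hg: "h \<circ> g' \<in> module_hom M L" by (rule module_hom_comp[OF M N L g'(2) h])
    have "cat_trace N (g \<circ> (f \<circ> h)) = cat_trace N (g' \<circ> (f \<circ> h))" by (rule eqg[OF fh(1)])
    also have "\<dots> = cat_trace M (f \<circ> (h \<circ> g'))"
      using MN.cat_trace_comm[OF g'(2) fh(1)] by (simp add: o_assoc)
    also have "\<dots> = cat_trace M (f' \<circ> (h \<circ> g'))" by (rule eqf[OF hg])
    also have "\<dots> = cat_trace N (g' \<circ> (f' \<circ> h))"
      using MN.cat_trace_comm[OF g'(2) fh(2)] by (simp add: o_assoc)
    finally show ?thesis by (simp add: o_assoc)
  qed
  then show ?thesis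
    using module_hom_comp[OF L M N] f' g' by (simp add: LN.negligible_rel_iff)
qed

lemma g_module_fd_supermodule:
  assumes "g_module G M" "finite_dim M"
  shows "fd_supermodule M"
  using assms coact_tensor_space[OF assms(1)] by unfold_locales (auto simp: g_module_def)

section \<open>Matrix coefficients of a module\<close>

context affine_supergroup
begin

text \<open>The comodule axioms read in coordinates: coassociativity and the counit axiom are
  compared at each basis vector, and \<open>coef_part\<close> holds because extracting the
  coordinate at \<open>k\<close> retains only left factors of the parity of
  \<open>k\<close>.\<close>

lemma
  assumes M: "g_module G M" and fd: "finite_dim M"
  shows comult_coef: "v \<in> carr M \<Longrightarrow> k \<in> hbasis M \<Longrightarrow>
      comult G (coef M k v) = (\<Sum>i\<in>hbasis M. coef M k i \<otimes>\<^sub>C coef M i v)"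
    and counit_coef: "v \<in> carr M \<Longrightarrow> k \<in> hbasis M \<Longrightarrow> counit G (coef M k v) = coord M k v"
    and coef_part: "v \<in> grade M p \<Longrightarrow> k \<in> hbasis M \<Longrightarrow> coef M k v \<in> part G (parity M k \<noteq> p)"
proof -
  interpret fd_supermodule M by (rule g_module_fd_supermodule[OF M fd])
  note V = subspace_carr
  {
    fix v k assume v: "v \<in> carr M" and k: "k \<in> hbasis M"
    have "tassoc (tmap (carr M) UNIV (coact M) id (coact M v)) = tmap (carr M) UNIV id (comult G) (coact M v)"
      using M v by (simp add: g_module_def)
    also have "\<dots> = (\<Sum>k\<in>hbasis M. k \<otimes>\<^sub>C comult G (coef M k v))"
      by (simp add: tmap_coact[OF clinear_on_id comult_linear v])
    also have "tassoc (tmap (carr M) UNIV (coact M) id (coact M v)) =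
        (\<Sum>i\<in>hbasis M. \<Sum>k\<in>hbasis M. k \<otimes>\<^sub>C (coef M k i \<otimes>\<^sub>C coef M i v))"
      by (simp add: tmap_coact[OF coact_linear clinear_on_id v] coact_coef[OF hbasis_carr] tens_sum_left
          clinear_sum[OF clinear_tassoc] tassoc_tens)
    also have "\<dots> = (\<Sum>k\<in>hbasis M. k \<otimes>\<^sub>C (\<Sum>i\<in>hbasis M. coef M k i \<otimes>\<^sub>C coef M i v))"
      by (subst sum.swap) (simp add: tens_sum_right)
    finally show "comult G (coef M k v) = (\<Sum>i\<in>hbasis M. coef M k i \<otimes>\<^sub>C coef M i v)"
      by (rule tens_hbasis_unique[where x = "\<lambda>k. comult G (coef M k v)" and
            y = "\<lambda>k. \<Sum>i\<in>hbasis M. coef M k i \<otimes>\<^sub>C coef M i v", OF sym k])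
    have "v = tlift (carr M) UNIV (\<lambda>u a. counit G a *\<^sub>C u) (coact M v)"
      using M v by (simp add: g_module_def)
    also have "\<dots> = (\<Sum>i\<in>hbasis M. counit G (coef M i v) *\<^sub>C i)"
      unfolding coact_coef[OF v]
      by (rule tlift_sum[OF V cvec.subspace_UNIV cbilinear_scale(2)[OF clinear_on_ident counit_linear]])
        (simp_all add: hbasis_carr)
    finally have "coord M k v = coord M k (\<Sum>i\<in>hbasis M. counit G (coef M i v) *\<^sub>C i)" by simp
    also have "\<dots> = (\<Sum>i\<in>hbasis M. if k = i then counit G (coef M i v) else 0)"
      by (subst clinear_on_sum[OF coord_linear V])
        (auto simp: cvec.subspace_scale[OF V] hbasis_carr clinear_on_scaleD[OF coord_linear] coord_hbasis
          intro!: sum.cong)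
    finally show "counit G (coef M k v) = coord M k v"
      using k finite_hbasis by simp
  }
  fix v p k assume v: "v \<in> grade M p" and k: "k \<in> hbasis M"
  let ?L = "tlift (carr M) UNIV (\<lambda>u a. coord M k u *\<^sub>C a)"
  have bil: "cbilinear_on (carr M) UNIV (\<lambda>u a. coord M k u *\<^sub>C (a::'a))"
    by (rule cbilinear_scale(1)[OF coord_linear clinear_on_ident])
  note L_lin = tlift_clinear[OF V cvec.subspace_UNIV bil]
  have sub: "cvec.subspace (tensor_space (carr M) (UNIV::'a set))" by (rule subspace_tensor_space)
  have "coact M ` grade M p \<subseteq> tensor_grade (grade M) (part G) p"
    using M by (simp add: g_module_def)
  with v have "coact M v \<in> tensor_grade (grade M) (part G) p" by blast
  then have "coact M v \<in> tensor_space (carr M) UNIV \<and> ?L (coact M v) \<in> part G (parity M k \<noteq> p)"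
    unfolding tensor_grade_def
  proof (induction rule: cvec.span_induct_alt)
    case base
    show ?case
      using clinear_on_0[OF L_lin cvec.subspace_0[OF sub]]
      by (simp add: cvec.subspace_0[OF sub] cvec.subspace_0[OF subspace_part])
  next
    case (step z t t')
    then obtain u a q q' where t: "t = u \<otimes>\<^sub>C a" "u \<in> grade M q" "a \<in> part G q'" "(q \<noteq> q') = p" by auto
    have u: "u \<in> carr M" using t(2) superspace_grade[OF superspace] by blast
    have tt: "t \<in> tensor_space (carr M) UNIV" by (simp add: t(1) tens_in_tensor_space u)
    have "?L t = coord M k u *\<^sub>C a"
      unfolding t(1) by (rule tlift_tens[OF V cvec.subspace_UNIV bil u]) simp
    also have "\<dots> \<in> part G (parity M k \<noteq> p)"
    proof (cases "parity M k = q")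
      case True
      then have "(parity M k \<noteq> p) = q'" using t(4) by auto
      then show ?thesis using t(3) by (simp add: cvec.subspace_scale[OF subspace_part])
    next
      case False
      then show ?thesis
        using coord_parity[OF t(2) k] by (simp add: cvec.subspace_0[OF subspace_part])
    qed
    finally show ?case
      using step tt
      by (simp add: cvec.subspace_add[OF sub] cvec.subspace_scale[OF sub] clinear_on_addD[OF L_lin]
          clinear_on_scaleD[OF L_lin] cvec.subspace_add[OF subspace_part] cvec.subspace_scale[OF subspace_part])
  qed
  then show "coef M k v \<in> part G (parity M k \<noteq> p)" by (simp add: coef_def)
qed

lemma comatrix_coef:
  assumes M: "g_module G M" and fd: "finite_dim M"
  shows "comatrix G (hbasis M) (parity M) (coef M)"
proof -
  interpret fd_supermodule M by (rule g_module_fd_supermodule[OF M fd])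
  show ?thesis
    unfolding comatrix_def
  proof (intro conjI ballI)
    show "coef M i j \<in> part G (parity M i \<noteq> parity M j)" if "i \<in> hbasis M" "j \<in> hbasis M" for i j
      by (rule coef_part[OF M fd hbasis_grade[OF that(2)] that(1)])
  qed (simp_all add: finite_hbasis comult_coef[OF M fd hbasis_carr] counit_coef[OF M fd hbasis_carr] coord_hbasis)
qed

end

section \<open>Restriction and the semisimplifications\<close>

text \<open>The chosen basis, the coordinates and the trace depend only on the carrier and the
  grading. Hence a map has the same matrix and the same trace over G and over K, and only the supply
  of test morphisms changes.\<close>

lemma restrict_module_simps [simp]:
  "carr (restrict_module r M) = carr M" "grade (restrict_module r M) = grade M"
  "hbasis (restrict_module r M) = hbasis M" "parity (restrict_module r M) = parity M"
  "coord (restrict_module r M) = coord M" "finite_dim (restrict_module r M) = finite_dim M"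
  "hom_matrix (restrict_module r M) = hom_matrix M"
  "cat_trace (restrict_module r M) = cat_trace M"
  by (simp_all add: restrict_module_def hbasis_def parity_def[abs_def] coord_def[abs_def] finite_dim_def
      hom_matrix_def[abs_def] cat_trace_def[abs_def] coev_def)

context supergroup_pair
begin

context
  fixes M :: "('v::complex_vector, 'a) supermodule"
  assumes M: "g_module G M" and fd: "finite_dim M"
begin

interpretation fd_supermodule M by (rule g_module_fd_supermodule[OF M fd])

lemma coact_restrict: "v \<in> carr M \<Longrightarrow> coact (restrict_module r M) v = (\<Sum>b\<in>hbasis M. b \<otimes>\<^sub>C r (coef M b v))"
  by (simp add: restrict_module_def tmap_coact[OF clinear_on_id r_linear])

lemma coact_restrict_linear: "clinear_on (carr M) (coact (restrict_module r M))"
proof -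
  have "clinear_on (carr M) (\<lambda>v. tmap (carr M) UNIV id r (coact M v))"
    unfolding tmap_def
    by (rule clinear_on_compose[OF coact_linear _ tlift_clinear[OF subspace_carr cvec.subspace_UNIV
          tmap_bilinear[OF clinear_on_id r_linear]]]) (use coact_in in auto)
  then show ?thesis by (simp add: restrict_module_def)
qed

lemma fd_supermodule_restrict: "fd_supermodule (restrict_module r M)"
proof
  show "coact (restrict_module r M) v \<in> tensor_space (carr (restrict_module r M)) UNIV"
    if "v \<in> carr (restrict_module r M)" for v
    using that by (auto simp: coact_restrict intro!: cvec.subspace_sum[OF subspace_tensor_space]
        tens_in_tensor_space hbasis_carr)
qed (simp_all add: superspace fd coact_restrict_linear)

lemma coef_restrict:
  assumes "v \<in> carr M" "b \<in> hbasis M"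
  shows "coef (restrict_module r M) b v = r (coef M b v)"
  using fd_supermodule.coact_coef_unique[OF fd_supermodule_restrict] assms coact_restrict by simp

lemma g_module_restrict: "g_module K (restrict_module r M)"
  unfolding g_module_def restrict_module_simps
proof (intro conjI allI ballI)
  let ?c = "coact (restrict_module r M)"
  fix p
  show "?c ` grade M p \<subseteq> tensor_grade (grade M) (part K) p"
  proof (rule image_subsetI)
    fix v assume v: "v \<in> grade M p"
    have vc: "v \<in> carr M" using v superspace_grade[OF superspace] by blast
    show "?c v \<in> tensor_grade (grade M) (part K) p"
      unfolding coact_restrict[OF vc] tensor_grade_def
    proof (intro cvec.span_sum cvec.span_base)
      fix b assume b: "b \<in> hbasis M"
      have "r (coef M b v) \<in> part K (parity M b \<noteq> p)" by (rule r_part[OF coef_part[OF M fd v b]])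
      moreover have "(parity M b \<noteq> (parity M b \<noteq> p)) = p" by auto
      ultimately show "b \<otimes>\<^sub>C r (coef M b v) \<in>
          {v \<otimes>\<^sub>C w |v w q r. v \<in> grade M q \<and> w \<in> part K r \<and> (q \<noteq> r) = p}"
        using hbasis_grade[OF b] by blast
    qed
  qed
next
  let ?c = "coact (restrict_module r M)"
  have KL: "clinear_on UNIV (comult K)" "clinear_on UNIV (counit K)"
    using affine_supergroup.comult_linear affine_supergroup.counit_linear K by (auto simp: affine_supergroup_def)
  fix v assume v: "v \<in> carr M"
  have "tassoc (tmap (carr M) UNIV ?c id (?c v)) =
      (\<Sum>i\<in>hbasis M. \<Sum>k\<in>hbasis M. k \<otimes>\<^sub>C (r (coef M k i) \<otimes>\<^sub>C r (coef M i v)))"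
    unfolding coact_restrict[OF v]
    by (subst tmap_sum[OF subspace_carr coact_restrict_linear clinear_on_id hbasis_carr])
      (simp_all add: coact_restrict[OF hbasis_carr] tens_sum_left clinear_sum[OF clinear_tassoc] tassoc_tens)
  also have "\<dots> = (\<Sum>k\<in>hbasis M. k \<otimes>\<^sub>C comult K (r (coef M k v)))"
    by (subst sum.swap)
      (simp add: tens_sum_right r_comult comult_coef[OF M fd v] tmap_sum[OF cvec.subspace_UNIV r_linear r_linear])
  also have "\<dots> = tmap (carr M) UNIV id (comult K) (?c v)"
    unfolding coact_restrict[OF v]
    by (subst tmap_sum[OF subspace_carr clinear_on_id KL(1) hbasis_carr]) simp_all
  finally show "tassoc (tmap (carr M) UNIV ?c id (?c v)) = tmap (carr M) UNIV id (comult K) (?c v)" .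
  have "tlift (carr M) UNIV (\<lambda>u a. counit K a *\<^sub>C u) (?c v) = (\<Sum>b\<in>hbasis M. counit K (r (coef M b v)) *\<^sub>C b)"
    unfolding coact_restrict[OF v]
    by (rule tlift_sum[OF subspace_carr cvec.subspace_UNIV cbilinear_scale(2)[OF clinear_on_ident KL(2)]])
      (simp_all add: hbasis_carr)
  also have "\<dots> = v"
    by (simp add: r_counit counit_coef[OF M fd v] flip: coord_expansion[OF v])
  finally show "tlift (carr M) UNIV (\<lambda>u a. counit K a *\<^sub>C u) (?c v) = v" .
qed (use superspace coact_restrict_linear in auto)

end

lemma module_hom_restrict:
  fixes M N :: "('v::complex_vector, 'a) supermodule"
  assumes M: "g_module G M" "finite_dim M" and N: "g_module G N" "finite_dim N" and f: "f \<in> module_hom M N"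
  shows "f \<in> module_hom (restrict_module r M) (restrict_module r N)"
proof -
  interpret fd_pair M N
    using M N by (simp add: fd_pair_def g_module_fd_supermodule)
  interpret R: fd_pair "restrict_module r M" "restrict_module r N"
    using M N by (simp add: fd_pair_def fd_supermodule_restrict)
  have "coact (restrict_module r N) (f v) = tmap (carr M) UNIV f id (coact (restrict_module r M) v)"
    if v: "v \<in> carr M" for v
  proof -
    have "coact (restrict_module r N) (f v) = tmap (carr N) UNIV id r (\<Sum>b\<in>hbasis M. f b \<otimes>\<^sub>C coef M b v)"
      using module_hom_coact[OF f v] M.tmap_coact[OF module_hom_linear[OF f] clinear_on_id v]
      by (simp add: restrict_module_def)
    also have "\<dots> = (\<Sum>b\<in>hbasis M. f b \<otimes>\<^sub>C r (coef M b v))"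
      by (subst tmap_sum[OF N.subspace_carr clinear_on_id r_linear])
        (simp_all add: module_hom_carr[OF f] M.hbasis_carr)
    also have "\<dots> = tmap (carr M) UNIV f id (coact (restrict_module r M) v)"
      unfolding coact_restrict[OF M v]
      by (subst tmap_sum[OF M.subspace_carr module_hom_linear[OF f] clinear_on_id M.hbasis_carr]) simp_all
    finally show ?thesis .
  qed
  then show ?thesis
    using f by (auto simp: module_hom_def)
qed

end

section \<open>Approximating K-morphisms by G-morphisms\<close>

locale proper_splitting_pair = splitting_pair G K r s for G :: "'a::complex_algebra_1 supergroup"
  and K :: "'b::complex_algebra_1 supergroup" and r :: "'a \<Rightarrow> 'b" and s :: "'a \<Rightarrow> complex" +
  fixes x :: "'b \<Rightarrow> complex" and gr :: "bool \<Rightarrow> complex set"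
  assumes x: "x \<in> lie K True" and DS: "DS_iso (x \<circ> r) (induced_trivial G r) (UNIV :: complex set) gr"
begin

text \<open>The matrix \<open>favg\<close> is even and intertwines over G, so it is the matrix of
  some \<open>f'\<close>. By \<open>supertrace_favg\<close> it has the same traces as
  \<open>f\<close> against every K-morphism. This is fullness before passing to classes.\<close>

lemma equivariant_approximation:
  fixes M N :: "('v::complex_vector, 'a) supermodule"
  assumes M: "g_module G M" "finite_dim M" and N: "g_module G N" "finite_dim N"
    and f: "f \<in> module_hom (restrict_module r M) (restrict_module r N)"
  obtains f' where "f' \<in> module_hom M N"
    "(f', f) \<in> negligible_rel (restrict_module r M) (restrict_module r N)"
proof -
  interpret fd_pair M N
    using M N by (simp add: fd_pair_def g_module_fd_supermodule)
  interpret R: fd_pair "restrict_module r M" "restrict_module r N"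
    using M N by (simp add: fd_pair_def fd_supermodule_restrict)
  interpret R': fd_pair "restrict_module r N" "restrict_module r M" by unfold_locales
  \<comment> \<open>Stated for arbitrary modules because it is needed from M to N for
    \<open>f\<close> and from N to M for the test morphisms.\<close>
  have restr: "intertwines (hbasis Y) (coef (restrict_module r Y)) (hbasis X) (coef (restrict_module r X)) H \<longleftrightarrow>
      intertwines (hbasis Y) (\<lambda>p q. r (coef Y p q)) (hbasis X) (\<lambda>i j. r (coef X i j)) H"
    if "g_module G X" "finite_dim X" "g_module G Y" "finite_dim Y" for X Y :: "('v, 'a) supermodule" and H
    using that by (simp add: intertwines_def coef_restrict
        fd_supermodule.hbasis_carr[OF g_module_fd_supermodule])
  interpret A: averaging_pair G K r s "hbasis N" "parity N" "coef N" "hbasis M" "parity M" "coef M" "hom_matrix N f"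
  proof
    show "comatrix G (hbasis N) (parity N) (coef N)" "comatrix G (hbasis M) (parity M) (coef M)"
      by (rule comatrix_coef[OF N] comatrix_coef[OF M])+
    show "even_matrix (hbasis N) (parity N) (hbasis M) (parity M) (hom_matrix N f)"
      using R.hom_matrix_even[OF f] by simp
    show "intertwines (hbasis N) (\<lambda>p q. r (coef N p q)) (hbasis M) (\<lambda>i j. r (coef M i j)) (hom_matrix N f)"
      using R.hom_matrix_intertwines[OF f] restr[OF M N] by simp
  qed
  obtain f' where f': "f' \<in> module_hom M N"
    and eq: "\<And>p j. p \<in> hbasis N \<Longrightarrow> j \<in> hbasis M \<Longrightarrow> hom_matrix N f' p j = A.favg p j"
    using matrix_hom[OF A.favg_even A.favg_intertwines] by metis
  have f'_R: "f' \<in> module_hom (restrict_module r M) (restrict_module r N)"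
    by (rule module_hom_restrict[OF M N f'])
  have "cat_trace N (f' \<circ> h) = cat_trace N (f \<circ> h)"
    if h: "h \<in> module_hom (restrict_module r N) (restrict_module r M)" for h
  proof -
    have "(\<Sum>p\<in>hbasis N. \<Sum>j\<in>hbasis M. psgn True (parity N p) * hom_matrix M h j p * A.favg p j) =
        (\<Sum>p\<in>hbasis N. \<Sum>j\<in>hbasis M. psgn True (parity N p) * hom_matrix M h j p * hom_matrix N f p j)"
      by (rule A.supertrace_favg[OF x DS])
        (use R'.hom_matrix_even[OF h] R'.hom_matrix_intertwines[OF h] restr[OF N M] in simp_all)
    then show ?thesis
      using R.cat_trace_comp[OF f h] R.cat_trace_comp[OF f'_R h] by (simp add: eq)
  qed
  then have "(f', f) \<in> negligible_rel (restrict_module r M) (restrict_module r N)"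
    using f f'_R by (simp add: R.negligible_rel_iff)
  then show ?thesis using that f' by blast
qed

text \<open>Over K there are more test morphisms. A test K-morphism \<open>h\<close> is congruent to
  a G-morphism \<open>h'\<close>, and by cyclicity \<open>h\<close> and \<open>h'\<close> have equal
  traces against \<open>f\<close> and against \<open>g\<close>.\<close>

lemma negligible_restrict:
  fixes M N :: "('v::complex_vector, 'a) supermodule"
  assumes M: "g_module G M" "finite_dim M" and N: "g_module G N" "finite_dim N"
    and fg: "(f, g) \<in> negligible_rel M N"
  shows "(f, g) \<in> negligible_rel (restrict_module r M) (restrict_module r N)"
proof -
  interpret fd_pair M N
    using M N by (simp add: fd_pair_def g_module_fd_supermodule)
  interpret NM: fd_pair N M by unfold_locales
  interpret R: fd_pair "restrict_module r M" "restrict_module r N"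
    using M N by (simp add: fd_pair_def fd_supermodule_restrict)
  interpret R': fd_pair "restrict_module r N" "restrict_module r M" by unfold_locales
  have f: "f \<in> module_hom M N" and g: "g \<in> module_hom M N"
    and tr: "\<And>h. h \<in> module_hom N M \<Longrightarrow> cat_trace N (f \<circ> h) = cat_trace N (g \<circ> h)"
    using fg by (auto simp: negligible_rel_iff)
  note fR = module_hom_restrict[OF M N f] and gR = module_hom_restrict[OF M N g]
  have "cat_trace N (f \<circ> h) = cat_trace N (g \<circ> h)"
    if h: "h \<in> module_hom (restrict_module r N) (restrict_module r M)" for h
  proof -
    obtain h' where h': "h' \<in> module_hom N M"
      and rel: "(h', h) \<in> negligible_rel (restrict_module r N) (restrict_module r M)"
      using equivariant_approximation[OF N M h] by metis
    have "cat_trace N (k \<circ> h) = cat_trace N (k \<circ> h')"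
      if k: "k \<in> module_hom (restrict_module r M) (restrict_module r N)" for k
      using rel k R.cat_trace_comm[OF k h] R.cat_trace_comm[OF k module_hom_restrict[OF N M h']]
      by (simp add: R'.negligible_rel_iff)
    then show ?thesis using tr[OF h'] fR gR by simp
  qed
  then show ?thesis using fR gR by (simp add: R.negligible_rel_iff)
qed

end

lemma proper_pair_splitting:
  assumes "proper_pair G K r"
  obtains s x gr where "proper_splitting_pair G K r s x gr"
proof -
  have G: "affine_algebraic_supergroup G" and K: "affine_algebraic_supergroup K" and r: "closed_subgroup G K r"
    using assms by (simp_all add: proper_pair_def splitting_subgroup_def quasireductive_def)
  interpret supergroup_pair G K r using G K r by unfold_locales
  obtain s0 where s0: "s0 \<in> module_hom (induced_trivial G r) trivial_module"
    and s0_unit: "\<And>c. s0 (induction_unit c) = c"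
    using assms by (auto simp: proper_pair_def splitting_subgroup_def)
  obtain x where x: "x \<in> homological K" and DS: "DS_iso (x \<circ> r) (induced_trivial G r)
      (carr (trivial_module :: (complex, 'a) supermodule)) (grade (trivial_module :: (complex, 'a) supermodule))"
    using assms by (auto simp: proper_pair_def)
  have s0_lin: "clinear_on invar s0"
    using module_hom_linear[OF s0] by (simp add: induced_trivial_simps)
  \<comment> \<open>The splitting is linear on the induced module only; it is extended to the whole
    coordinate ring.\<close>
  obtain s where s: "clinear_on UNIV s" and s_s0: "\<And>v. v \<in> invar \<Longrightarrow> s v = s0 v"
    using clinear_on_extend[OF subspace_invar s0_lin] by metis
  have "proper_splitting_pair G K r s x (grade (trivial_module :: (complex, 'a) supermodule))"
  proof
    show "clinear_on UNIV s" by (rule s)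
    have "1 \<in> invar"
      by (simp add: invar_def comult_one tmap_tens r_linear clinear_on_id clinear_on_ident r_one)
    then show "s 1 = 1" using s0_unit[of 1] by (simp add: s_s0 induction_unit_def scaleC_one)
    show "s y = 0" if "y \<in> invar_grade True" for y
      using module_hom_grade[OF s0, of True] that s_s0[of y]
      by (auto simp: induced_trivial_simps trivial_module_def image_subset_iff)
    show "tmap_all s id (comult G y) = s y \<otimes>\<^sub>C 1" if y: "y \<in> invar" for y
      using module_hom_coact[OF s0, of y] y s_s0
        tmap_on_eq_tmap_all[OF subspace_invar s0_lin clinear_on_id s _ comult_invar[OF y]]
      by (simp add: induced_trivial_simps trivial_module_def)
    show "x \<in> lie K True" using x by (simp add: homological_def)
    show "DS_iso (x \<circ> r) (induced_trivial G r) UNIV (grade (trivial_module :: (complex, 'a) supermodule))"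
      using DS by (simp add: trivial_module_def)
  qed
  then show ?thesis by (rule that)
qed

section \<open>Passage to the semisimplifications\<close>

text \<open>Composition in a quotient category and the induced functor are defined as unions over
  representatives. Compatibility with the congruence makes all members of the union equal;
  nonemptiness of \<open>C\<close> excludes the empty union.\<close>

lemma Union_class_eq:
  assumes "equiv A R" "\<And>f. f \<in> C \<Longrightarrow> (a, h f) \<in> R" "C \<noteq> {}"
  shows "(\<Union>f\<in>C. R `` {h f}) = R `` {a}"
proof -
  have "R `` {h f} = R `` {a}" if "f \<in> C" for f
    by (rule equiv_class_eq[OF assms(1) assms(2)[OF that], symmetric])
  then show ?thesis using assms(3) by auto
qed

lemma semisimplification_cmp:
  assumes "fd_supermodule L" "fd_supermodule M" "fd_supermodule N"
    and f: "f \<in> module_hom L M" and g: "g \<in> module_hom M N"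
  shows "cmp (semisimplification G) L M N (negligible_rel M N `` {g}) (negligible_rel L M `` {f}) =
    negligible_rel L N `` {g \<circ> f}"
proof -
  interpret LM: fd_pair L M using assms by (simp add: fd_pair_def)
  interpret MN: fd_pair M N using assms by (simp add: fd_pair_def)
  interpret LN: fd_pair L N using assms by (simp add: fd_pair_def)
  have ne: "negligible_rel L M `` {f} \<noteq> {}" "negligible_rel M N `` {g} \<noteq> {}"
    using equiv_class_self[OF LM.negligible_equiv f] equiv_class_self[OF MN.negligible_equiv g] by auto
  have "cmp (semisimplification G) L M N (negligible_rel M N `` {g}) (negligible_rel L M `` {f}) =
      (\<Union>g'\<in>negligible_rel M N `` {g}. \<Union>f'\<in>negligible_rel L M `` {f}. negligible_rel L N `` {g' \<circ> f'})"
    by (simp add: semisimplification_def quotient_category_def rep_category_def)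
  also have "\<dots> = (\<Union>g'\<in>negligible_rel M N `` {g}. negligible_rel L N `` {g \<circ> f})"
    by (intro SUP_cong refl Union_class_eq[OF LN.negligible_equiv _ ne(1)] negligible_rel_comp[OF assms(1-3)]) auto
  also have "\<dots> = negligible_rel L N `` {g \<circ> f}" using ne(2) by auto
  finally show ?thesis .
qed

context proper_splitting_pair
begin

lemma induced_functor_class:
  fixes M N :: "('v::complex_vector, 'a) supermodule"
  assumes M: "g_module G M" "finite_dim M" and N: "g_module G N" "finite_dim N" and f: "f \<in> module_hom M N"
  shows "on_mor (induced_functor negligible_rel (restriction_functor r)) M N (negligible_rel M N `` {f}) =
    negligible_rel (restrict_module r M) (restrict_module r N) `` {f}"
proof -
  interpret fd_pair M N
    using M N by (simp add: fd_pair_def g_module_fd_supermodule)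
  interpret R: fd_pair "restrict_module r M" "restrict_module r N"
    using M N by (simp add: fd_pair_def fd_supermodule_restrict)
  have "(\<Union>f'\<in>negligible_rel M N `` {f}. negligible_rel (restrict_module r M) (restrict_module r N) `` {f'}) =
      negligible_rel (restrict_module r M) (restrict_module r N) `` {f}"
    by (rule Union_class_eq[OF R.negligible_equiv])
      (use negligible_restrict[OF M N] equiv_class_self[OF negligible_equiv f] in auto)
  then show ?thesis by (simp add: induced_functor_def restriction_functor_def)
qed

lemma full_induced_functor:
  "full_functor
    (semisimplification G :: (('v::complex_vector, 'a) supermodule, ('v \<Rightarrow> 'v) set) category)
    (semisimplification K :: (('v, 'b) supermodule, ('v \<Rightarrow> 'v) set) category)
    (induced_functor negligible_rel (restriction_functor r))"
proof -
  let ?C = "semisimplification G :: (('v, 'a) supermodule, ('v \<Rightarrow> 'v) set) category"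
  let ?D = "semisimplification K :: (('v, 'b) supermodule, ('v \<Rightarrow> 'v) set) category"
  let ?F = "induced_functor negligible_rel (restriction_functor r) ::
    (('v, 'a) supermodule, ('v \<Rightarrow> 'v) set, ('v, 'b) supermodule, ('v \<Rightarrow> 'v) set) cat_functor"
  let ?R = "restrict_module r"
  have obj: "obj ?C = {M. g_module G M \<and> finite_dim M}" "obj ?D = {M. g_module K M \<and> finite_dim M}"
    and hom: "\<And>M N. hom ?C M N = module_hom M N // negligible_rel M N"
      "\<And>M N. hom ?D M N = module_hom M N // negligible_rel M N"
    and ident: "\<And>M. ident ?C M = negligible_rel M M `` {\<lambda>v. if v \<in> carr M then v else 0}"
      "\<And>M. ident ?D M = negligible_rel M M `` {\<lambda>v. if v \<in> carr M then v else 0}"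
    by (simp_all add: semisimplification_def quotient_category_def rep_category_def)
  have F_obj: "on_obj ?F M = ?R M" for M
    by (simp add: induced_functor_def restriction_functor_def)
  \<comment> \<open>The equality serves twice: one inclusion is the typing condition of a functor,
    the other is surjectivity on morphisms.\<close>
  have image: "on_mor ?F M N ` hom ?C M N = hom ?D (?R M) (?R N)" if MN: "M \<in> obj ?C" "N \<in> obj ?C" for M N
  proof -
    have M: "g_module G M" "finite_dim M" and N: "g_module G N" "finite_dim N" using MN by (auto simp: obj)
    interpret R: fd_pair "?R M" "?R N"
      using M N by (simp add: fd_pair_def fd_supermodule_restrict)
    have "on_mor ?F M N ` hom ?C M N = (\<lambda>f. negligible_rel (?R M) (?R N) `` {f}) ` module_hom M N"
    proof -
      have "hom ?C M N = (\<lambda>f. negligible_rel M N `` {f}) ` module_hom M N"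
        unfolding hom quotient_def by blast
      then show ?thesis by (simp add: image_image induced_functor_class[OF M N] cong: image_cong)
    qed
    also have "\<dots> = hom ?D (?R M) (?R N)"
    proof (intro equalityI subsetI)
      fix c assume "c \<in> (\<lambda>f. negligible_rel (?R M) (?R N) `` {f}) ` module_hom M N"
      then show "c \<in> hom ?D (?R M) (?R N)"
        using module_hom_restrict[OF M N] by (auto simp: hom quotient_def)
    next
      fix c assume "c \<in> hom ?D (?R M) (?R N)"
      then obtain f where f: "f \<in> module_hom (?R M) (?R N)" "c = negligible_rel (?R M) (?R N) `` {f}"
        by (auto simp: hom quotient_def)
      \<comment> \<open>A class over K is hit because its representative \<open>f\<close> is
        congruent over K to a G-morphism.\<close>
      obtain f' where "f' \<in> module_hom M N" "(f', f) \<in> negligible_rel (?R M) (?R N)"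
        using equivariant_approximation[OF M N f(1)] by metis
      then show "c \<in> (\<lambda>f. negligible_rel (?R M) (?R N) `` {f}) ` module_hom M N"
        using equiv_class_eq[OF R.negligible_equiv] f(2) by blast
    qed
    finally show ?thesis .
  qed
  have "on_mor ?F L N (cmp ?C L M N d c) =
      cmp ?D (?R L) (?R M) (?R N) (on_mor ?F M N d) (on_mor ?F L M c)"
    if LMN: "L \<in> obj ?C" "M \<in> obj ?C" "N \<in> obj ?C" and c: "c \<in> hom ?C L M" and d: "d \<in> hom ?C M N"
    for L M N c d
  proof -
    have L: "g_module G L" "finite_dim L" and M: "g_module G M" "finite_dim M"
      and N: "g_module G N" "finite_dim N" using LMN by (auto simp: obj)
    note sm = g_module_fd_supermodule[OF L] g_module_fd_supermodule[OF M] g_module_fd_supermodule[OF N]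
    note smR = fd_supermodule_restrict[OF L] fd_supermodule_restrict[OF M] fd_supermodule_restrict[OF N]
    obtain f g where f: "f \<in> module_hom L M" "c = negligible_rel L M `` {f}"
      and g: "g \<in> module_hom M N" "d = negligible_rel M N `` {g}"
      using c d by (auto simp: hom quotient_def)
    have gf: "g \<circ> f \<in> module_hom L N" by (rule module_hom_comp[OF sm f(1) g(1)])
    show ?thesis
      unfolding f(2) g(2) semisimplification_cmp[OF sm f(1) g(1)] induced_functor_class[OF L N gf]
        induced_functor_class[OF L M f(1)] induced_functor_class[OF M N g(1)]
      by (rule semisimplification_cmp[OF smR module_hom_restrict[OF L M f(1)] module_hom_restrict[OF M N g(1)],
            symmetric])
  qed
  moreover have "on_mor ?F M M (ident ?C M) = ident ?D (?R M)" if "M \<in> obj ?C" for M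
    using that module_hom_ident[OF g_module_fd_supermodule, of G M]
    by (simp add: obj ident induced_functor_class)
  moreover have "?R M \<in> obj ?D" if "M \<in> obj ?C" for M
    using that by (simp add: obj g_module_restrict)
  ultimately have "is_functor ?C ?D ?F"
    using image unfolding is_functor_def F_obj by blast
  with image show ?thesis by (simp add: full_functor_def F_obj)
qed

end

theorem theorem2p12:
  fixes G :: "'a::complex_algebra_1 supergroup"
    and K :: "'b::complex_algebra_1 supergroup"
    and r :: "'a \<Rightarrow> 'b"
  assumes "proper_pair G K r"
  shows "full_functor
    (semisimplification G :: (('v::complex_vector, 'a) supermodule, ('v \<Rightarrow> 'v) set) category)
    (semisimplification K :: (('v, 'b) supermodule, ('v \<Rightarrow> 'v) set) category)
    (induced_functor negligible_rel (restriction_functor r))"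
proof -
  obtain s x gr where "proper_splitting_pair G K r s x gr"
    using proper_pair_splitting[OF assms] .
  then show ?thesis by (rule proper_splitting_pair.full_induced_functor)
qed

end
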